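(* Let $M$ be a compact Riemannian manifold and let $X$ be a smooth vector field on $M$. Then: (i) if $X$ is a Killing vector field, then $X$ is global Jacobi and solenoidal; (ii) if $X$ is a global Jacobi field, then $X$ is Killing and solenoidal.
   Context: Manifolds are smooth and without boundary. Let $\nabla$ be the Levi-Civita connection and $R_{V,W}=\nabla_V\nabla_W-\nabla_W\nabla_V-\nabla_{[V,W]}$ the curvature. A vector field $X$ is Killing if $L_Xg=0$, where $g$ is the metric. It is called a global Jacobi field if its restriction to every geodesic $\gamma$ of $M$ is a Jacobi field along $\gamma$, i.e. $\nabla_{\dot\gamma}\nabla_{\dot\gamma}X=R_{\dot\gamma,X}\dot\gamma$ along $\gamma$. It is called solenoidal if $\operatorname{div}X=0$ on $M$. Orientability is not assumed; $\operatorname{div}X$ is the trace of $V\mapsto\nabla_VX$. *)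

theory Defs
  imports "HOL-Analysis.Analysis"
begin

section \<open>The model space\<close>

text \<open>
  Charts take values in a type of sort \<open>{real_inner, heine_borel, banach}\<close>.  Among inner product
  spaces the Heine--Borel property characterises the finite-dimensional ones (the sort \<open>banach\<close>
  is then no restriction), so this means a Euclidean space of arbitrary finite
  dimension.  The class \<open>euclidean_space\<close> is not used because it excludes dimension 0.
\<close>

definition orthonormal :: "'e::real_inner set \<Rightarrow> bool" where
  "orthonormal B \<longleftrightarrow> pairwise orthogonal B \<and> (\<forall>b\<in>B. norm b = 1)"

lemma orthonormal_card_bound:
  "\<exists>n. \<forall>B::'e::{real_inner,heine_borel} set. orthonormal B \<longrightarrow> finite B \<and> card B \<le> n"
proof -
  have "compact (cball (0::'e) 1)"
    by (simp add: compact_eq_bounded_closed)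
  then obtain K :: "'e set" where K: "finite K" "cball 0 1 \<subseteq> (\<Union>x\<in>K. ball x (1/2))"
    unfolding compact_eq_totally_bounded using half_gt_zero[OF zero_less_one] by blast
  have "finite B \<and> card B \<le> card K" if B: "orthonormal B" for B :: "'e set"
  proof -
    have "\<exists>x\<in>K. dist x b < 1/2" if "b \<in> B" for b
    proof -
      have "b \<in> cball 0 1" using B that by (simp add: orthonormal_def)
      then have "b \<in> (\<Union>x\<in>K. ball x (1/2))" using K(2) by (rule rev_subsetD)
      then show ?thesis unfolding UN_iff mem_ball .
    qed
    then have "\<forall>b\<in>B. \<exists>x. x \<in> K \<and> dist x b < 1/2" by blast
    then obtain h where "\<forall>b\<in>B. h b \<in> K \<and> dist (h b) b < 1/2" by (auto dest!: bchoice)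
    then have h: "h b \<in> K \<and> dist (h b) b < 1/2" if "b \<in> B" for b using that by blast
    have "inj_on h B"
    proof (rule inj_onI, rule ccontr)
      fix a b assume ab: "a \<in> B" "b \<in> B" "h a = h b" "a \<noteq> b"
      have "dist a b < 1"
        using h[OF ab(1)] h[OF ab(2)] ab(3) dist_triangle_half_r[of "h a" a 1 b] by simp
      then have "norm (a - b) ^ 2 < 1"
        using power_strict_mono[of "norm (a - b)" 1 2] by (simp add: dist_norm)
      moreover have "norm (a - b) ^ 2 = norm a ^ 2 + norm b ^ 2"
        using B ab norm_add_Pythagorean[of a "- b"]
        by (simp add: orthonormal_def pairwise_def orthogonal_def)
      ultimately show False using B ab by (simp add: orthonormal_def)
    qed
    moreover have "h ` B \<subseteq> K" using h by auto
    ultimately show ?thesis using K(1) by (meson card_inj_on_le inj_on_finite)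
  qed
  then show ?thesis by blast
qed

lemma ex_orthonormal_basis:
  "\<exists>B::'e::{real_inner,heine_borel} set. finite B \<and> orthonormal B \<and> span B = UNIV"
proof -
  obtain n where n: "\<And>B::'e set. orthonormal B \<Longrightarrow> finite B \<and> card B \<le> n"
    using orthonormal_card_bound by blast
  have "orthonormal ({}::'e set)" by (simp add: orthonormal_def)
  then obtain B :: "'e set" where B: "orthonormal B"
      and mx: "\<And>C::'e set. orthonormal C \<Longrightarrow> card C \<le> card B"
    using ex_has_greatest_nat[of orthonormal "{}::'e set" card "Suc n"] n
    by (metis le_imp_less_Suc)
  have fin: "finite B" using n B by blast
  have "a \<in> span B" for a
  proof (rule ccontr)
    assume a: "a \<notin> span B"
    define r where "r = a - (\<Sum>b\<in>B. (a \<bullet> b) *\<^sub>R b)"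
    have "(\<Sum>b\<in>B. (a \<bullet> b) *\<^sub>R b) \<in> span B"
      by (intro span_sum span_scale span_base)
    then have r0: "r \<noteq> 0" using a by (auto simp: r_def)
    have bb: "b \<bullet> c = (if b = c then 1 else 0)" if "b \<in> B" "c \<in> B" for b c
      using B that by (auto simp: orthonormal_def pairwise_def orthogonal_def norm_eq_1)
    have rb: "r \<bullet> c = 0" if "c \<in> B" for c
    proof -
      have "(\<Sum>b\<in>B. (a \<bullet> b) *\<^sub>R b) \<bullet> c = (\<Sum>b\<in>B. if b = c then a \<bullet> b else 0)"
        unfolding inner_sum_left by (rule sum.cong) (auto simp: bb that)
      also have "\<dots> = a \<bullet> c" using fin that by simp
      finally show ?thesis by (simp add: r_def inner_diff_left)
    qed
    let ?u = "r /\<^sub>R norm r"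
    have "?u \<notin> B"
    proof
      assume "?u \<in> B"
      then have "r \<bullet> ?u = 0" by (rule rb)
      then show False using r0 by simp
    qed
    moreover have "orthonormal (insert ?u B)"
      using B rb r0 by (auto simp: orthonormal_def pairwise_insert orthogonal_def inner_commute)
    ultimately show False using mx[of "insert ?u B"] fin by simp
  qed
  then show ?thesis using B fin by blast
qed

definition lin_trace :: "('e::real_inner \<Rightarrow> 'e) \<Rightarrow> real" where
  "lin_trace L =
     (\<Sum>b\<in>(SOME B. finite B \<and> orthonormal B \<and> span B = UNIV). L b \<bullet> b)"

text \<open>Only to be used for open \<open>S\<close>.  As the domain is finite-dimensional, continuity of all iterated
  directional derivatives is the usual notion of being k times continuously differentiable.\<close>

primrec Ck_on :: "nat \<Rightarrow> 'e::real_normed_vector set \<Rightarrow> ('e \<Rightarrow> 'f::real_normed_vector) \<Rightarrow> bool" where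
  "Ck_on 0 S f \<longleftrightarrow> continuous_on S f"
| "Ck_on (Suc k) S f \<longleftrightarrow>
     (\<forall>x\<in>S. f differentiable (at x)) \<and>
     (\<forall>v. Ck_on k S (\<lambda>x. frechet_derivative f (at x) v))"

definition smooth_on :: "'e::real_normed_vector set \<Rightarrow> ('e \<Rightarrow> 'f::real_normed_vector) \<Rightarrow> bool" where
  "smooth_on S f \<longleftrightarrow> (\<forall>k. Ck_on k S f)"

section \<open>Smooth manifolds\<close>

type_synonym ('a, 'e) chart = "'a set \<times> ('a \<Rightarrow> 'e)"

abbreviation cdom :: "('a, 'e) chart \<Rightarrow> 'a set" where "cdom c \<equiv> fst c"

abbreviation cmap :: "('a, 'e) chart \<Rightarrow> 'a \<Rightarrow> 'e" where "cmap c \<equiv> snd c"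

definition cinv :: "('a, 'e) chart \<Rightarrow> 'e \<Rightarrow> 'a" where
  "cinv c = inv_into (cdom c) (cmap c)"

definition is_chart :: "('a::topological_space, 'e::real_normed_vector) chart \<Rightarrow> bool" where
  "is_chart c \<longleftrightarrow> open (cdom c) \<and> open (cmap c ` cdom c) \<and>
     homeomorphism (cdom c) (cmap c ` cdom c) (cmap c) (cinv c)"

text \<open>The manifold is the union of the chart domains; the atlas need not be maximal.  Hausdorff
  and second countable are imposed through the sort of the point type.\<close>

definition mcarrier :: "('a, 'e) chart set \<Rightarrow> 'a set" where
  "mcarrier A = (\<Union>c\<in>A. cdom c)"

definition smooth_atlas ::
    "('a::{t2_space,second_countable_topology}, 'e::real_normed_vector) chart set \<Rightarrow> bool" where
  "smooth_atlas A \<longleftrightarrow> (\<forall>c\<in>A. is_chart c) \<and>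
     (\<forall>c\<in>A. \<forall>d\<in>A. smooth_on (cmap c ` (cdom c \<inter> cdom d)) (cmap d \<circ> cinv c))"

definition chart_at :: "('a, 'e) chart set \<Rightarrow> 'a \<Rightarrow> ('a, 'e) chart" where
  "chart_at A p = (SOME c. c \<in> A \<and> p \<in> cdom c)"

definition smooth_function_on ::
    "('a, 'e::real_normed_vector) chart set \<Rightarrow> 'a set \<Rightarrow> ('a \<Rightarrow> real) \<Rightarrow> bool" where
  "smooth_function_on A U f \<longleftrightarrow> (\<forall>c\<in>A. smooth_on (cmap c ` (U \<inter> cdom c)) (f \<circ> cinv c))"

section \<open>Tangent vectors and vector fields\<close>

text \<open>A tangent vector at \<open>p\<close> is the family of its components in all charts of the atlas
  around \<open>p\<close>, related by the derivatives of the transition maps; the components in all other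
  charts are set to 0.\<close>

type_synonym ('a, 'e) tvec = "('a, 'e) chart \<Rightarrow> 'e"

type_synonym ('a, 'e) vfield = "'a \<Rightarrow> ('a, 'e) tvec"

definition tangent_space ::
    "('a, 'e::real_normed_vector) chart set \<Rightarrow> 'a \<Rightarrow> ('a, 'e) tvec set" where
  "tangent_space A p =
     {v. (\<forall>c. \<not> (c \<in> A \<and> p \<in> cdom c) \<longrightarrow> v c = 0) \<and>
         (\<forall>c\<in>A. \<forall>d\<in>A. p \<in> cdom c \<inter> cdom d \<longrightarrow>
            v d = frechet_derivative (cmap d \<circ> cinv c) (at (cmap c p)) (v c))}"

definition tzero :: "('a, 'e::real_normed_vector) tvec" where
  "tzero = (\<lambda>c. 0)"

definition tadd :: "('a, 'e::real_normed_vector) tvec \<Rightarrow> ('a, 'e) tvec \<Rightarrow> ('a, 'e) tvec" where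
  "tadd v w = (\<lambda>c. v c + w c)"

definition tscale :: "real \<Rightarrow> ('a, 'e::real_normed_vector) tvec \<Rightarrow> ('a, 'e) tvec" where
  "tscale r v = (\<lambda>c. r *\<^sub>R v c)"

definition tdiff :: "('a, 'e::real_normed_vector) tvec \<Rightarrow> ('a, 'e) tvec \<Rightarrow> ('a, 'e) tvec" where
  "tdiff v w = (\<lambda>c. v c - w c)"

definition smooth_vfield_on ::
    "('a, 'e::real_normed_vector) chart set \<Rightarrow> 'a set \<Rightarrow> ('a, 'e) vfield \<Rightarrow> bool" where
  "smooth_vfield_on A U X \<longleftrightarrow> (\<forall>p\<in>U. X p \<in> tangent_space A p) \<and>
     (\<forall>c\<in>A. smooth_on (cmap c ` (U \<inter> cdom c)) (\<lambda>x. X (cinv c x) c))"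

text \<open>The vector field on \<open>cdom c\<close> whose component in the chart \<open>c\<close> is the constant \<open>u\<close>.\<close>

definition coord_field ::
    "('a, 'e::real_normed_vector) chart set \<Rightarrow> ('a, 'e) chart \<Rightarrow> 'e \<Rightarrow> ('a, 'e) vfield" where
  "coord_field A c u = (\<lambda>p d.
     if p \<in> cdom c \<and> d \<in> A \<and> p \<in> cdom d
     then frechet_derivative (cmap d \<circ> cinv c) (at (cmap c p)) u else 0)"

text \<open>Some local smooth vector field extending the tangent vector \<open>v\<close> at \<open>p\<close>.\<close>

definition extend_at ::
    "('a, 'e::real_normed_vector) chart set \<Rightarrow> 'a \<Rightarrow> ('a, 'e) tvec \<Rightarrow> ('a, 'e) vfield" where
  "extend_at A p v = coord_field A (chart_at A p) (v (chart_at A p))"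

definition dir_deriv ::
    "('a, 'e::real_normed_vector) chart set \<Rightarrow> ('a \<Rightarrow> real) \<Rightarrow> 'a \<Rightarrow> ('a, 'e) tvec \<Rightarrow> real" where
  "dir_deriv A f p v = (let c = chart_at A p in
     frechet_derivative (f \<circ> cinv c) (at (cmap c p)) (v c))"

definition lie_bracket ::
    "('a, 'e::real_normed_vector) chart set \<Rightarrow> ('a, 'e) vfield \<Rightarrow> ('a, 'e) vfield \<Rightarrow> ('a, 'e) vfield"
  where
  "lie_bracket A V W = (\<lambda>p c.
     if c \<in> A \<and> p \<in> cdom c
     then frechet_derivative (\<lambda>x. W (cinv c x) c) (at (cmap c p)) (V p c)
        - frechet_derivative (\<lambda>x. V (cinv c x) c) (at (cmap c p)) (W p c)
     else 0)"

section \<open>Riemannian metrics and the Levi-Civita connection\<close>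

type_synonym ('a, 'e) metric = "'a \<Rightarrow> ('a, 'e) tvec \<Rightarrow> ('a, 'e) tvec \<Rightarrow> real"

definition riemannian_metric ::
    "('a::topological_space, 'e::real_normed_vector) chart set \<Rightarrow> ('a, 'e) metric \<Rightarrow> bool" where
  "riemannian_metric A g \<longleftrightarrow>
     (\<forall>p\<in>mcarrier A. \<forall>u\<in>tangent_space A p. \<forall>v\<in>tangent_space A p.
        g p u v = g p v u \<and>
        (\<forall>w\<in>tangent_space A p. g p (tadd u v) w = g p u w + g p v w) \<and>
        (\<forall>r. g p (tscale r u) v = r * g p u v) \<and>
        (u \<noteq> tzero \<longrightarrow> g p u u > 0)) \<and>
     (\<forall>U V W. open U \<and> U \<subseteq> mcarrier A \<and> smooth_vfield_on A U V \<and> smooth_vfield_on A U W \<longrightarrow>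
        smooth_function_on A U (\<lambda>p. g p (V p) (W p)))"

type_synonym ('a, 'e) connection = "('a, 'e) vfield \<Rightarrow> ('a, 'e) vfield \<Rightarrow> ('a, 'e) vfield"

text \<open>\<open>nabla V Y\<close> is the covariant derivative of \<open>Y\<close> in direction \<open>V\<close>.  As usual the connection is
  taken to act on vector fields defined on arbitrary open subsets \<open>U\<close> of the manifold, compatibly
  with restriction.\<close>

definition affine_connection ::
    "('a::topological_space, 'e::real_normed_vector) chart set \<Rightarrow> ('a, 'e) connection \<Rightarrow> bool" where
  "affine_connection A nabla \<longleftrightarrow> (\<forall>U. open U \<and> U \<subseteq> mcarrier A \<longrightarrow>
     (\<forall>V Y. smooth_vfield_on A U V \<and> smooth_vfield_on A U Y \<longrightarrow>
        smooth_vfield_on A U (nabla V Y) \<and>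
        (\<forall>V' Y'. (\<forall>p\<in>U. V' p = V p \<and> Y' p = Y p) \<longrightarrow> (\<forall>p\<in>U. nabla V' Y' p = nabla V Y p)) \<and>
        (\<forall>V'. smooth_vfield_on A U V' \<longrightarrow>
           (\<forall>p\<in>U. nabla (\<lambda>q. tadd (V q) (V' q)) Y p = tadd (nabla V Y p) (nabla V' Y p))) \<and>
        (\<forall>Y'. smooth_vfield_on A U Y' \<longrightarrow>
           (\<forall>p\<in>U. nabla V (\<lambda>q. tadd (Y q) (Y' q)) p = tadd (nabla V Y p) (nabla V Y' p))) \<and>
        (\<forall>f. smooth_function_on A U f \<longrightarrow>
           (\<forall>p\<in>U. nabla (\<lambda>q. tscale (f q) (V q)) Y p = tscale (f p) (nabla V Y p) \<and>
                  nabla V (\<lambda>q. tscale (f q) (Y q)) p =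
                    tadd (tscale (dir_deriv A f p (V p)) (Y p)) (tscale (f p) (nabla V Y p))))))"

definition torsion_free ::
    "('a::topological_space, 'e::real_normed_vector) chart set \<Rightarrow> ('a, 'e) connection \<Rightarrow> bool" where
  "torsion_free A nabla \<longleftrightarrow> (\<forall>U V W. open U \<and> U \<subseteq> mcarrier A \<and>
     smooth_vfield_on A U V \<and> smooth_vfield_on A U W \<longrightarrow>
     (\<forall>p\<in>U. tdiff (nabla V W p) (nabla W V p) = lie_bracket A V W p))"

definition metric_compatible ::
    "('a::topological_space, 'e::real_normed_vector) chart set \<Rightarrow> ('a, 'e) metric \<Rightarrow>
     ('a, 'e) connection \<Rightarrow> bool" where
  "metric_compatible A g nabla \<longleftrightarrow> (\<forall>U V Y Z. open U \<and> U \<subseteq> mcarrier A \<and>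
     smooth_vfield_on A U V \<and> smooth_vfield_on A U Y \<and> smooth_vfield_on A U Z \<longrightarrow>
     (\<forall>p\<in>U. dir_deriv A (\<lambda>q. g q (Y q) (Z q)) p (V p) =
        g p (nabla V Y p) (Z p) + g p (Y p) (nabla V Z p)))"

definition levi_civita ::
    "('a::topological_space, 'e::real_normed_vector) chart set \<Rightarrow> ('a, 'e) metric \<Rightarrow>
     ('a, 'e) connection \<Rightarrow> bool" where
  "levi_civita A g nabla \<longleftrightarrow>
     affine_connection A nabla \<and> torsion_free A nabla \<and> metric_compatible A g nabla"

definition curvature ::
    "('a, 'e::real_normed_vector) chart set \<Rightarrow> ('a, 'e) connection \<Rightarrow>
     ('a, 'e) vfield \<Rightarrow> ('a, 'e) vfield \<Rightarrow> ('a, 'e) vfield \<Rightarrow> ('a, 'e) vfield" where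
  "curvature A nabla V W Y = (\<lambda>p.
     tdiff (tdiff (nabla V (nabla W Y) p) (nabla W (nabla V Y) p)) (nabla (lie_bracket A V W) Y p))"

text \<open>The curvature is tensorial, so its value on tangent vectors can be computed with arbitrary
  local extensions.\<close>

definition curvature_at ::
    "('a, 'e::real_normed_vector) chart set \<Rightarrow> ('a, 'e) connection \<Rightarrow>
     'a \<Rightarrow> ('a, 'e) tvec \<Rightarrow> ('a, 'e) tvec \<Rightarrow> ('a, 'e) tvec \<Rightarrow> ('a, 'e) tvec" where
  "curvature_at A nabla p v w y =
     curvature A nabla (extend_at A p v) (extend_at A p w) (extend_at A p y) p"

section \<open>Geodesics and Jacobi fields\<close>

definition smooth_curve_on ::
    "('a::topological_space, 'e::real_normed_vector) chart set \<Rightarrow> real set \<Rightarrow> (real \<Rightarrow> 'a) \<Rightarrow> bool"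
  where
  "smooth_curve_on A J \<gamma> \<longleftrightarrow> continuous_on J \<gamma> \<and> \<gamma> ` J \<subseteq> mcarrier A \<and>
     (\<forall>c\<in>A. smooth_on (J \<inter> \<gamma> -` cdom c) (cmap c \<circ> \<gamma>))"

definition velocity ::
    "('a, 'e::real_normed_vector) chart set \<Rightarrow> (real \<Rightarrow> 'a) \<Rightarrow> real \<Rightarrow> ('a, 'e) tvec" where
  "velocity A \<gamma> t = (\<lambda>c.
     if c \<in> A \<and> \<gamma> t \<in> cdom c then vector_derivative (cmap c \<circ> \<gamma>) (at t) else 0)"

text \<open>Component in the chart \<open>c\<close> of the covariant derivative at \<open>p\<close> of the coordinate field \<open>v\<close> in
  direction of the coordinate field \<open>u\<close>, i.e. the Christoffel symbols.\<close>

definition christoffel ::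
    "('a, 'e::real_normed_vector) chart set \<Rightarrow> ('a, 'e) connection \<Rightarrow>
     ('a, 'e) chart \<Rightarrow> 'a \<Rightarrow> 'e \<Rightarrow> 'e \<Rightarrow> 'e" where
  "christoffel A nabla c p u v = nabla (coord_field A c u) (coord_field A c v) p c"

text \<open>Covariant derivative, along the curve \<open>\<gamma>\<close>, of a vector field \<open>Z\<close> along \<open>\<gamma>\<close>
  (\<open>Z t\<close> is tangent at \<open>\<gamma> t\<close>).\<close>

definition cov_along ::
    "('a, 'e::real_normed_vector) chart set \<Rightarrow> ('a, 'e) connection \<Rightarrow> (real \<Rightarrow> 'a) \<Rightarrow>
     (real \<Rightarrow> ('a, 'e) tvec) \<Rightarrow> real \<Rightarrow> ('a, 'e) tvec" where
  "cov_along A nabla \<gamma> Z t = (\<lambda>c.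
     if c \<in> A \<and> \<gamma> t \<in> cdom c
     then vector_derivative (\<lambda>s. Z s c) (at t)
        + christoffel A nabla c (\<gamma> t) (velocity A \<gamma> t c) (Z t c)
     else 0)"

definition geodesic_on ::
    "('a::topological_space, 'e::real_normed_vector) chart set \<Rightarrow> ('a, 'e) connection \<Rightarrow>
     real set \<Rightarrow> (real \<Rightarrow> 'a) \<Rightarrow> bool" where
  "geodesic_on A nabla J \<gamma> \<longleftrightarrow> open J \<and> is_interval J \<and> smooth_curve_on A J \<gamma> \<and>
     (\<forall>t\<in>J. cov_along A nabla \<gamma> (velocity A \<gamma>) t = tzero)"

definition jacobi_along ::
    "('a, 'e::real_normed_vector) chart set \<Rightarrow> ('a, 'e) connection \<Rightarrow>
     real set \<Rightarrow> (real \<Rightarrow> 'a) \<Rightarrow> (real \<Rightarrow> ('a, 'e) tvec) \<Rightarrow> bool" where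
  "jacobi_along A nabla J \<gamma> Z \<longleftrightarrow> (\<forall>t\<in>J.
     cov_along A nabla \<gamma> (cov_along A nabla \<gamma> Z) t =
       curvature_at A nabla (\<gamma> t) (velocity A \<gamma> t) (Z t) (velocity A \<gamma> t))"

definition global_jacobi ::
    "('a::topological_space, 'e::real_normed_vector) chart set \<Rightarrow> ('a, 'e) connection \<Rightarrow>
     ('a, 'e) vfield \<Rightarrow> bool" where
  "global_jacobi A nabla X \<longleftrightarrow>
     (\<forall>J \<gamma>. geodesic_on A nabla J \<gamma> \<longrightarrow> jacobi_along A nabla J \<gamma> (X \<circ> \<gamma>))"

section \<open>Killing and solenoidal fields\<close>

definition lie_deriv_metric ::
    "('a, 'e::real_normed_vector) chart set \<Rightarrow> ('a, 'e) metric \<Rightarrow>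
     ('a, 'e) vfield \<Rightarrow> ('a, 'e) vfield \<Rightarrow> ('a, 'e) vfield \<Rightarrow> 'a \<Rightarrow> real" where
  "lie_deriv_metric A g X V W p =
     dir_deriv A (\<lambda>q. g q (V q) (W q)) p (X p)
     - g p (lie_bracket A X V p) (W p) - g p (V p) (lie_bracket A X W p)"

definition killing ::
    "('a::topological_space, 'e::real_normed_vector) chart set \<Rightarrow> ('a, 'e) metric \<Rightarrow>
     ('a, 'e) vfield \<Rightarrow> bool" where
  "killing A g X \<longleftrightarrow> (\<forall>U V W. open U \<and> U \<subseteq> mcarrier A \<and>
     smooth_vfield_on A U V \<and> smooth_vfield_on A U W \<longrightarrow>
     (\<forall>p\<in>U. lie_deriv_metric A g X V W p = 0))"

text \<open>The trace of \<open>v \<mapsto> nabla v X\<close> on the tangent space at \<open>p\<close>, computed in a chart.\<close>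

definition divergence ::
    "('a, 'e::real_inner) chart set \<Rightarrow> ('a, 'e) connection \<Rightarrow> ('a, 'e) vfield \<Rightarrow> 'a \<Rightarrow> real" where
  "divergence A nabla X p = (let c = chart_at A p in
     lin_trace (\<lambda>u. nabla (coord_field A c u) X p c))"

definition solenoidal ::
    "('a, 'e::real_inner) chart set \<Rightarrow> ('a, 'e) connection \<Rightarrow> ('a, 'e) vfield \<Rightarrow> bool" where
  "solenoidal A nabla X \<longleftrightarrow> (\<forall>p\<in>mcarrier A. divergence A nabla X p = 0)"

end

theory Submission
  imports Defs
begin

text \<open>
  In a chart the connection is \<open>\<nabla>\<^sub>V Y = DY(V) + \<Gamma>(V,Y)\<close>.  A field \<open>X\<close> is Killing iff
  \<open>v \<mapsto> \<nabla>\<^sub>v X\<close> is skew for the metric; a skew map has trace 0, and Kostant's argument (Ricci identity,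
  skewness of \<open>\<nabla>\<^sup>2X\<close> and pair symmetry of the curvature) gives \<open>\<nabla>\<^sup>2\<^bsub>u,u\<^esub> X = R(u,X)u\<close>, which is the
  Jacobi equation along geodesics.

  Conversely, if \<open>X\<close> is a Jacobi field along a geodesic with velocity \<open>v\<close>, then \<open>a = g(\<nabla>\<^sub>v X, v)\<close> is
  constant and \<open>b = g(X,v)\<close> is affine with slope \<open>a\<close>.  Geodesic completeness is not needed: the set of
  all pairs \<open>(a,b)\<close> over the unit tangent bundle is compact, and short geodesics move \<open>(a,b)\<close>
  to \<open>(a, b + t a)\<close> within it, so a pair with maximal \<open>b\<close> for given \<open>a\<close> shows \<open>a = 0\<close>.
\<close>

section \<open>Calculus of smooth functions\<close>

text \<open>Along a geodesic with velocity v the derivative of g(X,v) is g(\<nabla>_v X, v), and the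
  derivative of the latter is g(R(v,X)v, v), which vanishes because R(v,X) is skew; hence
  \<open>a\<close> and \<open>b\<close>. Pairs of reals replace unit vectors because tangent
  vectors, being families indexed by charts, carry no topology here; the set of pairs is compact as
  a finite union of continuous images of compact coordinate pieces. The main obstacle is that
  \<open>nabla\<close> is an abstract operator on vector fields, whereas geodesics and Jacobi fields
  are defined by components. Locality and function-linearity, applied to expansions in a fixed
  finite orthonormal basis, recover the coordinate formula; the geometry then takes place in a
  locale that knows only Christoffel symbols and metric coefficients on an open set. The same
  expansion serves the calculus: \<open>Ck_on\<close> controls derivatives in fixed directions,
  while the chain rule produces directions that move with the point.\<close>

definition obase :: "'e::real_inner set" where
  "obase = (SOME B. finite B \<and> orthonormal B \<and> span B = UNIV)"

lemma
  shows finite_obase: "finite (obase :: 'e::{real_inner,heine_borel} set)"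
    and orthonormal_obase: "orthonormal (obase :: 'e set)"
    and span_obase: "span (obase :: 'e set) = UNIV"
  using someI_ex[OF ex_orthonormal_basis[where 'e='e]] unfolding obase_def by auto

lemma lin_trace_obase: "lin_trace L = (\<Sum>b\<in>obase. L b \<bullet> b)"
  by (simp add: lin_trace_def obase_def)

lemma inner_obase:
  fixes b c :: "'e::{real_inner,heine_borel}"
  assumes "b \<in> obase" "c \<in> obase"
  shows "b \<bullet> c = (if b = c then 1 else 0)"
  using orthonormal_obase assms by (auto simp: orthonormal_def pairwise_def orthogonal_def norm_eq_1)

lemma obase_expand:
  fixes x :: "'e::{real_inner,heine_borel}"
  shows "(\<Sum>b\<in>obase. (x \<bullet> b) *\<^sub>R b) = x"
proof -
  have "x \<in> span obase" by (simp add: span_obase)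
  then obtain u where u: "x = (\<Sum>b\<in>obase. u b *\<^sub>R b)"
    by (auto simp: span_finite[OF finite_obase])
  have "x \<bullet> b = u b" if "b \<in> obase" for b
  proof -
    have "x \<bullet> b = (\<Sum>c\<in>obase. if c = b then u c else 0)"
      unfolding u inner_sum_left by (rule sum.cong) (auto simp: inner_obase that)
    then show ?thesis using that by (simp add: finite_obase)
  qed
  then have "(\<Sum>b\<in>obase. (x \<bullet> b) *\<^sub>R b) = (\<Sum>b\<in>obase. u b *\<^sub>R b)"
    by (intro sum.cong) auto
  then show ?thesis using u by simp
qed

text \<open>Trades a varying argument for finitely many fixed ones; the later rules for a linear map
  applied to a moving vector rest on this.\<close>

lemma linear_obase_expand:
  fixes L :: "'e::{real_inner,heine_borel} \<Rightarrow> 'f::real_vector"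
  assumes "linear L"
  shows "L x = (\<Sum>b\<in>obase. (x \<bullet> b) *\<^sub>R L b)"
proof -
  have "L x = L (\<Sum>b\<in>obase. (x \<bullet> b) *\<^sub>R b)" by (simp add: obase_expand)
  also have "\<dots> = (\<Sum>b\<in>obase. (x \<bullet> b) *\<^sub>R L b)"
    by (simp add: linear_sum[OF assms] linear_scale[OF assms])
  finally show ?thesis .
qed

lemma norm_linear_obase_le:
  fixes L :: "'e::{real_inner,heine_borel} \<Rightarrow> 'f::real_normed_vector"
  assumes "linear L"
  shows "norm (L x) \<le> (\<Sum>b\<in>obase. norm (L b)) * norm x"
proof -
  have "norm (L x) \<le> (\<Sum>b\<in>obase. norm ((x \<bullet> b) *\<^sub>R L b))"
    by (subst linear_obase_expand[OF assms]) (rule norm_sum)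
  also have "\<dots> \<le> (\<Sum>b\<in>obase. norm (L b) * norm x)"
  proof (rule sum_mono)
    fix b :: 'e assume "b \<in> obase"
    then have "norm b = 1" using orthonormal_obase by (auto simp: orthonormal_def)
    then have "\<bar>x \<bullet> b\<bar> \<le> norm x" using Cauchy_Schwarz_ineq2[of x b] by simp
    then show "norm ((x \<bullet> b) *\<^sub>R L b) \<le> norm (L b) * norm x"
      by (simp add: mult.commute[of _ "norm (L b)"] mult_left_mono)
  qed
  finally show ?thesis by (simp add: sum_distrib_right)
qed

lemma frechet_derivative_eq: "(f has_derivative f') (at x) \<Longrightarrow> frechet_derivative f (at x) = f'"
  using frechet_derivative_at by metis

lemma differentiable_has_derivative:
  "f differentiable (at x) \<Longrightarrow> (f has_derivative frechet_derivative f (at x)) (at x)"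
  using frechet_derivative_works by blast

section \<open>Closure properties of C^k functions\<close>

lemma Ck_on_cong:
  assumes "open S" "\<And>x. x \<in> S \<Longrightarrow> f x = g x"
  shows "Ck_on k S f \<longleftrightarrow> Ck_on k S g"
proof -
  have imp: "Ck_on k S g" if "Ck_on k S f" "\<And>x. x \<in> S \<Longrightarrow> f x = g x" for f g
    using that
  proof (induction k arbitrary: f g)
    case 0
    then show ?case using continuous_on_cong[of S S f g] by auto
  next
    case (Suc k)
    have d: "(g has_derivative frechet_derivative f (at x)) (at x)" if "x \<in> S" for x
      by (rule has_derivative_transform_within_open[OF differentiable_has_derivative \<open>open S\<close> that])
        (use Suc.prems that in auto)
    then have e: "frechet_derivative g (at x) = frechet_derivative f (at x)" if "x \<in> S" for x
      using that by (simp add: frechet_derivative_eq)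
    have "Ck_on k S (\<lambda>x. frechet_derivative g (at x) v)" for v
      by (rule Suc.IH[of "\<lambda>x. frechet_derivative f (at x) v"]) (use Suc.prems e in auto)
    then show ?case using d by (auto simp: differentiable_def)
  qed
  show ?thesis using imp[of f g] imp[of g f] assms(2) by auto
qed

lemma Ck_on_SucI:
  assumes "open S" "\<And>x. x \<in> S \<Longrightarrow> (f has_derivative f' x) (at x)"
    and "\<And>v. Ck_on k S (\<lambda>x. f' x v)"
  shows "Ck_on (Suc k) S f"
proof -
  have "Ck_on k S (\<lambda>x. frechet_derivative f (at x) v)" for v
    by (rule iffD1[OF Ck_on_cong[OF assms(1)] assms(3)[of v]])
      (simp add: frechet_derivative_eq[OF assms(2)])
  then show ?thesis using assms(2) by (auto simp: differentiable_def)
qed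

lemma Ck_on_SucD: "Ck_on (Suc k) S f \<Longrightarrow> Ck_on k S f"
proof (induction k arbitrary: f)
  case 0
  then show ?case
    by (auto intro!: continuous_at_imp_continuous_on differentiable_imp_continuous_within)
next
  case (Suc k)
  then show ?case by (metis Ck_on.simps(2))
qed

lemma Ck_on_subset: "Ck_on k S f \<Longrightarrow> T \<subseteq> S \<Longrightarrow> Ck_on k T f"
  by (induction k arbitrary: f) (auto intro: continuous_on_subset)

lemma Ck_on_bounded_linear:
  assumes "bounded_linear L" "open S" "Ck_on k S f"
  shows "Ck_on k S (\<lambda>x. L (f x))"
  using assms(3)
proof (induction k arbitrary: f)
  case 0
  then show ?case using bounded_linear.continuous_on[OF assms(1)] by auto
next
  case (Suc k)
  show ?case
  proof (rule Ck_on_SucI[OF assms(2)])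
    show "((\<lambda>x. L (f x)) has_derivative (\<lambda>v. L (frechet_derivative f (at x) v))) (at x)"
      if "x \<in> S" for x
      using Suc.prems that
      by (intro bounded_linear.has_derivative[OF assms(1)] differentiable_has_derivative) auto
  qed (use Suc in auto)
qed

lemma Ck_on_add:
  assumes "open S" "Ck_on k S f" "Ck_on k S g"
  shows "Ck_on k S (\<lambda>x. f x + g x)"
  using assms(2,3)
proof (induction k arbitrary: f g)
  case 0
  then show ?case by (auto intro: continuous_on_add)
next
  case (Suc k)
  show ?case
  proof (rule Ck_on_SucI[OF assms(1)])
    show "((\<lambda>x. f x + g x) has_derivative
        (\<lambda>v. frechet_derivative f (at x) v + frechet_derivative g (at x) v)) (at x)"
      if "x \<in> S" for x
      using Suc.prems that by (intro has_derivative_add differentiable_has_derivative) auto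
  qed (use Suc in auto)
qed

lemma Ck_on_const: "Ck_on k S (\<lambda>x. c)"
  by (induction k arbitrary: c) auto

text \<open>The induction runs over both factors at once: the Leibniz rule differentiates one and
  keeps the other, whose regularity is lowered by \<open>Ck_on_SucD\<close> to fit the induction
  hypothesis.\<close>

lemma Ck_on_bilinear:
  assumes "bounded_bilinear pr" "open S" "Ck_on k S f" "Ck_on k S g"
  shows "Ck_on k S (\<lambda>x. pr (f x) (g x))"
  using assms(3,4)
proof (induction k arbitrary: f g)
  case 0
  then show ?case using bounded_bilinear.continuous_on[OF assms(1)] by auto
next
  case (Suc k)
  show ?case
  proof (rule Ck_on_SucI[OF assms(2)])
    show "((\<lambda>x. pr (f x) (g x)) has_derivative
        (\<lambda>v. pr (f x) (frechet_derivative g (at x) v) + pr (frechet_derivative f (at x) v) (g x))) (at x)"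
      if "x \<in> S" for x
      using Suc.prems that
      by (intro bounded_bilinear.FDERIV[OF assms(1)] differentiable_has_derivative) auto
    show "Ck_on k S (\<lambda>x. pr (f x) (frechet_derivative g (at x) v)
        + pr (frechet_derivative f (at x) v) (g x))" for v
      by (rule Ck_on_add[OF assms(2)]; rule Suc.IH)
        (use Suc.prems Ck_on_SucD[OF Suc.prems(1)] Ck_on_SucD[OF Suc.prems(2)] in auto)
  qed
qed

lemma Ck_on_sum:
  assumes "open S" "\<And>i. i \<in> I \<Longrightarrow> Ck_on k S (f i)"
  shows "Ck_on k S (\<lambda>x. \<Sum>i\<in>I. f i x)"
  using assms(2)
  by (induction I rule: infinite_finite_induct) (auto intro: Ck_on_const Ck_on_add[OF assms(1)])

text \<open>The derivative of f at \<open>h x\<close> is applied to a vector depending on x.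
  Expanding that vector in \<open>obase\<close> leaves products of scalar functions with derivatives
  of f in fixed directions, composed with h, to which the induction hypothesis applies.\<close>

lemma Ck_on_compose:
  fixes f :: "'e::{real_inner,heine_borel} \<Rightarrow> 'f::real_normed_vector"
    and h :: "'d::real_normed_vector \<Rightarrow> 'e"
  assumes "open S" "Ck_on k T f" "Ck_on k S h" "h ` S \<subseteq> T"
  shows "Ck_on k S (\<lambda>x. f (h x))"
  using assms(2,3)
proof (induction k arbitrary: f)
  case 0
  then show ?case using continuous_on_compose2[of T f S h] assms(4) by auto
next
  case (Suc k)
  have d: "f differentiable (at (h x))" if "x \<in> S" for x
    using Suc.prems that assms(4) by auto
  show ?case
  proof (rule Ck_on_SucI[OF assms(1)])
    fix x assume x: "x \<in> S"
    have "((\<lambda>x. f (h x)) has_derivative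
        (\<lambda>v. frechet_derivative f (at (h x)) (frechet_derivative h (at x) v))) (at x)"
      by (rule has_derivative_compose[OF differentiable_has_derivative differentiable_has_derivative])
        (use x d Suc.prems in auto)
    also have "(\<lambda>v. frechet_derivative f (at (h x)) (frechet_derivative h (at x) v)) =
      (\<lambda>v. \<Sum>b\<in>obase. (frechet_derivative h (at x) v \<bullet> b) *\<^sub>R frechet_derivative f (at (h x)) b)"
      by (rule ext) (rule linear_obase_expand[OF linear_frechet_derivative[OF d[OF x]]])
    finally show "((\<lambda>x. f (h x)) has_derivative
        (\<lambda>v. \<Sum>b\<in>obase. (frechet_derivative h (at x) v \<bullet> b) *\<^sub>R frechet_derivative f (at (h x)) b))
        (at x)" .
  next
    fix v
    have 1: "Ck_on k S (\<lambda>x. frechet_derivative f (at (h x)) b)" for b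
      by (rule Suc.IH) (use Suc.prems Ck_on_SucD[OF Suc.prems(2)] in auto)
    have 2: "Ck_on k S (\<lambda>x. frechet_derivative h (at x) v \<bullet> b)" for b
      by (rule Ck_on_bounded_linear[OF bounded_linear_inner_left assms(1)]) (use Suc.prems in auto)
    show "Ck_on k S (\<lambda>x. \<Sum>b\<in>obase. (frechet_derivative h (at x) v \<bullet> b)
        *\<^sub>R frechet_derivative f (at (h x)) b)"
      by (intro Ck_on_sum assms(1) Ck_on_bilinear[OF bounded_bilinear_scaleR] 1 2)
  qed
qed

lemma Ck_on_id: "open S \<Longrightarrow> Ck_on k S (\<lambda>x. x)"
proof (induction k)
  case (Suc k)
  show ?case
    by (rule Ck_on_SucI[where f' = "\<lambda>x v. v"]) (use Suc Ck_on_const in auto)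
qed auto

section \<open>Smooth functions\<close>

lemma smooth_on_differentiable: "smooth_on S f \<Longrightarrow> x \<in> S \<Longrightarrow> f differentiable (at x)"
  unfolding smooth_on_def by (metis Ck_on.simps(2))

lemma smooth_on_has_derivative:
  "smooth_on S f \<Longrightarrow> x \<in> S \<Longrightarrow> (f has_derivative frechet_derivative f (at x)) (at x)"
  using smooth_on_differentiable differentiable_has_derivative by blast

lemma smooth_on_linear_derivative: "smooth_on S f \<Longrightarrow> x \<in> S \<Longrightarrow> linear (frechet_derivative f (at x))"
  using smooth_on_differentiable linear_frechet_derivative by blast

lemma smooth_on_continuous: "smooth_on S f \<Longrightarrow> continuous_on S f"
  unfolding smooth_on_def by (metis Ck_on.simps(1))

lemma smooth_on_derivative: "smooth_on S f \<Longrightarrow> smooth_on S (\<lambda>x. frechet_derivative f (at x) v)"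
  unfolding smooth_on_def by (metis Ck_on.simps(2))

lemma smooth_on_cong:
  "open S \<Longrightarrow> (\<And>x. x \<in> S \<Longrightarrow> f x = g x) \<Longrightarrow> smooth_on S f \<longleftrightarrow> smooth_on S g"
  unfolding smooth_on_def by (intro iff_allI Ck_on_cong)

lemma smooth_on_subset: "smooth_on S f \<Longrightarrow> T \<subseteq> S \<Longrightarrow> smooth_on T f"
  unfolding smooth_on_def using Ck_on_subset by blast

lemma smooth_on_const: "smooth_on S (\<lambda>x. c)"
  unfolding smooth_on_def using Ck_on_const by blast

lemma smooth_on_id: "open S \<Longrightarrow> smooth_on S (\<lambda>x. x)"
  unfolding smooth_on_def using Ck_on_id by blast

lemma smooth_on_bounded_linear:
  "bounded_linear L \<Longrightarrow> open S \<Longrightarrow> smooth_on S f \<Longrightarrow> smooth_on S (\<lambda>x. L (f x))"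
  unfolding smooth_on_def using Ck_on_bounded_linear by blast

lemma smooth_on_add:
  "open S \<Longrightarrow> smooth_on S f \<Longrightarrow> smooth_on S g \<Longrightarrow> smooth_on S (\<lambda>x. f x + g x)"
  unfolding smooth_on_def using Ck_on_add by blast

lemma smooth_on_minus:
  "open S \<Longrightarrow> smooth_on S f \<Longrightarrow> smooth_on S (\<lambda>x. - f x)"
  by (rule smooth_on_bounded_linear[OF bounded_linear_minus[OF bounded_linear_ident]])

lemma smooth_on_diff:
  "open S \<Longrightarrow> smooth_on S f \<Longrightarrow> smooth_on S g \<Longrightarrow> smooth_on S (\<lambda>x. f x - g x)"
  using smooth_on_add[of S f "\<lambda>x. - g x"] smooth_on_minus[of S g] by simp

lemma smooth_on_scaleR:
  "open S \<Longrightarrow> smooth_on S f \<Longrightarrow> smooth_on S g \<Longrightarrow> smooth_on S (\<lambda>x. f x *\<^sub>R g x)"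
  unfolding smooth_on_def using Ck_on_bilinear[OF bounded_bilinear_scaleR] by blast

lemma smooth_on_Pair:
  assumes "open S" "smooth_on S f" "smooth_on S g"
  shows "smooth_on S (\<lambda>x. (f x, g x))"
proof -
  have "smooth_on S (\<lambda>x. (f x, 0) + (0, g x))"
    by (intro smooth_on_add assms
        smooth_on_bounded_linear[OF bounded_linear_Pair[OF bounded_linear_ident bounded_linear_zero]]
        smooth_on_bounded_linear[OF bounded_linear_Pair[OF bounded_linear_zero bounded_linear_ident]])
  then show ?thesis by simp
qed

lemma smooth_on_sum:
  "open S \<Longrightarrow> (\<And>i. i \<in> I \<Longrightarrow> smooth_on S (f i)) \<Longrightarrow> smooth_on S (\<lambda>x. \<Sum>i\<in>I. f i x)"
  unfolding smooth_on_def by (intro allI Ck_on_sum) auto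

lemma smooth_on_compose:
  fixes f :: "'e::{real_inner,heine_borel} \<Rightarrow> 'f::real_normed_vector"
  assumes "open S" "smooth_on T f" "smooth_on S h" "h ` S \<subseteq> T"
  shows "smooth_on S (\<lambda>x. f (h x))"
  unfolding smooth_on_def
proof
  show "Ck_on k S (\<lambda>x. f (h x))" for k
    by (rule Ck_on_compose[OF assms(1) _ _ assms(4)]) (use assms(2,3) in \<open>auto simp: smooth_on_def\<close>)
qed

lemma smooth_on_linear_apply:
  fixes L :: "'d::real_normed_vector \<Rightarrow> 'e::{real_inner,heine_borel} \<Rightarrow> 'f::real_normed_vector"
  assumes "open S" "\<And>x. x \<in> S \<Longrightarrow> linear (L x)" "\<And>v. smooth_on S (\<lambda>x. L x v)" "smooth_on S u"
  shows "smooth_on S (\<lambda>x. L x (u x))"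
proof -
  have "smooth_on S (\<lambda>x. \<Sum>b\<in>obase. (u x \<bullet> b) *\<^sub>R L x b)"
    by (intro smooth_on_sum smooth_on_scaleR assms
        smooth_on_bounded_linear[OF bounded_linear_inner_left])
  moreover have "smooth_on S (\<lambda>x. L x (u x)) \<longleftrightarrow> smooth_on S (\<lambda>x. \<Sum>b\<in>obase. (u x \<bullet> b) *\<^sub>R L x b)"
    by (rule smooth_on_cong[OF assms(1) linear_obase_expand[OF assms(2)]])
  ultimately show ?thesis by simp
qed

lemma smooth_on_bilinear_apply:
  fixes L :: "'d::real_normed_vector \<Rightarrow> 'e::{real_inner,heine_borel} \<Rightarrow> 'e \<Rightarrow> 'f::real_normed_vector"
  assumes "open S" "\<And>x u. x \<in> S \<Longrightarrow> linear (L x u)" "\<And>x v. x \<in> S \<Longrightarrow> linear (\<lambda>u. L x u v)"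
    "\<And>u v. smooth_on S (\<lambda>x. L x u v)" "smooth_on S u" "smooth_on S v"
  shows "smooth_on S (\<lambda>x. L x (u x) (v x))"
proof -
  have w: "smooth_on S (\<lambda>x. L x w (v x))" for w
    by (rule smooth_on_linear_apply[OF assms(1,2) assms(4,6)])
  show ?thesis
    by (rule smooth_on_linear_apply[where L = "\<lambda>x w. L x w (v x)", OF assms(1) assms(3) w assms(5)])
qed

lemma smooth_on_directional:
  fixes f :: "'e::{real_inner,heine_borel} \<Rightarrow> 'f::real_normed_vector"
  assumes "open S" "smooth_on S f" "smooth_on S u"
  shows "smooth_on S (\<lambda>x. frechet_derivative f (at x) (u x))"
  by (rule smooth_on_linear_apply[OF assms(1) smooth_on_linear_derivative[OF assms(2)]
      smooth_on_derivative[OF assms(2)] assms(3)])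

section \<open>Leibniz rules for multilinear maps with moving arguments\<close>

text \<open>Differentiability of \<open>L\<close> is known only with its linear argument fixed.
  Expansion in \<open>obase\<close> gives a sum of scalar coefficients times such maps, to which the
  ordinary product rule applies.\<close>

lemma has_derivative_linear_apply:
  fixes L :: "'e::real_normed_vector \<Rightarrow> 'h::{real_inner,heine_borel} \<Rightarrow> 'f::real_normed_vector"
  assumes "open S" "x t \<in> S" "\<And>y. y \<in> S \<Longrightarrow> linear (L y)"
    and "\<And>v. (\<lambda>y. L y v) differentiable (at (x t))"
    and "(x has_derivative x') (at t)" "(u has_derivative u') (at t)"
  shows "((\<lambda>s. L (x s) (u s)) has_derivative
    (\<lambda>h. frechet_derivative (\<lambda>y. L y (u t)) (at (x t)) (x' h) + L (x t) (u' h))) (at t)"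
proof -
  have c: "((\<lambda>s. L (x s) v) has_derivative (\<lambda>h. frechet_derivative (\<lambda>y. L y v) (at (x t)) (x' h))) (at t)"
    for v by (rule has_derivative_compose[OF assms(5) differentiable_has_derivative[OF assms(4)]])
  have d: "((\<lambda>s. \<Sum>b\<in>obase. (u s \<bullet> b) *\<^sub>R L (x s) b) has_derivative
    (\<lambda>h. \<Sum>b\<in>obase. (u t \<bullet> b) *\<^sub>R frechet_derivative (\<lambda>y. L y b) (at (x t)) (x' h)
        + (u' h \<bullet> b) *\<^sub>R L (x t) b)) (at t)"
    by (intro has_derivative_sum has_derivative_scaleR c has_derivative_inner_left assms(6))
  \<comment> \<open>The sum over the basis is folded back into a single derivative with the argument
    frozen at \<open>u t\<close>.\<close>
  have e: "frechet_derivative (\<lambda>y. L y (u t)) (at (x t)) =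
      (\<lambda>w. \<Sum>b\<in>obase. (u t \<bullet> b) *\<^sub>R frechet_derivative (\<lambda>y. L y b) (at (x t)) w)"
  proof (rule frechet_derivative_eq, rule has_derivative_transform_within_open[OF _ assms(1,2)])
    show "((\<lambda>y. \<Sum>b\<in>obase. (u t \<bullet> b) *\<^sub>R L y b) has_derivative
      (\<lambda>w. \<Sum>b\<in>obase. (u t \<bullet> b) *\<^sub>R frechet_derivative (\<lambda>y. L y b) (at (x t)) w)) (at (x t))"
      by (intro has_derivative_sum has_derivative_scaleR_right differentiable_has_derivative assms(4))
  qed (rule linear_obase_expand[OF assms(3), symmetric])
  have f: "(\<lambda>h. \<Sum>b\<in>obase. (u t \<bullet> b) *\<^sub>R frechet_derivative (\<lambda>y. L y b) (at (x t)) (x' h)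
        + (u' h \<bullet> b) *\<^sub>R L (x t) b) =
      (\<lambda>h. frechet_derivative (\<lambda>y. L y (u t)) (at (x t)) (x' h) + L (x t) (u' h))"
    unfolding e sum.distrib linear_obase_expand[OF assms(3)[OF assms(2)], symmetric] by (rule refl)
  \<comment> \<open>The expansion holds only while \<open>x s\<close> lies in S, where
    \<open>L\<close> is linear; continuity of x supplies a neighbourhood of t on which it
    does.\<close>
  have "continuous (at t) x" using assms(5) has_derivative_continuous by blast
  then have "\<exists>T. open T \<and> t \<in> T \<and> (\<forall>s\<in>T. x s \<in> S)"
    using assms(1,2) unfolding continuous_at_open by blast
  then obtain T where T: "open T" "t \<in> T" "\<And>s. s \<in> T \<Longrightarrow> x s \<in> S" by blast
  show ?thesis
    by (rule has_derivative_transform_within_open[OF d[unfolded f] T(1,2)])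
      (rule linear_obase_expand[OF assms(3)[OF T(3)], symmetric])
qed

text \<open>The linear rule used twice: first with the first slot frozen at w, then for the family
  \<open>\<lambda>s w. L (x s) w (v s)\<close>, whose base point is the parameter s itself.\<close>

lemma has_derivative_bilinear_apply:
  fixes L :: "'e::real_normed_vector \<Rightarrow> 'h::{real_inner,heine_borel} \<Rightarrow> 'h \<Rightarrow> 'f::real_normed_vector"
  assumes S: "open S" "x t \<in> S"
    and lin: "\<And>y u. y \<in> S \<Longrightarrow> linear (L y u)" "\<And>y v. y \<in> S \<Longrightarrow> linear (\<lambda>u. L y u v)"
    and diff: "\<And>u v. (\<lambda>y. L y u v) differentiable (at (x t))"
    and x: "(x has_derivative x') (at t)" and u: "(u has_derivative u') (at t)"
    and v: "(v has_derivative v') (at t)"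
  shows "((\<lambda>s. L (x s) (u s) (v s)) has_derivative
    (\<lambda>h. frechet_derivative (\<lambda>y. L y (u t) (v t)) (at (x t)) (x' h)
      + L (x t) (u' h) (v t) + L (x t) (u t) (v' h))) (at t)"
proof -
  have 1: "((\<lambda>s. L (x s) w (v s)) has_derivative
    (\<lambda>h. frechet_derivative (\<lambda>y. L y w (v t)) (at (x t)) (x' h) + L (x t) w (v' h))) (at t)" for w
    by (rule has_derivative_linear_apply[OF S lin(1) diff x v])
  have "continuous (at t) x" using x has_derivative_continuous by blast
  then have "\<exists>T. open T \<and> t \<in> T \<and> (\<forall>s\<in>T. x s \<in> S)"
    using S unfolding continuous_at_open by blast
  then obtain T where T: "open T" "t \<in> T" "\<And>s. s \<in> T \<Longrightarrow> x s \<in> S" by blast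
  have "((\<lambda>s. L (x s) (u s) (v s)) has_derivative
    (\<lambda>h. frechet_derivative (\<lambda>s. L (x s) (u t) (v s)) (at t) h + L (x t) (u' h) (v t))) (at t)"
    by (rule has_derivative_linear_apply[where x = "\<lambda>s. s" and L = "\<lambda>s w. L (x s) w (v s)"
          and x' = "\<lambda>h. h", OF T(1,2) lin(2)[OF T(3)] differentiableI[OF 1] has_derivative_ident u])
  then show ?thesis unfolding frechet_derivative_eq[OF 1] by (simp add: algebra_simps)
qed

lemma frechet_derivative_chain:
  assumes "f differentiable (at (h x))" "h differentiable (at x)"
  shows "frechet_derivative (\<lambda>x. f (h x)) (at x) v = frechet_derivative f (at (h x)) (frechet_derivative h (at x) v)"
  by (subst frechet_derivative_eq[OF has_derivative_compose[OF
          differentiable_has_derivative[OF assms(2)] differentiable_has_derivative[OF assms(1)]]]) simp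

lemma smooth_on_has_vector_derivative:
  "smooth_on J f \<Longrightarrow> t \<in> J \<Longrightarrow> (f has_vector_derivative vector_derivative f (at t)) (at t)"
  using smooth_on_differentiable vector_derivative_works by (metis differentiableI_vector differentiable_def
      frechet_derivative_eq_vector_derivative has_vector_derivative_def smooth_on_has_derivative)

lemma smooth_on_vector_derivative:
  assumes "open J" "smooth_on J f"
  shows "smooth_on J (\<lambda>t. vector_derivative f (at t))"
proof -
  have "frechet_derivative f (at t) 1 = vector_derivative f (at t)" if "t \<in> J" for t
    using frechet_derivative_eq_vector_derivative[OF smooth_on_differentiable[OF assms(2) that]] by simp
  then show ?thesis
    by (rule iffD1[OF smooth_on_cong[OF assms(1)] smooth_on_derivative[OF assms(2), of 1]])
qed

section \<open>Symmetry of second derivatives\<close>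

lemma has_real_derivative_along_line:
  fixes f :: "'e::real_normed_vector \<Rightarrow> real"
  assumes "f differentiable (at (x + s *\<^sub>R u))"
  shows "((\<lambda>s. f (x + s *\<^sub>R u)) has_real_derivative frechet_derivative f (at (x + s *\<^sub>R u)) u) (at s)"
proof -
  have 1: "((\<lambda>s. x + s *\<^sub>R u) has_derivative (\<lambda>h. h *\<^sub>R u)) (at s)"
    by (auto intro!: derivative_eq_intros)
  have "((\<lambda>s. f (x + s *\<^sub>R u)) has_derivative
      (\<lambda>h. frechet_derivative f (at (x + s *\<^sub>R u)) (h *\<^sub>R u))) (at s)"
    by (rule has_derivative_compose[OF 1 differentiable_has_derivative[OF assms]])
  then show ?thesis
    unfolding has_field_derivative_def
    by (simp add: linear_scale[OF linear_frechet_derivative[OF assms]] mult_commute_abs)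
qed

text \<open>The mean value theorem is applied first to the difference of f on two parallel segments
  in direction u, then to the derivative along u on a segment in direction v.\<close>

lemma second_difference_MVT:
  fixes f :: "'e::real_normed_vector \<Rightarrow> real"
  assumes C2: "Ck_on 2 S f" and t: "0 < t"
    and S: "\<And>s r. 0 \<le> s \<Longrightarrow> s \<le> t \<Longrightarrow> 0 \<le> r \<Longrightarrow> r \<le> t \<Longrightarrow> x + s *\<^sub>R u + r *\<^sub>R v \<in> S"
  shows "\<exists>s r. 0 < s \<and> s < t \<and> 0 < r \<and> r < t \<and>
    f (x + t *\<^sub>R u + t *\<^sub>R v) - f (x + t *\<^sub>R u) - f (x + t *\<^sub>R v) + f x =
    t * (t * frechet_derivative (\<lambda>y. frechet_derivative f (at y) u) (at (x + s *\<^sub>R u + r *\<^sub>R v)) v)"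
proof -
  have d1: "f differentiable (at y)" if "y \<in> S" for y
    using C2 that by (simp add: numeral_2_eq_2)
  have d2: "(\<lambda>y. frechet_derivative f (at y) u) differentiable (at y)" if "y \<in> S" for y
    using C2 that by (simp add: numeral_2_eq_2)
  have "((\<lambda>s. f ((x + t *\<^sub>R v) + s *\<^sub>R u) - f (x + s *\<^sub>R u)) has_real_derivative
      frechet_derivative f (at ((x + t *\<^sub>R v) + s *\<^sub>R u)) u - frechet_derivative f (at (x + s *\<^sub>R u)) u) (at s)"
    if "0 \<le> s" "s \<le> t" for s
    by (intro DERIV_diff has_real_derivative_along_line d1)
      (use S[OF that, of t] S[OF that, of 0] t in \<open>simp_all add: add_ac\<close>)
  then obtain s where s: "0 < s" "s < t" and
    es: "(f ((x + t *\<^sub>R v) + t *\<^sub>R u) - f (x + t *\<^sub>R u)) - (f ((x + t *\<^sub>R v) + 0 *\<^sub>R u) - f (x + 0 *\<^sub>R u)) =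
      (t - 0) * (frechet_derivative f (at ((x + t *\<^sub>R v) + s *\<^sub>R u)) u - frechet_derivative f (at (x + s *\<^sub>R u)) u)"
    using MVT2[OF t, of "\<lambda>s. f ((x + t *\<^sub>R v) + s *\<^sub>R u) - f (x + s *\<^sub>R u)"
        "\<lambda>s. frechet_derivative f (at ((x + t *\<^sub>R v) + s *\<^sub>R u)) u - frechet_derivative f (at (x + s *\<^sub>R u)) u"]
    by blast
  have "((\<lambda>r. frechet_derivative f (at ((x + s *\<^sub>R u) + r *\<^sub>R v)) u) has_real_derivative
      frechet_derivative (\<lambda>y. frechet_derivative f (at y) u) (at ((x + s *\<^sub>R u) + r *\<^sub>R v)) v) (at r)"
    if "0 \<le> r" "r \<le> t" for r
    by (rule has_real_derivative_along_line[of "\<lambda>y. frechet_derivative f (at y) u"])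
      (use S[OF _ _ that] s d2 in auto)
  then obtain r where r: "0 < r" "r < t" and
    er: "frechet_derivative f (at ((x + s *\<^sub>R u) + t *\<^sub>R v)) u - frechet_derivative f (at ((x + s *\<^sub>R u) + 0 *\<^sub>R v)) u
      = (t - 0) * frechet_derivative (\<lambda>y. frechet_derivative f (at y) u) (at ((x + s *\<^sub>R u) + r *\<^sub>R v)) v"
    using MVT2[OF t, of "\<lambda>r. frechet_derivative f (at ((x + s *\<^sub>R u) + r *\<^sub>R v)) u"
        "\<lambda>r. frechet_derivative (\<lambda>y. frechet_derivative f (at y) u) (at ((x + s *\<^sub>R u) + r *\<^sub>R v)) v"]
    by blast
  have "f (x + t *\<^sub>R u + t *\<^sub>R v) - f (x + t *\<^sub>R u) - f (x + t *\<^sub>R v) + f x =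
    t * (t * frechet_derivative (\<lambda>y. frechet_derivative f (at y) u) (at (x + s *\<^sub>R u + r *\<^sub>R v)) v)"
    using es er by (simp add: add.commute add.left_commute)
  then show ?thesis using s r by blast
qed

text \<open>The second difference is symmetric in u and v, so the two mixed derivatives coincide at
  two points arbitrarily close to x; their continuity then forces equality at x.\<close>

lemma frechet_derivative_symmetric_real:
  fixes f :: "'e::real_normed_vector \<Rightarrow> real"
  assumes "open S" "Ck_on 2 S f" "x \<in> S"
  shows "frechet_derivative (\<lambda>y. frechet_derivative f (at y) u) (at x) v =
    frechet_derivative (\<lambda>y. frechet_derivative f (at y) v) (at x) u"
proof (rule ccontr)
  define h1 where "h1 y = frechet_derivative (\<lambda>y. frechet_derivative f (at y) u) (at y) v" for y
  define h2 where "h2 y = frechet_derivative (\<lambda>y. frechet_derivative f (at y) v) (at y) u" for y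
  assume "\<not> ?thesis"
  then have ne: "h1 x \<noteq> h2 x" by (simp add: h1_def h2_def)
  \<comment> \<open>Half the supposed gap: two equal values within e of \<open>h1 x\<close> and
    \<open>h2 x\<close> would make the gap smaller than itself.\<close>
  define e where "e = \<bar>h1 x - h2 x\<bar> / 2"
  have e: "e > 0" using ne by (simp add: e_def)
  have "continuous_on S h1" "continuous_on S h2"
    using assms(2) unfolding h1_def h2_def by (simp_all add: numeral_2_eq_2)
  then have "isCont h1 x" "isCont h2 x"
    using assms(1,3) by (simp_all add: continuous_on_eq_continuous_at)
  then obtain d1 d2 where d: "d1 > 0" "d2 > 0" "\<And>y. dist y x < d1 \<Longrightarrow> dist (h1 y) (h1 x) < e"
    "\<And>y. dist y x < d2 \<Longrightarrow> dist (h2 y) (h2 x) < e"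
    using e unfolding continuous_at_eps_delta dist_norm by blast
  obtain d3 where d3: "d3 > 0" "ball x d3 \<subseteq> S" using assms(1,3) open_contains_ball by blast
  define d where "d = min d1 (min d2 d3)"
  have d0: "d > 0" using d d3 by (simp add: d_def)
  \<comment> \<open>Ensures t (|u| + |v|) < d, which keeps the whole parallelogram within distance d
    of x; the summand 1 covers u = v = 0.\<close>
  define t where "t = d / (2 * (norm u + norm v + 1))"
  have t: "0 < t" using d0 by (simp add: t_def add_nonneg_pos)
  have near: "dist (x + s *\<^sub>R a + r *\<^sub>R b) x < d"
    if "0 \<le> s" "s \<le> t" "0 \<le> r" "r \<le> t" "norm a + norm b = norm u + norm v" for s r a b
  proof -
    have "norm (s *\<^sub>R a + r *\<^sub>R b) \<le> t * norm a + t * norm b"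
      by (rule norm_triangle_le) (use that in \<open>auto intro!: add_mono mult_right_mono\<close>)
    also have "\<dots> = t * (norm u + norm v)" using that by (metis distrib_left)
    also have "\<dots> < t * (2 * (norm u + norm v + 1))"
      using t by (intro mult_strict_left_mono) (auto simp: add_nonneg_pos intro: add_pos_nonneg)
    also have "\<dots> = d"
      using norm_ge_zero[of u] norm_ge_zero[of v] unfolding t_def by (simp add: add_nonneg_eq_0_iff field_simps)
    finally show ?thesis by (simp add: dist_norm add.assoc)
  qed
  have inS: "y \<in> S" if "dist y x < d" for y
    using that d3(2) by (auto simp: d_def dist_commute)
  from second_difference_MVT[OF assms(2) t inS[OF near], of u v]
  obtain s r where 1: "0 < s" "s < t" "0 < r" "r < t"
    "f (x + t *\<^sub>R u + t *\<^sub>R v) - f (x + t *\<^sub>R u) - f (x + t *\<^sub>R v) + f x = t * (t * h1 (x + s *\<^sub>R u + r *\<^sub>R v))"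
    unfolding h1_def by auto
  from second_difference_MVT[OF assms(2) t inS[OF near], of v u]
  obtain s' r' where 2: "0 < s'" "s' < t" "0 < r'" "r' < t"
    "f (x + t *\<^sub>R v + t *\<^sub>R u) - f (x + t *\<^sub>R v) - f (x + t *\<^sub>R u) + f x = t * (t * h2 (x + s' *\<^sub>R v + r' *\<^sub>R u))"
    unfolding h2_def by (auto simp: add.commute)
  have "x + t *\<^sub>R v + t *\<^sub>R u = x + t *\<^sub>R u + t *\<^sub>R v" by (simp add: add_ac)
  from 1(5) 2(5)[unfolded this] have "t * (t * h1 (x + s *\<^sub>R u + r *\<^sub>R v)) = t * (t * h2 (x + s' *\<^sub>R v + r' *\<^sub>R u))"
    by linarith
  then have eq: "h1 (x + s *\<^sub>R u + r *\<^sub>R v) = h2 (x + s' *\<^sub>R v + r' *\<^sub>R u)" using t by simp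
  have "dist (x + s *\<^sub>R u + r *\<^sub>R v) x < d" "dist (x + s' *\<^sub>R v + r' *\<^sub>R u) x < d"
    by (rule near; use 1 2 in simp)+
  then have "dist (h1 (x + s *\<^sub>R u + r *\<^sub>R v)) (h1 x) < e" "dist (h2 (x + s' *\<^sub>R v + r' *\<^sub>R u)) (h2 x) < e"
    using d by (auto simp: d_def)
  then show False using eq unfolding e_def dist_real_def by argo
qed

text \<open>Pairing with each vector c reduces this to the real-valued case, since inner products
  separate points.\<close>

lemma frechet_derivative_symmetric:
  fixes f :: "'e::real_normed_vector \<Rightarrow> 'f::real_inner"
  assumes S: "open S" "x \<in> S" and f: "Ck_on 2 S f"
  shows "frechet_derivative (\<lambda>y. frechet_derivative f (at y) u) (at x) v =
    frechet_derivative (\<lambda>y. frechet_derivative f (at y) v) (at x) u"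
proof -
  have d1: "f differentiable (at y)" if "y \<in> S" for y
    using f that by (simp add: numeral_2_eq_2)
  have d2: "(\<lambda>y. frechet_derivative f (at y) w) differentiable (at x)" for w
    using f S by (simp add: numeral_2_eq_2)
  have D: "frechet_derivative (\<lambda>y. frechet_derivative (\<lambda>z. f z \<bullet> c) (at y) w) (at x) =
      (\<lambda>k. frechet_derivative (\<lambda>y. frechet_derivative f (at y) w) (at x) k \<bullet> c)" for c w
  proof (rule frechet_derivative_eq, rule has_derivative_transform_within_open[OF _ S])
    show "((\<lambda>y. frechet_derivative f (at y) w \<bullet> c) has_derivative
      (\<lambda>k. frechet_derivative (\<lambda>y. frechet_derivative f (at y) w) (at x) k \<bullet> c)) (at x)"
      by (intro has_derivative_inner_left differentiable_has_derivative d2)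
    show "frechet_derivative f (at y) w \<bullet> c = frechet_derivative (\<lambda>z. f z \<bullet> c) (at y) w"
      if "y \<in> S" for y
      using frechet_derivative_eq[OF has_derivative_inner_left[OF differentiable_has_derivative[OF d1[OF that]]]]
      by simp
  qed
  have "Ck_on 2 S (\<lambda>y. f y \<bullet> c)" for c
    by (rule Ck_on_bounded_linear[OF bounded_linear_inner_left S(1) f])
  from frechet_derivative_symmetric_real[OF S(1) this S(2), of _ u v]
  have "frechet_derivative (\<lambda>y. frechet_derivative f (at y) u) (at x) v \<bullet> c =
    frechet_derivative (\<lambda>y. frechet_derivative f (at y) v) (at x) u \<bullet> c" for c
    unfolding D .
  then show ?thesis using vector_eq_rdot by blast
qed

section \<open>Local existence for smooth ordinary differential equations\<close>

text \<open>The sum of the norms of the derivatives in the basis directions dominates the operator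
  norm and is continuous, hence bounded on the compact ball. The maximum with 0 covers an empty
  ball, where any L is a bound.\<close>

lemma Ck_on_lipschitz_cball:
  fixes f :: "'e::{real_inner,heine_borel} \<Rightarrow> 'f::real_normed_vector"
  assumes "Ck_on 1 S f" "cball z r \<subseteq> S"
  obtains L where "0 \<le> L"
    "\<And>x y. x \<in> cball z r \<Longrightarrow> y \<in> cball z r \<Longrightarrow> norm (f x - f y) \<le> L * norm (x - y)"
proof -
  have d: "f differentiable (at x)" if "x \<in> S" for x using assms(1) that by simp
  have "continuous_on (cball z r) (\<lambda>x. \<Sum>b\<in>obase. norm (frechet_derivative f (at x) b))"
    using assms by (intro continuous_intros) (auto intro: continuous_on_subset)
  from compact_continuous_image[OF this compact_cball]
  have "bdd_above ((\<lambda>x. \<Sum>b\<in>obase. norm (frechet_derivative f (at x) b)) ` cball z r)"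
    by (intro bounded_imp_bdd_above compact_imp_bounded)
  then obtain L where L: "\<And>x. x \<in> cball z r \<Longrightarrow> (\<Sum>b\<in>obase. norm (frechet_derivative f (at x) b)) \<le> L"
    unfolding bdd_above_def by blast
  have "norm (f x - f y) \<le> max 0 L * norm (x - y)" if "x \<in> cball z r" "y \<in> cball z r" for x y
  proof (rule differentiable_bound[OF convex_cball _ _ that])
    fix w assume w: "w \<in> cball z r"
    show "(f has_derivative frechet_derivative f (at w)) (at w within cball z r)"
      by (rule has_derivative_at_withinI[OF differentiable_has_derivative]) (use assms(2) w d in blast)
    show "onorm (frechet_derivative f (at w)) \<le> max 0 L"
    proof (rule onorm_bound)
      fix h
      have "norm (frechet_derivative f (at w) h) \<le> (\<Sum>b\<in>obase. norm (frechet_derivative f (at w) b)) * norm h"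
        using assms(2) w d by (intro norm_linear_obase_le linear_frechet_derivative) auto
      also have "\<dots> \<le> max 0 L * norm h" using L[OF w] by (intro mult_right_mono) auto
      finally show "norm (frechet_derivative f (at w) h) \<le> max 0 L * norm h" .
    qed simp
  qed
  then show ?thesis by (intro that[of "max 0 L"]) auto
qed

text \<open>Basing both integrals at \<open>-d\<close> yields the oriented integral from 0 to t
  without a case distinction on the sign of t.\<close>

lemma norm_integral_difference_le:
  fixes h :: "real \<Rightarrow> 'b::banach"
  assumes "continuous_on {-d..d} h" "\<And>s. s \<in> {-d..d} \<Longrightarrow> norm (h s) \<le> B" "0 \<le> B"
    and "t \<in> {-d..d}"
  shows "norm (integral {-d..t} h - integral {-d..0} h) \<le> B * d"
proof -
  have "norm (integral {-d..t} h - integral {-d..0} h) \<le> B * norm (t - 0)"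
  proof (rule differentiable_bound[of "{-d..d}"])
    fix x assume x: "x \<in> {-d..d}"
    show "((\<lambda>t. integral {-d..t} h) has_derivative (\<lambda>r. r *\<^sub>R h x)) (at x within {-d..d})"
      using integral_has_vector_derivative[OF assms(1) x] by (simp add: has_vector_derivative_def)
    show "onorm (\<lambda>r. r *\<^sub>R h x) \<le> B"
      using assms(2)[OF x] assms(3) by (intro onorm_bound) (auto simp: mult.commute[of B] mult_left_mono)
  qed (use assms(4) in auto)
  also have "\<dots> \<le> B * d" using assms(3,4) by (intro mult_left_mono) auto
  finally show ?thesis .
qed

text \<open>Banach's fixed point theorem for the integral operator, acting on bounded continuous
  functions on the whole line with values in the closed ball; these form a closed, hence complete,
  set.\<close>

lemma picard_lindelof:
  fixes F :: "'b::banach \<Rightarrow> 'b"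
  assumes r: "0 < r" and L: "0 \<le> L"
    and lip: "\<And>x y. x \<in> cball z0 r \<Longrightarrow> y \<in> cball z0 r \<Longrightarrow> norm (F x - F y) \<le> L * norm (x - y)"
  obtains d z where "0 < d" "z 0 = z0" "\<And>t. z t \<in> cball z0 r"
    "\<And>t. t \<in> {-d<..<d} \<Longrightarrow> (z has_vector_derivative F (z t)) (at t)"
proof -
  \<comment> \<open>A bound for F on the ball, obtained from its value at the centre and the
    Lipschitz estimate.\<close>
  define B where "B = norm (F z0) + L * r"
  have B: "0 \<le> B" using r L by (simp add: B_def)
  have FB: "norm (F x) \<le> B" if "x \<in> cball z0 r" for x
  proof -
    have "norm (F x) \<le> norm (F z0) + norm (F x - F z0)"
      using norm_triangle_ineq[of "F z0" "F x - F z0"] by simp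
    also have "norm (F x - F z0) \<le> L * norm (x - z0)" using lip[OF that] r by simp
    also have "L * norm (x - z0) \<le> L * r"
      using that L by (intro mult_left_mono) (auto simp: dist_norm norm_minus_commute)
    finally show ?thesis by (simp add: B_def)
  qed
  \<comment> \<open>The first term gives B d \<le> r, so the operator preserves the ball; the second
    gives L d \<le> 1/2, the contraction constant. Adding 1 prevents division by 0.\<close>
  define d where "d = min (r / (B + 1)) (1 / (2 * (L + 1)))"
  have d: "0 < d" using B L r by (simp add: d_def)
  have "B * d \<le> B * (r / (B + 1))" using B by (intro mult_left_mono) (auto simp: d_def)
  also have "\<dots> \<le> r" using B r by (simp add: field_simps)
  finally have Bd: "B * d \<le> r" .
  have "L * d \<le> L * (1 / (2 * (L + 1)))" using L by (intro mult_left_mono) (auto simp: d_def)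
  also have "\<dots> \<le> 1 / 2" using L by (simp add: field_simps)
  finally have Ld: "L * d \<le> 1 / 2" .
  \<comment> \<open>Clamping time to \<open>{-d..d}\<close> extends the integral operator to
    functions on all of the real line.\<close>
  define k where "k t = max (-d) (min d t)" for t :: real
  have k: "k t \<in> {-d..d}" for t using d by (auto simp: k_def)
  have k_id: "k t = t" if "t \<in> {-d..d}" for t using that by (auto simp: k_def)
  have k_cont: "continuous_on UNIV k" unfolding k_def by (intro continuous_intros)
  define I where "I \<phi> t = integral {-d..t} (\<lambda>s. F (\<phi> s))" for \<phi> :: "real \<Rightarrow> 'b" and t
  define T where "T \<phi> = Bcontfun (\<lambda>t. z0 + (I (apply_bcontfun \<phi>) (k t) - I (apply_bcontfun \<phi>) 0))" for \<phi>
  define X where "X = PiC (UNIV :: real set) (\<lambda>_. cball z0 r)"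
  have X: "\<phi> \<in> X \<longleftrightarrow> (\<forall>t. apply_bcontfun \<phi> t \<in> cball z0 r)" for \<phi>
    by (auto simp: X_def mem_PiC_iff)
  have F_cont: "continuous_on (cball z0 r) F"
    unfolding continuous_on_iff
  proof (intro ballI allI impI)
    fix x e assume x: "x \<in> cball z0 r" and e: "(0::real) < e"
    show "\<exists>\<delta>>0. \<forall>x'\<in>cball z0 r. dist x' x < \<delta> \<longrightarrow> dist (F x') (F x) < e"
    proof (intro exI[of _ "e / (L + 1)"] conjI ballI impI)
      show "e / (L + 1) > 0" using e L by simp
      fix x' assume x': "x' \<in> cball z0 r" "dist x' x < e / (L + 1)"
      have "dist (F x') (F x) \<le> L * dist x' x" using lip[OF x'(1) x] by (simp add: dist_norm)
      also have "\<dots> \<le> (L + 1) * dist x' x" by (simp add: algebra_simps)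
      also have "\<dots> < e" using x'(2) L by (simp add: field_simps)
      finally show "dist (F x') (F x) < e" .
    qed
  qed
  have Fphi: "continuous_on {-d..d} (\<lambda>s. F (apply_bcontfun \<phi> s))" if "\<phi> \<in> X" for \<phi>
    by (rule continuous_on_compose2[OF F_cont]) (use that X in auto)
  have T_app: "apply_bcontfun (T \<phi>) t = z0 + (I (apply_bcontfun \<phi>) (k t) - I (apply_bcontfun \<phi>) 0)"
    and T_X: "T \<phi> \<in> X" if phi: "\<phi> \<in> X" for \<phi> t
  proof -
    have bd: "norm (I (apply_bcontfun \<phi>) (k t) - I (apply_bcontfun \<phi>) 0) \<le> r" for t
      using norm_integral_difference_le[OF Fphi[OF phi] FB B k[of t]] phi Bd
      unfolding I_def X by force
    have c: "continuous_on {-d..d} (I (apply_bcontfun \<phi>))"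
      unfolding I_def
      by (rule indefinite_integral_continuous_1[OF integrable_continuous_real[OF Fphi[OF phi]]])
    have "continuous_on UNIV (\<lambda>t. z0 + (I (apply_bcontfun \<phi>) (k t) - I (apply_bcontfun \<phi>) 0))"
      by (intro continuous_intros continuous_on_compose2[OF c k_cont]) (use k in auto)
    moreover have "bounded (range (\<lambda>t. z0 + (I (apply_bcontfun \<phi>) (k t) - I (apply_bcontfun \<phi>) 0)))"
      by (rule bounded_subset[OF bounded_cball[of z0 r]]) (use bd in \<open>auto simp: dist_norm norm_minus_commute\<close>)
    ultimately have *: "apply_bcontfun (T \<phi>) = (\<lambda>t. z0 + (I (apply_bcontfun \<phi>) (k t) - I (apply_bcontfun \<phi>) 0))"
      unfolding T_def by (intro Bcontfun_inverse) (simp add: bcontfun_def)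
    show "apply_bcontfun (T \<phi>) t = z0 + (I (apply_bcontfun \<phi>) (k t) - I (apply_bcontfun \<phi>) 0)"
      by (simp add: *)
    show "T \<phi> \<in> X" unfolding X * using bd by (auto simp: dist_norm norm_minus_commute)
  qed
  have contr: "dist (T \<phi>) (T \<psi>) \<le> 1 / 2 * dist \<phi> \<psi>" if p: "\<phi> \<in> X" "\<psi> \<in> X" for \<phi> \<psi>
  proof (rule dist_bound)
    fix t
    let ?h = "\<lambda>s. F (apply_bcontfun \<phi> s) - F (apply_bcontfun \<psi> s)"
    have int: "(\<lambda>s. F (apply_bcontfun \<phi> s)) integrable_on {-d..u}" "(\<lambda>s. F (apply_bcontfun \<psi> s)) integrable_on {-d..u}"
      if "u \<in> {-d..d}" for u
      using that by (auto intro!: integrable_continuous_real continuous_on_subset[OF Fphi] p)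
    have "I (apply_bcontfun \<phi>) u - I (apply_bcontfun \<psi>) u = integral {-d..u} ?h" if "u \<in> {-d..d}" for u
      unfolding I_def by (rule integral_diff[symmetric]) (use int[OF that] in auto)
    from this[OF k[of t]] this[of 0]
    have "dist (apply_bcontfun (T \<phi>) t) (apply_bcontfun (T \<psi>) t) = norm (integral {-d..k t} ?h - integral {-d..0} ?h)"
      using d by (simp add: T_app p dist_norm algebra_simps)
    also have "\<dots> \<le> (L * dist \<phi> \<psi>) * d"
    proof (rule norm_integral_difference_le[OF _ _ _ k])
      show "continuous_on {-d..d} ?h" by (intro continuous_intros Fphi p)
      fix s assume "s \<in> {-d..d}"
      have "norm (?h s) \<le> L * dist (apply_bcontfun \<phi> s) (apply_bcontfun \<psi> s)"
        unfolding dist_norm by (rule lip) (use p X in auto)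
      also have "\<dots> \<le> L * dist \<phi> \<psi>" using L by (intro mult_left_mono dist_bounded)
      finally show "norm (?h s) \<le> L * dist \<phi> \<psi>" .
    qed (use L in simp)
    also have "\<dots> = (L * d) * dist \<phi> \<psi>" by simp
    also have "\<dots> \<le> 1 / 2 * dist \<phi> \<psi>" using Ld by (intro mult_right_mono) auto
    finally show "dist (apply_bcontfun (T \<phi>) t) (apply_bcontfun (T \<psi>) t) \<le> 1 / 2 * dist \<phi> \<psi>" .
  qed
  have "\<exists>!\<phi>\<in>X. T \<phi> = \<phi>"
  proof (rule Banach_fix[where c = "1/2"])
    show "complete X" unfolding X_def complete_eq_closed by (rule closed_PiC) simp
    have "const_bcontfun z0 \<in> X" using r by (simp add: X const_bcontfun.rep_eq)
    then show "X \<noteq> {}" by blast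
  qed (use T_X contr in auto)
  then obtain \<phi> where phi: "\<phi> \<in> X" "T \<phi> = \<phi>" by blast
  let ?z = "apply_bcontfun \<phi>"
  have z: "?z t = z0 + (I ?z (k t) - I ?z 0)" for t
    using T_app[OF phi(1), of t] phi(2) by simp
  show ?thesis
  proof (rule that[OF d, of ?z])
    show "?z 0 = z0" using z[of 0] k_id[of 0] d by simp
    show "?z t \<in> cball z0 r" for t using phi(1) X by blast
    fix t assume t: "t \<in> {-d<..<d}"
    have "((\<lambda>u. I ?z u) has_vector_derivative F (?z t)) (at t within {-d..d})"
      unfolding I_def by (rule integral_has_vector_derivative[OF Fphi[OF phi(1)]]) (use t in auto)
    then have "((\<lambda>u. I ?z u) has_vector_derivative F (?z t)) (at t)"
      using t at_within_interior[of t "{-d..d}"] by (simp add: interior_atLeastAtMost_real)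
    then have "((\<lambda>u. z0 + (I ?z u - I ?z 0)) has_vector_derivative F (?z t)) (at t)"
      by (auto intro!: derivative_eq_intros)
    then show "(?z has_vector_derivative F (?z t)) (at t)"
      by (rule has_vector_derivative_transform_within_open[where S = "{-d<..<d}"])
        (use t z k_id in auto)
  qed
qed

text \<open>Bootstrapping: if z is C^k then so is its derivative, the composition of F with z, and
  hence z is C^(k+1).\<close>

lemma smooth_on_ode_solution:
  fixes F :: "'e::{real_inner,heine_borel} \<Rightarrow> 'e"
  assumes F: "smooth_on S F" and J: "open J"
    and z: "\<And>t. t \<in> J \<Longrightarrow> z t \<in> S" "\<And>t. t \<in> J \<Longrightarrow> (z has_vector_derivative F (z t)) (at t)"
  shows "smooth_on J z"
proof -
  have "Ck_on k J z" for k
  proof (induction k)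
    case 0
    have "continuous (at t) z" if "t \<in> J" for t
      using z(2)[OF that] has_vector_derivative_continuous by blast
    then show ?case by (simp add: continuous_at_imp_continuous_on)
  next
    case (Suc k)
    show ?case
    proof (rule Ck_on_SucI[OF J])
      show "(z has_derivative (\<lambda>h. h *\<^sub>R F (z t))) (at t)" if "t \<in> J" for t
        using z(2)[OF that] by (simp add: has_vector_derivative_def)
      have "Ck_on k J (\<lambda>t. F (z t))"
        by (rule Ck_on_compose[OF J _ Suc]) (use F z in \<open>auto simp: smooth_on_def\<close>)
      then show "Ck_on k J (\<lambda>t. h *\<^sub>R F (z t))" for h
        by (rule Ck_on_bounded_linear[OF bounded_linear_scaleR_right J])
    qed
  qed
  then show ?thesis by (simp add: smooth_on_def)
qed

lemma smooth_ode_exists: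
  fixes F :: "'e::{real_inner,heine_borel,banach} \<Rightarrow> 'e"
  assumes "open S" "smooth_on S F" "z0 \<in> S"
  obtains d z where "0 < d" "z 0 = z0" "\<And>t. t \<in> {-d<..<d} \<Longrightarrow> z t \<in> S"
    "\<And>t. t \<in> {-d<..<d} \<Longrightarrow> (z has_vector_derivative F (z t)) (at t)" "smooth_on {-d<..<d} z"
proof -
  obtain r where r: "0 < r" "cball z0 r \<subseteq> S" using assms(1,3) open_contains_cball by blast
  have "Ck_on 1 S F" using assms(2) by (simp add: smooth_on_def)
  then obtain L where L: "0 \<le> L"
    "\<And>x y. x \<in> cball z0 r \<Longrightarrow> y \<in> cball z0 r \<Longrightarrow> norm (F x - F y) \<le> L * norm (x - y)"
    using Ck_on_lipschitz_cball r(2) by blast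
  obtain d z where z: "0 < d" "z 0 = z0" "\<And>t. z t \<in> cball z0 r"
    "\<And>t. t \<in> {-d<..<d} \<Longrightarrow> (z has_vector_derivative F (z t)) (at t)"
    using picard_lindelof[OF r(1) L] by blast
  have zS: "z t \<in> S" for t using z(3) r(2) by blast
  show ?thesis
    by (rule that[OF z(1,2) zS z(4) smooth_on_ode_solution[OF assms(2) _ zS z(4)]]) auto
qed

section \<open>The trace of a skew map\<close>

text \<open>A basis extracted from the finite spanning set \<open>obase\<close> exhibits the model
  space as finite-dimensional, also in dimension 0.\<close>

lemma inj_linear_imp_surj:
  fixes S :: "'e::{real_inner,heine_borel} \<Rightarrow> 'e"
  assumes "linear S" "inj S"
  shows "surj S"
proof -
  obtain B :: "'e set" where B: "B \<subseteq> obase" "independent B" "obase \<subseteq> span B"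
    using real_vector.maximal_independent_subset by blast
  have "span B = UNIV"
    using B(3) span_obase span_minimal[OF B(3) subspace_span] by auto
  then interpret fd: finite_dimensional_vector_space "(*\<^sub>R) :: real \<Rightarrow> 'e \<Rightarrow> 'e" B
    by unfold_locales (use B finite_subset[OF B(1) finite_obase] in
        \<open>auto simp: dependent_raw_def span_raw_def\<close>)
  show ?thesis
    by (rule fd.linear_inj_imp_surj[OF _ assms(2)]) (use assms(1) in \<open>simp add: linear_def\<close>)
qed

text \<open>The trace is taken in a basis orthonormal for the ambient inner product, whereas A is
  skew for G. With the Gram operator S of G, A is the product of the symmetric map inv S and the
  ambient-skew map S A, and such a product has trace 0.\<close>

lemma lin_trace_skew_eq_0:
  fixes G :: "'e::{real_inner,heine_borel} \<Rightarrow> 'e \<Rightarrow> real"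
  assumes lin: "\<And>u. linear (G u)" "\<And>v. linear (\<lambda>u. G u v)" and sym: "\<And>u v. G u v = G v u"
    and pos: "\<And>u. u \<noteq> 0 \<Longrightarrow> G u u > 0"
    and A: "linear A" and skew: "\<And>u v. G (A u) v + G u (A v) = 0"
  shows "lin_trace A = 0"
proof -
  \<comment> \<open>The Gram operator: S u represents the functional \<open>G u\<close> in the
    ambient inner product.\<close>
  define S where "S u = (\<Sum>b\<in>obase. G u b *\<^sub>R b)" for u
  have Sdot: "S u \<bullet> v = G u v" for u v
    unfolding S_def inner_sum_left using linear_obase_expand[OF lin(1), of u v]
    by (simp add: inner_commute mult.commute)
  have linS: "linear S"
    by (rule linearI) (simp_all add: S_def linear_add[OF lin(2)] linear_scale[OF lin(2)]
        scaleR_add_left sum.distrib scaleR_sum_right)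
  have "u = 0" if "S u = 0" for u
    using Sdot[of u u] that pos[of u] by (metis inner_zero_left less_irrefl)
  then have inj: "inj S" using linear_injective_0[OF linS] by blast
  then have surj: "surj S" by (rule inj_linear_imp_surj[OF linS])
  define T where "T = inv S"
  have ST: "S (T x) = x" and TS: "T (S x) = x" for x
    using surj inj by (simp_all add: T_def surj_f_inv_f)
  have Tsym: "T x \<bullet> y = x \<bullet> T y" for x y
    using Sdot[of "T y" "T x"] Sdot[of "T x" "T y"] sym by (simp add: ST inner_commute)
  have exp: "(\<Sum>c\<in>obase. (x \<bullet> c) * (y \<bullet> c)) = x \<bullet> y" for x y :: 'e
    using arg_cong[OF obase_expand[of y], of "\<lambda>z. x \<bullet> z"] by (simp add: inner_sum_right mult.commute)
  have K: "S (A u) \<bullet> v = - (S (A v) \<bullet> u)" for u v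
    using skew[of u v] sym[of u "A v"] by (simp add: Sdot)
  \<comment> \<open>A b is T applied to S (A b), and symmetry moves T to the other factor; the
    resulting inner product is expanded in the basis.\<close>
  have "A b \<bullet> b = (\<Sum>c\<in>obase. (S (A b) \<bullet> c) * (T b \<bullet> c))" for b
    using Tsym[of "S (A b)" b] by (simp add: TS exp)
  then have tr: "lin_trace A = (\<Sum>b\<in>obase. \<Sum>c\<in>obase. (S (A b) \<bullet> c) * (T b \<bullet> c))"
    by (simp add: lin_trace_obase)
  also have "\<dots> = (\<Sum>c\<in>obase. \<Sum>b\<in>obase. (S (A b) \<bullet> c) * (T b \<bullet> c))"
    by (rule sum.swap)
  \<comment> \<open>Exchanging b and c preserves the symmetric factor and negates the skew one, so
    the trace equals its own negative.\<close>
  also have "\<dots> = (\<Sum>c\<in>obase. \<Sum>b\<in>obase. - ((S (A c) \<bullet> b) * (T c \<bullet> b)))"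
  proof (intro sum.cong refl)
    fix b c
    have "S (A b) \<bullet> c = - (S (A c) \<bullet> b)" "T b \<bullet> c = T c \<bullet> b"
      using K[of b c] Tsym[of b c] by (simp_all add: inner_commute)
    then show "(S (A b) \<bullet> c) * (T b \<bullet> c) = - ((S (A c) \<bullet> b) * (T c \<bullet> b))" by simp
  qed
  also have "\<dots> = - lin_trace A" unfolding tr by (simp add: sum_negf)
  finally show ?thesis by simp
qed

section \<open>Riemannian geometry in a chart\<close>

lemma frechet_derivative_cong_open:
  assumes "open S" "x \<in> S" "\<And>y. y \<in> S \<Longrightarrow> f y = g y" "g differentiable (at x)"
  shows "frechet_derivative f (at x) = frechet_derivative g (at x)"
  by (rule frechet_derivative_eq,
      rule has_derivative_transform_within_open[OF differentiable_has_derivative[OF assms(4)] assms(1,2)])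
    (simp add: assms(3))

text \<open>Coordinate data on the range of one chart. Symmetry of \<open>Gam\<close> encodes
  vanishing torsion, and \<open>compatible\<close> is metric compatibility for fields with constant
  components.\<close>

locale local_metric =
  fixes S :: "'e::{real_inner,heine_borel,banach} set"
    and Gam :: "'e \<Rightarrow> 'e \<Rightarrow> 'e \<Rightarrow> 'e"
    and G :: "'e \<Rightarrow> 'e \<Rightarrow> 'e \<Rightarrow> real"
  assumes open_S: "open S"
    and Gam_linear_right: "x \<in> S \<Longrightarrow> linear (Gam x u)"
    and Gam_commute: "x \<in> S \<Longrightarrow> Gam x u v = Gam x v u"
    and Gam_smooth: "smooth_on S (\<lambda>x. Gam x u v)"
    and G_linear_right: "x \<in> S \<Longrightarrow> linear (G x u)"
    and G_commute: "x \<in> S \<Longrightarrow> G x u v = G x v u"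
    and G_pos: "x \<in> S \<Longrightarrow> u \<noteq> 0 \<Longrightarrow> G x u u > 0"
    and G_smooth: "smooth_on S (\<lambda>x. G x u v)"
    and compatible: "x \<in> S \<Longrightarrow>
      frechet_derivative (\<lambda>y. G y u v) (at x) w = G x (Gam x w u) v + G x u (Gam x w v)"
begin

lemma Gam_linear_left: "x \<in> S \<Longrightarrow> linear (\<lambda>u. Gam x u v)"
  using Gam_linear_right[of x v] Gam_commute[of x _ v] by simp

lemma G_linear_left: "x \<in> S \<Longrightarrow> linear (\<lambda>u. G x u v)"
  using G_linear_right[of x v] G_commute[of x _ v] by simp

lemmas Gam_lin = linear_add[OF Gam_linear_left] linear_add[OF Gam_linear_right]
  linear_diff[OF Gam_linear_left] linear_diff[OF Gam_linear_right]
  linear_scale[OF Gam_linear_left] linear_scale[OF Gam_linear_right]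
  linear_neg[OF Gam_linear_left] linear_neg[OF Gam_linear_right]

lemmas G_lin = linear_add[OF G_linear_left] linear_add[OF G_linear_right]
  linear_diff[OF G_linear_left] linear_diff[OF G_linear_right]
  linear_scale[OF G_linear_left] linear_scale[OF G_linear_right]
  linear_neg[OF G_linear_left] linear_neg[OF G_linear_right]

lemma Gam_differentiable: "x \<in> S \<Longrightarrow> (\<lambda>x. Gam x u v) differentiable (at x)"
  using smooth_on_differentiable[OF Gam_smooth] .

lemma G_differentiable: "x \<in> S \<Longrightarrow> (\<lambda>x. G x u v) differentiable (at x)"
  using smooth_on_differentiable[OF G_smooth] .

lemma G_eq_0_imp: "x \<in> S \<Longrightarrow> (\<And>v. G x u v = 0) \<Longrightarrow> u = 0"
  using G_pos[of x u] by (metis less_irrefl)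

lemma G_eqI: "x \<in> S \<Longrightarrow> (\<And>w. G x u w = G x v w) \<Longrightarrow> u = v"
  using G_eq_0_imp[of x "u - v"] by (simp add: G_lin)

text \<open>The covariant Leibniz rule: \<open>compatible\<close> turns the derivative of the metric
  coefficients into the Christoffel corrections of the two arguments.\<close>

lemma has_derivative_G:
  assumes "x t \<in> S" "(x has_derivative x') (at t)" "(a has_derivative a') (at t)" "(b has_derivative b') (at t)"
  shows "((\<lambda>s. G (x s) (a s) (b s)) has_derivative
    (\<lambda>h. G (x t) (a' h + Gam (x t) (x' h) (a t)) (b t) + G (x t) (a t) (b' h + Gam (x t) (x' h) (b t)))) (at t)"
proof -
  have "((\<lambda>s. G (x s) (a s) (b s)) has_derivative
    (\<lambda>h. frechet_derivative (\<lambda>y. G y (a t) (b t)) (at (x t)) (x' h)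
      + G (x t) (a' h) (b t) + G (x t) (a t) (b' h))) (at t)"
    by (rule has_derivative_bilinear_apply[where x = x and t = t, OF open_S assms(1) G_linear_right
          G_linear_left G_differentiable[OF assms(1)] assms(2-4)])
  then show ?thesis using assms(1) by (simp add: compatible G_lin algebra_simps)
qed

lemma frechet_derivative_G:
  assumes "x \<in> S" "a differentiable (at x)" "b differentiable (at x)"
  shows "frechet_derivative (\<lambda>y. G y (a y) (b y)) (at x) w =
    G x (frechet_derivative a (at x) w + Gam x w (a x)) (b x)
    + G x (a x) (frechet_derivative b (at x) w + Gam x w (b x))"
  by (subst frechet_derivative_eq[OF has_derivative_G[where x = "\<lambda>y. y", OF assms(1) has_derivative_ident
          differentiable_has_derivative[OF assms(2)] differentiable_has_derivative[OF assms(3)]]]) simp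

lemma frechet_derivative_Gam_commute:
  assumes "x \<in> S"
  shows "frechet_derivative (\<lambda>y. Gam y u v) (at x) = frechet_derivative (\<lambda>y. Gam y v u) (at x)"
  by (rule frechet_derivative_cong_open[OF open_S assms Gam_commute Gam_differentiable[OF assms]])

section \<open>Curvature in coordinates and its symmetries\<close>

text \<open>R(u,v)w computed with constant coordinate fields, whose bracket vanishes; the sign
  convention is that of \<open>curvature\<close>.\<close>

definition curv :: "'e \<Rightarrow> 'e \<Rightarrow> 'e \<Rightarrow> 'e \<Rightarrow> 'e" where
  "curv x u v w = frechet_derivative (\<lambda>y. Gam y v w) (at x) u - frechet_derivative (\<lambda>y. Gam y u w) (at x) v
    + Gam x u (Gam x v w) - Gam x v (Gam x u w)"

lemma curv_antisym: "curv x u v w = - curv x v u w"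
  by (simp add: curv_def)

lemma curv_bianchi:
  assumes "x \<in> S"
  shows "curv x u v w + curv x v w u + curv x w u v = 0"
  using frechet_derivative_Gam_commute[OF assms, of u v] frechet_derivative_Gam_commute[OF assms, of v w]
    frechet_derivative_Gam_commute[OF assms, of u w]
    Gam_commute[OF assms, of u v] Gam_commute[OF assms, of v w] Gam_commute[OF assms, of u w]
  by (simp add: curv_def)

text \<open>This is the commutation of second derivatives of the metric coefficients.\<close>

lemma G_curv_skew:
  assumes x: "x \<in> S"
  shows "G x (curv x u v w) z + G x w (curv x u v z) = 0"
proof -
  have D: "frechet_derivative (\<lambda>y. frechet_derivative (\<lambda>y. G y w z) (at y) v) (at x) u =
     G x (frechet_derivative (\<lambda>y. Gam y v w) (at x) u + Gam x u (Gam x v w)) z + G x (Gam x v w) (Gam x u z)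
     + (G x (Gam x u w) (Gam x v z) + G x w (frechet_derivative (\<lambda>y. Gam y v z) (at x) u + Gam x u (Gam x v z)))"
    for u v
  proof -
    have d: "(\<lambda>y. G y (Gam y v w) z) differentiable (at x)" "(\<lambda>y. G y w (Gam y v z)) differentiable (at x)"
      by (rule differentiableI[OF has_derivative_G[where x = "\<lambda>y. y", OF x has_derivative_ident
          differentiable_has_derivative differentiable_has_derivative]];
          simp add: Gam_differentiable x)+
    have "frechet_derivative (\<lambda>y. frechet_derivative (\<lambda>y. G y w z) (at y) v) (at x) u =
      frechet_derivative (\<lambda>y. G y (Gam y v w) z + G y w (Gam y v z)) (at x) u"
      by (subst frechet_derivative_cong_open[OF open_S x compatible]) (use d in auto)
    also have "\<dots> = frechet_derivative (\<lambda>y. G y (Gam y v w) z) (at x) u + frechet_derivative (\<lambda>y. G y w (Gam y v z)) (at x) u"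
      by (subst frechet_derivative_eq[OF has_derivative_add[OF d[THEN differentiable_has_derivative]]]) simp
    also have "frechet_derivative (\<lambda>y. G y (Gam y v w) z) (at x) u =
       G x (frechet_derivative (\<lambda>y. Gam y v w) (at x) u + Gam x u (Gam x v w)) z + G x (Gam x v w) (Gam x u z)"
      by (subst frechet_derivative_G[OF x]) (simp_all add: Gam_differentiable x)
    also have "frechet_derivative (\<lambda>y. G y w (Gam y v z)) (at x) u =
       G x (Gam x u w) (Gam x v z) + G x w (frechet_derivative (\<lambda>y. Gam y v z) (at x) u + Gam x u (Gam x v z))"
      by (subst frechet_derivative_G[OF x]) (simp_all add: Gam_differentiable x)
    finally show ?thesis .
  qed
  have "frechet_derivative (\<lambda>y. frechet_derivative (\<lambda>y. G y w z) (at y) v) (at x) u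
      = frechet_derivative (\<lambda>y. frechet_derivative (\<lambda>y. G y w z) (at y) u) (at x) v"
    by (rule frechet_derivative_symmetric_real[OF open_S _ x]) (use G_smooth in \<open>auto simp: smooth_on_def\<close>)
  \<comment> \<open>The two terms pairing one Christoffel expression with another are interchanged
    by swapping u and v, so they cancel and only curvature terms remain.\<close>
  then show ?thesis unfolding D by (simp add: curv_def G_lin x)
qed

text \<open>The classical octahedron argument: four Bianchi sums, one for each vector in the last
  slot, combined using the two antisymmetries.\<close>

lemma G_curv_pair_commute:
  assumes x: "x \<in> S"
  shows "G x (curv x u v w) z = G x (curv x w z u) v"
proof -
  define K where "K u v w z = G x (curv x u v w) z" for u v w z
  have a: "K u v w z = - K v u w z" for u v w z
    using curv_antisym[of x u v w] by (simp add: K_def G_lin x)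
  have s: "K u v w z = - K u v z w" for u v w z
    using G_curv_skew[OF x, of u v w z] G_commute[OF x, of w "curv x u v z"] by (simp add: K_def)
  have b: "K u v w z + K v w u z + K w u v z = 0" for u v w z
    using arg_cong[OF curv_bianchi[OF x, of u v w], of "\<lambda>y. G x y z"]
    by (simp add: K_def G_lin x linear_0[OF G_linear_left[OF x]])
  have "K u v w z = K w z u v"
    \<comment> \<open>The instances of \<open>b\<close> are the four Bianchi sums; those of
      \<open>a\<close> and \<open>s\<close> only bring terms to common argument orders up to sign,
      after which the goal is linear.\<close>
    using b[of u v w z] b[of v w z u] b[of w z u v] b[of z u v w]
      a[of u w v z] s[of w u v z] a[of v z w u] s[of v z w u] a[of z v w u] s[of v w z u] s[of w z v u]
      a[of w z v u] s[of z v w u] s[of w u v z] s[of z u w v] s[of u w z v] a[of u w z v] a[of z u v w]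
      s[of u v z w] s[of u v w z] a[of v u w z] s[of z u v w] s[of w z u v] s[of v w u z] a[of w v u z]
      a[of z w u v] s[of u z v w] a[of u z v w] a[of u z w v]
    by linarith
  then show ?thesis by (simp add: K_def)
qed

section \<open>First and second covariant derivatives of a vector field\<close>

definition cov :: "('e \<Rightarrow> 'e) \<Rightarrow> 'e \<Rightarrow> 'e \<Rightarrow> 'e" where
  "cov X x u = frechet_derivative X (at x) u + Gam x u (X x)"

text \<open>The second covariant derivative with u as the outer direction. For constant fields u and
  v, the subtracted term is \<nabla>X in direction \<nabla>_u v, which makes the expression
  tensorial in v.\<close>

definition cov2 :: "('e \<Rightarrow> 'e) \<Rightarrow> 'e \<Rightarrow> 'e \<Rightarrow> 'e \<Rightarrow> 'e" where
  "cov2 X x u v = frechet_derivative (\<lambda>y. cov X y v) (at x) u + Gam x u (cov X x v) - cov X x (Gam x u v)"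

lemma cov_linear:
  assumes "smooth_on S X" "x \<in> S"
  shows "linear (cov X x)"
  unfolding cov_def[abs_def]
  by (intro linear_compose_add smooth_on_linear_derivative[OF assms] Gam_linear_left[OF assms(2)])

lemma cov_smooth:
  assumes "smooth_on S X"
  shows "smooth_on S (\<lambda>x. cov X x u)"
  unfolding cov_def
  by (rule smooth_on_add[OF open_S smooth_on_derivative[OF assms]
        smooth_on_linear_apply[OF open_S Gam_linear_right Gam_smooth assms]])

lemma frechet_derivative_cov:
  assumes X: "smooth_on S X" and x: "x \<in> S"
  shows "frechet_derivative (\<lambda>y. cov X y v) (at x) u =
    frechet_derivative (\<lambda>y. frechet_derivative X (at y) v) (at x) u
    + frechet_derivative (\<lambda>y. Gam y v (X x)) (at x) u + Gam x v (frechet_derivative X (at x) u)"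
proof -
  have "((\<lambda>y. Gam y v (X y)) has_derivative
    (\<lambda>h. frechet_derivative (\<lambda>y. Gam y v (X x)) (at x) h + Gam x v (frechet_derivative X (at x) h))) (at x)"
    by (rule has_derivative_linear_apply[where x = "\<lambda>y. y", OF open_S x Gam_linear_right
          Gam_differentiable[OF x] has_derivative_ident smooth_on_has_derivative[OF X x]])
  from has_derivative_add[OF smooth_on_has_derivative[OF smooth_on_derivative[OF X] x] this]
  show ?thesis unfolding cov_def by (subst frechet_derivative_eq) (auto simp: add.assoc)
qed

text \<open>Second partial derivatives of X commute and \<open>Gam x u v\<close> is symmetric, so
  only curvature terms survive the antisymmetrisation.\<close>

lemma ricci_identity:
  assumes X: "smooth_on S X" and x: "x \<in> S"
  shows "cov2 X x u v - cov2 X x v u = curv x u v (X x)"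
proof -
  have "frechet_derivative (\<lambda>y. frechet_derivative X (at y) v) (at x) u =
      frechet_derivative (\<lambda>y. frechet_derivative X (at y) u) (at x) v"
    by (rule frechet_derivative_symmetric[OF open_S x]) (use X in \<open>auto simp: smooth_on_def\<close>)
  then show ?thesis
    using Gam_commute[OF x, of u v]
    by (simp add: cov2_def frechet_derivative_cov[OF X x] cov_def[of X x v] cov_def[of X x u] curv_def Gam_lin x)
qed

definition skew_cov :: "('e \<Rightarrow> 'e) \<Rightarrow> bool" where
  "skew_cov X \<longleftrightarrow> (\<forall>x\<in>S. \<forall>u v. G x (cov X x u) v + G x u (cov X x v) = 0)"

text \<open>The skewness identity is differentiated in direction w with u and v constant. The
  corrections \<open>Gam x w u\<close> and \<open>Gam x w v\<close> are accounted for by the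
  identity itself at x.\<close>

lemma cov2_skew:
  assumes X: "smooth_on S X" and skew: "skew_cov X" and x: "x \<in> S"
  shows "G x (cov2 X x w u) v + G x u (cov2 X x w v) = 0"
proof -
  have sk: "G y (cov X y u) v + G y u (cov X y v) = 0" if "y \<in> S" for y u v
    using skew that by (simp add: skew_cov_def)
  have d: "(\<lambda>y. cov X y u) differentiable (at x)" for u
    by (rule smooth_on_differentiable[OF cov_smooth[OF X] x])
  have d2: "(\<lambda>y. G y (cov X y u) v) differentiable (at x)" "(\<lambda>y. G y u (cov X y v)) differentiable (at x)"
    by (rule differentiableI[OF has_derivative_G[where x = "\<lambda>y. y", OF x has_derivative_ident
          differentiable_has_derivative differentiable_has_derivative]];
          simp add: d x)+
  have "0 = frechet_derivative (\<lambda>y. G y (cov X y u) v + G y u (cov X y v)) (at x) w"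
    by (subst frechet_derivative_cong_open[OF open_S x sk]) auto
  also have "\<dots> = frechet_derivative (\<lambda>y. G y (cov X y u) v) (at x) w + frechet_derivative (\<lambda>y. G y u (cov X y v)) (at x) w"
    by (subst frechet_derivative_eq[OF has_derivative_add[OF d2[THEN differentiable_has_derivative]]]) simp
  also have "\<dots> = G x (frechet_derivative (\<lambda>y. cov X y u) (at x) w + Gam x w (cov X x u)) v
      + G x (cov X x u) (Gam x w v) + (G x (Gam x w u) (cov X x v)
      + G x u (frechet_derivative (\<lambda>y. cov X y v) (at x) w + Gam x w (cov X x v)))"
    by (simp add: frechet_derivative_G[OF x] d)
  finally show ?thesis
    using sk[OF x, of u "Gam x w v"] sk[OF x, of "Gam x w u" v] by (simp add: cov2_def G_lin x)
qed

text \<open>Test against w. Skewness moves the second derivative in directions u, w against u;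
  exchanging u and w costs a curvature term, and what remains vanishes since a skew map has zero
  diagonal. Pair symmetry then moves X into the second slot of the curvature.\<close>

lemma killing_cov2:
  assumes X: "smooth_on S X" and skew: "skew_cov X" and x: "x \<in> S"
  shows "cov2 X x u u = curv x u (X x) u"
proof (rule G_eqI[OF x])
  fix w
  have "G x (cov2 X x u u) w = - G x (cov2 X x u w) u"
    using cov2_skew[OF assms, of u u w] G_commute[OF x, of u "cov2 X x u w"] by simp
  also have "G x (cov2 X x u w) u = G x (cov2 X x w u) u + G x (curv x u w (X x)) u"
    using arg_cong[OF ricci_identity[OF X x, of u w], of "\<lambda>z. G x z u"] by (simp add: G_lin x)
  also have "G x (cov2 X x w u) u = 0"
    using cov2_skew[OF assms, of w u u] G_commute[OF x, of u "cov2 X x w u"] by simp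
  also have "G x (curv x u w (X x)) u = G x (curv x (X x) u u) w"
    by (rule G_curv_pair_commute[OF x])
  finally show "G x (cov2 X x u u) w = G x (curv x u (X x) u) w"
    using curv_antisym[of x "X x" u u] by (simp add: G_lin x)
qed

section \<open>Derivatives along geodesics\<close>

lemma has_vector_derivative_G:
  assumes "x t \<in> S" "(x has_vector_derivative u) (at t)" "(a has_vector_derivative a') (at t)"
    "(b has_vector_derivative b') (at t)"
  shows "((\<lambda>s. G (x s) (a s) (b s)) has_vector_derivative
    (G (x t) (a' + Gam (x t) u (a t)) (b t) + G (x t) (a t) (b' + Gam (x t) u (b t)))) (at t)"
  using has_derivative_G[OF assms[unfolded has_vector_derivative_def]] assms(1)
  by (simp add: has_vector_derivative_def G_lin Gam_lin algebra_simps)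

text \<open>The geodesic equation makes the derivative of u supply exactly the correction in
  \<open>cov2\<close>. The remaining \<open>Gam\<close> term distinguishes the ordinary from the
  covariant derivative along the curve.\<close>

lemma has_vector_derivative_cov:
  assumes X: "smooth_on S X" and x: "x t \<in> S" "(x has_vector_derivative u t) (at t)"
    and u: "(u has_vector_derivative - Gam (x t) (u t) (u t)) (at t)"
  shows "((\<lambda>s. cov X (x s) (u s)) has_vector_derivative
    (cov2 X (x t) (u t) (u t) - Gam (x t) (u t) (cov X (x t) (u t)))) (at t)"
proof -
  have "((\<lambda>s. cov X (x s) (u s)) has_derivative
    (\<lambda>h. frechet_derivative (\<lambda>y. cov X y (u t)) (at (x t)) (h *\<^sub>R u t)
      + cov X (x t) (h *\<^sub>R - Gam (x t) (u t) (u t)))) (at t)"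
    by (rule has_derivative_linear_apply[OF open_S x(1) cov_linear[OF X]
          smooth_on_differentiable[OF cov_smooth[OF X] x(1)]
          x(2)[unfolded has_vector_derivative_def] u[unfolded has_vector_derivative_def]])
  then show ?thesis
    using linear_scale[OF smooth_on_linear_derivative[OF cov_smooth[OF X] x(1)]]
      linear_scale[OF cov_linear[OF X x(1)]] linear_neg[OF cov_linear[OF X x(1)]]
    by (simp add: has_vector_derivative_def cov2_def algebra_simps)
qed

lemma has_vector_derivative_vfield:
  assumes X: "smooth_on S X" and x: "x t \<in> S" "(x has_vector_derivative u) (at t)"
  shows "((\<lambda>s. X (x s)) has_vector_derivative (cov X (x t) u - Gam (x t) u (X (x t)))) (at t)"
  using has_derivative_compose[OF x(2)[unfolded has_vector_derivative_def] smooth_on_has_derivative[OF X x(1)]]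
    linear_scale[OF smooth_on_linear_derivative[OF X x(1)]]
  by (simp add: has_vector_derivative_def cov_def)

lemma smooth_on_fst: "smooth_on (S \<times> UNIV) (fst :: 'e \<times> 'e \<Rightarrow> 'e)"
  and smooth_on_snd: "smooth_on (S \<times> UNIV) (snd :: 'e \<times> 'e \<Rightarrow> 'e)"
  and open_S_Times: "open (S \<times> (UNIV :: 'e set))"
proof -
  show o: "open (S \<times> (UNIV :: 'e set))" by (simp add: open_Times open_S)
  show "smooth_on (S \<times> UNIV) (fst :: 'e \<times> 'e \<Rightarrow> 'e)" "smooth_on (S \<times> UNIV) (snd :: 'e \<times> 'e \<Rightarrow> 'e)"
    using smooth_on_bounded_linear[OF bounded_linear_fst o smooth_on_id[OF o]]
      smooth_on_bounded_linear[OF bounded_linear_snd o smooth_on_id[OF o]] by simp_all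
qed

text \<open>The second-order geodesic equation becomes a first-order autonomous system for position
  and velocity on \<open>S \<times> UNIV\<close>.\<close>

lemma geodesic_exists:
  assumes "x0 \<in> S"
  obtains d x u where "0 < d" "x 0 = x0" "u 0 = u0" "\<And>t. t \<in> {-d<..<d} \<Longrightarrow> x t \<in> S"
    "\<And>t. t \<in> {-d<..<d} \<Longrightarrow> (x has_vector_derivative u t) (at t)"
    "\<And>t. t \<in> {-d<..<d} \<Longrightarrow> (u has_vector_derivative - Gam (x t) (u t) (u t)) (at t)"
    "smooth_on {-d<..<d} x"
proof -
  let ?F = "\<lambda>z. (snd z, - Gam (fst z) (snd z) (snd z))"
  note o = open_S_Times and f = smooth_on_fst and s = smooth_on_snd
  have g: "smooth_on (S \<times> UNIV) (\<lambda>z :: 'e \<times> 'e. Gam (fst z) a b)" for a b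
    by (rule smooth_on_compose[where f = "\<lambda>y. Gam y a b" and h = fst, OF o Gam_smooth f]) auto
  have "smooth_on (S \<times> UNIV) (\<lambda>z. Gam (fst z) (snd z) (snd z))"
    by (rule smooth_on_bilinear_apply[OF o Gam_linear_right Gam_linear_left g s s]) auto
  then have "smooth_on (S \<times> UNIV) ?F"
    by (intro smooth_on_Pair[OF o s] smooth_on_minus[OF o])
  then obtain d z where z: "0 < d" "z 0 = (x0, u0)" "\<And>t. t \<in> {-d<..<d} \<Longrightarrow> z t \<in> S \<times> UNIV"
    "\<And>t. t \<in> {-d<..<d} \<Longrightarrow> (z has_vector_derivative ?F (z t)) (at t)" "smooth_on {-d<..<d} z"
    using smooth_ode_exists[OF o, of ?F "(x0, u0)"] assms by auto
  show ?thesis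
  proof (rule that[OF z(1), of "\<lambda>t. fst (z t)" "\<lambda>t. snd (z t)"])
    fix t assume t: "t \<in> {-d<..<d}"
    show "fst (z t) \<in> S" using z(3)[OF t] by auto
    show "((\<lambda>t. fst (z t)) has_vector_derivative snd (z t)) (at t)"
      using bounded_linear.has_vector_derivative[OF bounded_linear_fst z(4)[OF t]] by simp
    show "((\<lambda>t. snd (z t)) has_vector_derivative - Gam (fst (z t)) (snd (z t)) (snd (z t))) (at t)"
      using bounded_linear.has_vector_derivative[OF bounded_linear_snd z(4)[OF t]] by simp
  next
    show "smooth_on {-d<..<d} (\<lambda>t. fst (z t))"
      by (rule smooth_on_bounded_linear[OF bounded_linear_fst _ z(5)]) simp
  qed (use z(2) in auto)
qed

text \<open>Since u is parallel, each derivative falls on the other factor: the speed is constant,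
  g(\<nabla>_u X, u) has derivative g(R(u,X)u, u) = 0, and it is itself the derivative of g(X,
  u).\<close>

lemma jacobi_geodesic_affine:
  assumes X: "smooth_on S X" and J: "open J" "is_interval J" "0 \<in> J"
    and x: "\<And>t. t \<in> J \<Longrightarrow> x t \<in> S" "\<And>t. t \<in> J \<Longrightarrow> (x has_vector_derivative u t) (at t)"
    and u: "\<And>t. t \<in> J \<Longrightarrow> (u has_vector_derivative - Gam (x t) (u t) (u t)) (at t)"
    and jac: "\<And>t. t \<in> J \<Longrightarrow> cov2 X (x t) (u t) (u t) = curv (x t) (u t) (X (x t)) (u t)"
    and t: "t \<in> J"
  shows "G (x t) (u t) (u t) = G (x 0) (u 0) (u 0)"
    and "G (x t) (cov X (x t) (u t)) (u t) = G (x 0) (cov X (x 0) (u 0)) (u 0)"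
    and "G (x t) (X (x t)) (u t) = G (x 0) (X (x 0)) (u 0) + t * G (x 0) (cov X (x 0) (u 0)) (u 0)"
proof -
  have const: "h t = h 0" if "\<And>s. s \<in> J \<Longrightarrow> (h has_vector_derivative 0) (at s)" for h :: "real \<Rightarrow> real"
  proof (rule has_derivative_zero_unique[of J h])
    show "convex J" using J(2) is_interval_convex by blast
    show "(h has_derivative (\<lambda>h. 0)) (at s within J)" if "s \<in> J" for s
      using \<open>\<And>s. s \<in> J \<Longrightarrow> (h has_vector_derivative 0) (at s)\<close>[OF that]
      by (simp add: has_vector_derivative_def has_derivative_at_withinI)
  qed (use J t in auto)
  \<comment> \<open>Skewness of the curvature operator with both arguments equal.\<close>
  have curv0: "G (x s) (curv (x s) v w v') v' = 0" if "s \<in> J" for s v w v'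
    using G_curv_skew[OF x(1)[OF that], of v w v' v'] G_commute[OF x(1)[OF that], of v'] by simp
  show "G (x t) (u t) (u t) = G (x 0) (u 0) (u 0)"
  proof (rule const)
    fix s assume s: "s \<in> J"
    show "((\<lambda>t. G (x t) (u t) (u t)) has_vector_derivative 0) (at s)"
      using has_vector_derivative_G[OF x(1)[OF s] x(2)[OF s] u[OF s] u[OF s]] x(1)[OF s]
      by (simp add: linear_0[OF G_linear_left] linear_0[OF G_linear_right])
  qed
  \<comment> \<open>Proved at every time in J, since the affine claim below needs the slope at each
    s.\<close>
  have c: "G (x t) (cov X (x t) (u t)) (u t) = G (x 0) (cov X (x 0) (u 0)) (u 0)" if t: "t \<in> J" for t
  proof (rule has_derivative_zero_unique[of J "\<lambda>t. G (x t) (cov X (x t) (u t)) (u t)"])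
    show "convex J" using J(2) is_interval_convex by blast
    fix s assume s: "s \<in> J"
    have "((\<lambda>t. G (x t) (cov X (x t) (u t)) (u t)) has_vector_derivative 0) (at s)"
      using has_vector_derivative_G[OF x(1)[OF s] x(2)[OF s]
          has_vector_derivative_cov[OF X x(1)[OF s] x(2)[OF s] u[OF s]] u[OF s]] x(1)[OF s] s
      by (simp add: linear_0[OF G_linear_left] linear_0[OF G_linear_right] jac curv0)
    then show "((\<lambda>t. G (x t) (cov X (x t) (u t)) (u t)) has_derivative (\<lambda>h. 0)) (at s within J)"
      by (simp add: has_vector_derivative_def has_derivative_at_withinI)
  qed (use J t in auto)
  then show "G (x t) (cov X (x t) (u t)) (u t) = G (x 0) (cov X (x 0) (u 0)) (u 0)" using t .
  \<comment> \<open>Subtracting the expected linear part reduces the claim to constancy.\<close>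
  have "G (x t) (X (x t)) (u t) - t * G (x 0) (cov X (x 0) (u 0)) (u 0) =
    G (x 0) (X (x 0)) (u 0) - 0 * G (x 0) (cov X (x 0) (u 0)) (u 0)"
  proof (rule const)
    fix s assume s: "s \<in> J"
    have "((\<lambda>t. G (x t) (X (x t)) (u t)) has_vector_derivative G (x 0) (cov X (x 0) (u 0)) (u 0)) (at s)"
      using has_vector_derivative_G[OF x(1)[OF s] x(2)[OF s]
          has_vector_derivative_vfield[OF X x(1)[OF s] x(2)[OF s]] u[OF s]] x(1)[OF s] c[OF s]
      by (simp add: linear_0[OF G_linear_left] linear_0[OF G_linear_right])
    from has_vector_derivative_diff[OF this has_vector_derivative_mult_left[OF has_vector_derivative_id],
        of "G (x 0) (cov X (x 0) (u 0)) (u 0)"]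
    show "((\<lambda>t. G (x t) (X (x t)) (u t) - t * G (x 0) (cov X (x 0) (u 0)) (u 0)) has_vector_derivative 0) (at s)"
      by auto
  qed
  then show "G (x t) (X (x t)) (u t) = G (x 0) (X (x 0)) (u 0) + t * G (x 0) (cov X (x 0) (u 0)) (u 0)"
    by simp
qed

end

text \<open>Tensoriality: second derivatives of y cancel by symmetry, first derivatives of y cancel
  between the two iterated terms, and those of v and w are removed by the bracket b.\<close>

lemma (in local_metric) curvature_formula:
  assumes W: "open W" "W \<subseteq> S" "x \<in> W" and v: "smooth_on W v" and w: "smooth_on W w" and y: "smooth_on W y"
  defines "D \<equiv> \<lambda>a b x. frechet_derivative b (at x) (a x) + Gam x (a x) (b x)"
    and "b \<equiv> frechet_derivative w (at x) (v x) - frechet_derivative v (at x) (w x)"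
  shows "D v (D w y) x - D w (D v y) x - (frechet_derivative y (at x) b + Gam x b (y x)) = curv x (v x) (w x) (y x)"
proof -
  have x: "x \<in> S" using W by blast
  have DD: "frechet_derivative (D a y) (at x) h =
      frechet_derivative (\<lambda>z. frechet_derivative y (at z) (a x)) (at x) h
      + frechet_derivative y (at x) (frechet_derivative a (at x) h)
      + (frechet_derivative (\<lambda>z. Gam z (a x) (y x)) (at x) h
      + Gam x (frechet_derivative a (at x) h) (y x) + Gam x (a x) (frechet_derivative y (at x) h))"
    if a: "smooth_on W a" for a h
  proof -
    note da = smooth_on_has_derivative[OF a W(3)] and dy = smooth_on_has_derivative[OF y W(3)]
    have 1: "((\<lambda>z. frechet_derivative y (at z) (a z)) has_derivative
      (\<lambda>h. frechet_derivative (\<lambda>z. frechet_derivative y (at z) (a x)) (at x) h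
        + frechet_derivative y (at x) (frechet_derivative a (at x) h))) (at x)"
      by (rule has_derivative_linear_apply[where x = "\<lambda>z. z" and L = "\<lambda>z. frechet_derivative y (at z)",
            OF W(1,3) smooth_on_linear_derivative[OF y]
            smooth_on_differentiable[OF smooth_on_derivative[OF y] W(3)] has_derivative_ident da])
    have 2: "((\<lambda>z. Gam z (a z) (y z)) has_derivative
      (\<lambda>h. frechet_derivative (\<lambda>z. Gam z (a x) (y x)) (at x) h
      + Gam x (frechet_derivative a (at x) h) (y x) + Gam x (a x) (frechet_derivative y (at x) h))) (at x)"
      by (rule has_derivative_bilinear_apply[where x = "\<lambda>z. z" and L = Gam,
            OF open_S x Gam_linear_right Gam_linear_left Gam_differentiable[OF x] has_derivative_ident da dy])
    show ?thesis
      unfolding D_def by (subst frechet_derivative_eq[OF has_derivative_add[OF 1 2]]) simp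
  qed
  have sym: "frechet_derivative (\<lambda>z. frechet_derivative y (at z) (w x)) (at x) (v x) =
      frechet_derivative (\<lambda>z. frechet_derivative y (at z) (v x)) (at x) (w x)"
    by (rule frechet_derivative_symmetric[OF W(1,3)]) (use y in \<open>auto simp: smooth_on_def\<close>)
  have e: "D v (D w y) x = frechet_derivative (D w y) (at x) (v x) + Gam x (v x) (D w y x)"
    "D w (D v y) x = frechet_derivative (D v y) (at x) (w x) + Gam x (w x) (D v y x)"
    "D w y x = frechet_derivative y (at x) (w x) + Gam x (w x) (y x)"
    "D v y x = frechet_derivative y (at x) (v x) + Gam x (v x) (y x)"
    by (simp_all add: D_def)
  show ?thesis
    unfolding e(1,2) DD[OF v] DD[OF w] unfolding e(3,4) b_def curv_def sym
    by (simp add: Gam_lin x linear_diff[OF smooth_on_linear_derivative[OF y W(3)]] algebra_simps)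
qed

section \<open>Unit vectors over a compact coordinate set\<close>

context local_metric
begin

lemma smooth_on_G_Times:
  fixes a b :: "'e \<times> 'e \<Rightarrow> 'e"
  assumes "smooth_on (S \<times> UNIV) a" "smooth_on (S \<times> UNIV) b"
  shows "smooth_on (S \<times> UNIV) (\<lambda>z. G (fst z) (a z) (b z))"
proof -
  have g: "smooth_on (S \<times> UNIV) (\<lambda>z :: 'e \<times> 'e. G (fst z) u v)" for u v
    by (rule smooth_on_compose[where f = "\<lambda>y. G y u v" and h = fst, OF open_S_Times G_smooth smooth_on_fst]) auto
  show ?thesis
    by (rule smooth_on_bilinear_apply[OF open_S_Times G_linear_right G_linear_left g assms]) auto
qed

lemma smooth_on_cov_Times:
  assumes X: "smooth_on S X"
  shows "smooth_on (S \<times> UNIV) (\<lambda>z. cov X (fst z) (snd z))"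
proof -
  have g: "smooth_on (S \<times> UNIV) (\<lambda>z :: 'e \<times> 'e. cov X (fst z) u)" for u
    by (rule smooth_on_compose[where f = "\<lambda>y. cov X y u" and h = fst, OF open_S_Times cov_smooth[OF X] smooth_on_fst]) auto
  show ?thesis
    by (rule smooth_on_linear_apply[OF open_S_Times cov_linear[OF X] g smooth_on_snd]) auto
qed

text \<open>Closedness is continuity of the metric. For boundedness, the metric has a positive
  minimum m over K and the Euclidean unit sphere, so by homogeneity a unit vector u satisfies |u|^2
  \<le> 1/m.\<close>

lemma compact_unit_bundle:
  assumes K: "compact K" "K \<subseteq> S"
  shows "compact {z \<in> K \<times> UNIV. G (fst z) (snd z) (snd z) = 1}"
proof -
  have cont: "continuous_on (S \<times> UNIV) (\<lambda>z. G (fst z) (snd z) (snd z))"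
    by (rule smooth_on_continuous[OF smooth_on_G_Times[OF smooth_on_snd smooth_on_snd]])
  have "closed ((K \<times> UNIV) \<inter> (\<lambda>z. G (fst z) (snd z) (snd z)) -` {1})"
    by (rule continuous_closed_preimage[OF continuous_on_subset[OF cont]
          closed_Times[OF compact_imp_closed[OF K(1)] closed_UNIV]])
      (use K in auto)
  moreover have "(K \<times> UNIV) \<inter> (\<lambda>z. G (fst z) (snd z) (snd z)) -` {1} =
      {z \<in> K \<times> UNIV. G (fst z) (snd z) (snd z) = 1}" by auto
  ultimately have cl: "closed {z \<in> K \<times> UNIV. G (fst z) (snd z) (snd z) = 1}" by metis
  have "sphere (0::'e) 1 = {u. norm u = 1}" by auto
  then have "closed (sphere (0::'e) 1)" by (simp add: closed_Collect_eq continuous_on_norm)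
  moreover have "bounded (sphere (0::'e) 1)" by (rule bounded_subset[OF bounded_cball sphere_cball])
  ultimately have sph: "compact (sphere (0::'e) 1)" by (simp add: compact_eq_bounded_closed)
  have "\<exists>m>0. \<forall>z\<in>K \<times> sphere 0 1. m \<le> G (fst z) (snd z) (snd z)"
  \<comment> \<open>The product is empty if K is, or in dimension 0, where the sphere is empty; any
    positive m then serves.\<close>
  proof (cases "K \<times> sphere (0::'e) 1 = {}")
    case False
    have "continuous_on (K \<times> sphere 0 1) (\<lambda>z. G (fst z) (snd z) (snd z))"
      by (rule continuous_on_subset[OF cont]) (use K in auto)
    from continuous_attains_inf[OF compact_Times[OF K(1) sph] False this]
    obtain z0 where z0: "z0 \<in> K \<times> sphere 0 1"
      "\<And>z. z \<in> K \<times> sphere 0 1 \<Longrightarrow> G (fst z0) (snd z0) (snd z0) \<le> G (fst z) (snd z) (snd z)"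
      by blast
    have "snd z0 \<noteq> 0" using z0(1) by auto
    then have "G (fst z0) (snd z0) (snd z0) > 0" using z0(1) K(2) G_pos by auto
    then show ?thesis using z0(2) by blast
  qed (use zero_less_one in blast)
  then obtain m where m: "m > 0" "\<And>x u. x \<in> K \<Longrightarrow> norm u = 1 \<Longrightarrow> m \<le> G x u u" by auto
  have "norm u \<le> sqrt (1 / m)" if x: "x \<in> K" and u: "G x u u = 1" for x u
  proof (cases "u = 0")
    case False
    have "m \<le> G x (u /\<^sub>R norm u) (u /\<^sub>R norm u)" using False by (intro m(2)[OF x]) simp
    also have "\<dots> = 1 / (norm u)\<^sup>2"
      using x K(2) u by (simp add: G_lin subset_iff power2_eq_square field_simps)
    finally have "(norm u)\<^sup>2 \<le> 1 / m" using False m(1) by (simp add: field_simps)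
    then show ?thesis by (simp add: real_le_rsqrt)
  qed (use m(1) in simp)
  then have "{z \<in> K \<times> UNIV. G (fst z) (snd z) (snd z) = 1} \<subseteq> K \<times> cball 0 (sqrt (1 / m))" by auto
  then have "bounded {z \<in> K \<times> UNIV. G (fst z) (snd z) (snd z) = 1}"
    by (rule bounded_subset[rotated]) (intro bounded_Times compact_imp_bounded[OF K(1)] bounded_cball)
  with cl show ?thesis by (simp add: compact_eq_bounded_closed)
qed

text \<open>Polarisation of the quadratic form at u + v.\<close>

lemma skew_cov_diagonal:
  assumes X: "smooth_on S X" and d: "\<And>x u. x \<in> S \<Longrightarrow> G x (cov X x u) u = 0"
  shows "skew_cov X"
  unfolding skew_cov_def
proof (intro ballI allI)
  fix x u v assume x: "x \<in> S"
  show "G x (cov X x u) v + G x u (cov X x v) = 0"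
    using d[OF x, of "u + v"] d[OF x, of u] d[OF x, of v] G_commute[OF x, of u "cov X x v"]
    by (simp add: linear_add[OF cov_linear[OF X x]] G_lin x)
qed

end

section \<open>Charts and tangent vectors\<close>

locale atlas =
  fixes A :: "('a::{t2_space,second_countable_topology}, 'e::{real_inner,heine_borel,banach}) chart set"
  assumes atlas: "smooth_atlas A"
begin

lemma is_chart: "c \<in> A \<Longrightarrow> is_chart c"
  using atlas by (simp add: smooth_atlas_def)

lemma open_cdom: "c \<in> A \<Longrightarrow> open (cdom c)"
  and open_range: "c \<in> A \<Longrightarrow> open (cmap c ` cdom c)"
  and chart_homeomorphism: "c \<in> A \<Longrightarrow> homeomorphism (cdom c) (cmap c ` cdom c) (cmap c) (cinv c)"
  using is_chart by (auto simp: is_chart_def)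

lemma cinv_cmap: "c \<in> A \<Longrightarrow> p \<in> cdom c \<Longrightarrow> cinv c (cmap c p) = p"
  by (rule homeomorphism_apply1[OF chart_homeomorphism])

lemma cinv_in: "c \<in> A \<Longrightarrow> x \<in> cmap c ` cdom c \<Longrightarrow> cinv c x \<in> cdom c"
  by (auto simp: cinv_cmap)

lemma continuous_on_cmap: "c \<in> A \<Longrightarrow> continuous_on (cdom c) (cmap c)"
  and continuous_on_cinv: "c \<in> A \<Longrightarrow> continuous_on (cmap c ` cdom c) (cinv c)"
  using homeomorphism_cont1[OF chart_homeomorphism] homeomorphism_cont2[OF chart_homeomorphism] by blast+

lemma open_cmap_image:
  assumes "c \<in> A" "open U"
  shows "open (cmap c ` (U \<inter> cdom c))"
proof -
  have "cmap c ` (U \<inter> cdom c) = cinv c -` U \<inter> cmap c ` cdom c"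
    using cinv_cmap[OF assms(1)] by force
  then show ?thesis
    using continuous_open_preimage[OF continuous_on_cinv[OF assms(1)] open_range[OF assms(1)] assms(2)]
    by (simp add: Int_commute)
qed

lemma cdom_subset: "c \<in> A \<Longrightarrow> cdom c \<subseteq> mcarrier A"
  by (auto simp: mcarrier_def)

lemma chart_at: "p \<in> mcarrier A \<Longrightarrow> chart_at A p \<in> A" "p \<in> mcarrier A \<Longrightarrow> p \<in> cdom (chart_at A p)"
  using someI_ex[of "\<lambda>c. c \<in> A \<and> p \<in> cdom c"] unfolding chart_at_def mcarrier_def by blast+

section \<open>Transition maps and tangent vectors\<close>

abbreviation tr :: "('a, 'e) chart \<Rightarrow> ('a, 'e) chart \<Rightarrow> 'e \<Rightarrow> 'e" where
  "tr c d \<equiv> cmap d \<circ> cinv c"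

abbreviation dtr :: "('a, 'e) chart \<Rightarrow> ('a, 'e) chart \<Rightarrow> 'a \<Rightarrow> 'e \<Rightarrow> 'e" where
  "dtr c d p \<equiv> frechet_derivative (cmap d \<circ> cinv c) (at (cmap c p))"

lemma tr_smooth: "c \<in> A \<Longrightarrow> d \<in> A \<Longrightarrow> smooth_on (cmap c ` (cdom c \<inter> cdom d)) (tr c d)"
  using atlas by (simp add: smooth_atlas_def)

lemma tr_differentiable:
  "c \<in> A \<Longrightarrow> d \<in> A \<Longrightarrow> p \<in> cdom c \<Longrightarrow> p \<in> cdom d \<Longrightarrow> tr c d differentiable (at (cmap c p))"
  using smooth_on_differentiable[OF tr_smooth] by blast

lemma dtr_linear:
  "c \<in> A \<Longrightarrow> d \<in> A \<Longrightarrow> p \<in> cdom c \<Longrightarrow> p \<in> cdom d \<Longrightarrow> linear (dtr c d p)"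
  using linear_frechet_derivative[OF tr_differentiable] .

lemma tr_cmap: "c \<in> A \<Longrightarrow> p \<in> cdom c \<Longrightarrow> tr c d (cmap c p) = cmap d p"
  by (simp add: cinv_cmap)

lemma open_overlap: "c \<in> A \<Longrightarrow> d \<in> A \<Longrightarrow> open (cmap c ` (cdom c \<inter> cdom d))"
  using open_cmap_image[of c "cdom d"] open_cdom by (simp add: Int_commute)

text \<open>The two coordinate expressions of f differ by a transition map only over the overlap of
  the charts, which is open, so the chain rule may be applied there.\<close>

lemma dtr_chain:
  assumes "c \<in> A" "d \<in> A" "p \<in> cdom c" "p \<in> cdom d"
    and f: "(f \<circ> cinv d) differentiable (at (cmap d p))"
  shows "(f \<circ> cinv c) differentiable (at (cmap c p))"
    and "frechet_derivative (f \<circ> cinv c) (at (cmap c p)) v = frechet_derivative (f \<circ> cinv d) (at (cmap d p)) (dtr c d p v)"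
proof -
  have p: "cmap c p \<in> cmap c ` (cdom c \<inter> cdom d)" using assms by blast
  have e: "(f \<circ> cinv d) (tr c d y) = (f \<circ> cinv c) y" if "y \<in> cmap c ` (cdom c \<inter> cdom d)" for y
    using that assms by (auto simp: cinv_cmap)
  have "((\<lambda>x. (f \<circ> cinv d) (tr c d x)) has_derivative
      (\<lambda>v. frechet_derivative (f \<circ> cinv d) (at (tr c d (cmap c p))) (dtr c d p v))) (at (cmap c p))"
    by (rule has_derivative_compose[OF differentiable_has_derivative[OF tr_differentiable[OF assms(1-4)]]])
      (use differentiable_has_derivative[OF f] in \<open>simp only: tr_cmap[OF assms(1,3)]\<close>)
  from has_derivative_transform_within_open[OF this open_overlap[OF assms(1,2)] p e]
  have "((f \<circ> cinv c) has_derivative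
      (\<lambda>v. frechet_derivative (f \<circ> cinv d) (at (cmap d p)) (dtr c d p v))) (at (cmap c p))"
    by (simp only: tr_cmap[OF assms(1,3)])
  then show "(f \<circ> cinv c) differentiable (at (cmap c p))"
    "frechet_derivative (f \<circ> cinv c) (at (cmap c p)) v = frechet_derivative (f \<circ> cinv d) (at (cmap d p)) (dtr c d p v)"
    by (auto simp: differentiable_def frechet_derivative_eq)
qed

lemma dtr_dtr:
  assumes "c \<in> A" "d \<in> A" "e \<in> A" "p \<in> cdom c" "p \<in> cdom d" "p \<in> cdom e"
  shows "dtr d e p (dtr c d p v) = dtr c e p v"
  using dtr_chain(2)[where f = "cmap e" and c = c and d = d and p = p and v = v] assms tr_differentiable by simp

lemma dtr_self:
  assumes "c \<in> A" "p \<in> cdom c"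
  shows "dtr c c p v = v"
proof -
  have "dtr c c p = frechet_derivative (\<lambda>x. x) (at (cmap c p))"
    by (rule frechet_derivative_cong_open[OF open_range[OF assms(1)]])
      (use assms in \<open>auto simp: cinv_cmap\<close>)
  then show ?thesis by simp
qed

lemma coord_field_apply:
  "p \<in> cdom c \<Longrightarrow> d \<in> A \<Longrightarrow> p \<in> cdom d \<Longrightarrow> coord_field A c u p d = dtr c d p u"
  by (simp add: coord_field_def)

lemma coord_field_self [simp]: "c \<in> A \<Longrightarrow> p \<in> cdom c \<Longrightarrow> coord_field A c u p c = u"
  by (simp add: coord_field_apply dtr_self)

lemma coord_field_tangent:
  assumes "c \<in> A" "p \<in> cdom c"
  shows "coord_field A c u p \<in> tangent_space A p"
  unfolding tangent_space_def
proof (intro CollectI conjI ballI allI impI)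
  show "coord_field A c u p d = 0" if "\<not> (d \<in> A \<and> p \<in> cdom d)" for d
    using that by (auto simp: coord_field_def)
  show "coord_field A c u p e = dtr d e p (coord_field A c u p d)"
    if "d \<in> A" "e \<in> A" "p \<in> cdom d \<inter> cdom e" for d e
    using that assms by (simp add: coord_field_apply dtr_dtr)
qed

lemma tangentD:
  "v \<in> tangent_space A p \<Longrightarrow> c \<in> A \<Longrightarrow> d \<in> A \<Longrightarrow> p \<in> cdom c \<Longrightarrow> p \<in> cdom d \<Longrightarrow> v d = dtr c d p (v c)"
  unfolding tangent_space_def by blast

lemma tangent_outside: "v \<in> tangent_space A p \<Longrightarrow> \<not> (c \<in> A \<and> p \<in> cdom c) \<Longrightarrow> v c = 0"
  unfolding tangent_space_def by blast

text \<open>One component determines a tangent vector: the other charts at p follow through the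
  transition derivatives, and everywhere else both sides have the default 0.\<close>

lemma tangent_eq_coord_field:
  assumes "c \<in> A" "p \<in> cdom c" "v \<in> tangent_space A p"
  shows "coord_field A c (v c) p = v"
proof
  fix d show "coord_field A c (v c) p d = v d"
    using tangentD[OF assms(3,1) _ assms(2), of d] tangent_outside[OF assms(3), of d] assms(2)
    by (auto simp: coord_field_def)
qed

lemma tangentI:
  assumes "\<And>c. \<not> (c \<in> A \<and> p \<in> cdom c) \<Longrightarrow> v c = 0"
    and "\<And>c d. c \<in> A \<Longrightarrow> d \<in> A \<Longrightarrow> p \<in> cdom c \<Longrightarrow> p \<in> cdom d \<Longrightarrow> v d = dtr c d p (v c)"
  shows "v \<in> tangent_space A p"
  using assms unfolding tangent_space_def by blast

text \<open>Operations commuting with all linear maps respect the transition rule;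
  \<open>F 0 0 = 0\<close> preserves the default value outside the charts at p.\<close>

lemma tangent_map2:
  assumes v: "v \<in> tangent_space A p" and w: "w \<in> tangent_space A p"
    and F: "F 0 0 = 0" "\<And>L a b. linear L \<Longrightarrow> L (F a b) = F (L a) (L b)"
  shows "(\<lambda>c. F (v c) (w c)) \<in> tangent_space A p"
proof (rule tangentI)
  show "F (v c) (w c) = 0" if "\<not> (c \<in> A \<and> p \<in> cdom c)" for c
    unfolding tangent_outside[OF v that] tangent_outside[OF w that] by (rule F(1))
  show "F (v d) (w d) = dtr c d p (F (v c) (w c))"
    if "c \<in> A" "d \<in> A" "p \<in> cdom c" "p \<in> cdom d" for c d
    unfolding F(2)[OF dtr_linear[OF that]] tangentD[OF v that, symmetric] tangentD[OF w that, symmetric]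
    by (rule refl)
qed

lemma tangent_tdiff: "v \<in> tangent_space A p \<Longrightarrow> w \<in> tangent_space A p \<Longrightarrow> tdiff v w \<in> tangent_space A p"
  and tangent_tscale: "v \<in> tangent_space A p \<Longrightarrow> tscale r v \<in> tangent_space A p"
  unfolding tdiff_def tscale_def
  using tangent_map2[of v p w "(-)"] tangent_map2[of v p v "\<lambda>a b. r *\<^sub>R a"]
  by (simp_all add: linear_diff linear_scale)

lemma coord_field_add:
  "c \<in> A \<Longrightarrow> coord_field A c (u + v) p = tadd (coord_field A c u p) (coord_field A c v p)"
  and coord_field_scale: "c \<in> A \<Longrightarrow> coord_field A c (r *\<^sub>R u) p = tscale r (coord_field A c u p)"
  by (rule ext; simp add: coord_field_def tadd_def tscale_def dtr_linear linear_add linear_scale)+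

section \<open>Vector fields and their component functions\<close>

text \<open>The axioms of a connection concern fields, so component functions that vary must be
  turned back into fields; \<open>rep\<close> goes the other way.\<close>

definition chart_field :: "('a, 'e) chart \<Rightarrow> ('e \<Rightarrow> 'e) \<Rightarrow> ('a, 'e) vfield" where
  "chart_field c \<phi> = (\<lambda>p. coord_field A c (\<phi> (cmap c p)) p)"

lemma chart_field_const: "chart_field c (\<lambda>x. u) = coord_field A c u"
  by (simp add: chart_field_def)

lemma chart_field_add:
  "c \<in> A \<Longrightarrow> chart_field c (\<lambda>x. \<phi> x + \<psi> x) = (\<lambda>p. tadd (chart_field c \<phi> p) (chart_field c \<psi> p))"
  by (simp add: chart_field_def coord_field_add)

lemma chart_field_scale:
  "c \<in> A \<Longrightarrow> chart_field c (\<lambda>x. f x *\<^sub>R \<phi> x) = (\<lambda>p. tscale ((f \<circ> cmap c) p) (chart_field c \<phi> p))"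
  by (simp add: chart_field_def coord_field_scale)

text \<open>Smoothness on part of one chart is carried to another by precomposing with the
  transition map; thus conditions quantified over the atlas can be verified in a single
  chart.\<close>

lemma smooth_change_chart:
  assumes c: "c \<in> A" and d: "d \<in> A" and U: "open U" and F: "smooth_on (cmap c ` (U \<inter> cdom c)) (F \<circ> cinv c)"
  shows "smooth_on (cmap d ` (U \<inter> cdom c \<inter> cdom d)) (F \<circ> cinv d)"
proof -
  let ?W = "cmap d ` (U \<inter> cdom c \<inter> cdom d)"
  have W: "open ?W" by (rule open_cmap_image[OF d]) (use U open_cdom[OF c] in auto)
  have "smooth_on ?W (\<lambda>x. (F \<circ> cinv c) (tr d c x))"
  proof (rule smooth_on_compose[OF W F])
    show "smooth_on ?W (tr d c)" by (rule smooth_on_subset[OF tr_smooth[OF d c]]) blast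
    show "tr d c ` ?W \<subseteq> cmap c ` (U \<inter> cdom c)" using d by (auto simp: cinv_cmap)
  qed
  then show ?thesis
    by (rule iffD1[OF smooth_on_cong[OF W], rotated]) (use c d in \<open>auto simp: cinv_cmap\<close>)
qed

lemma smooth_function_on_chart:
  assumes c: "c \<in> A" and U: "open U" "U \<subseteq> cdom c" and f: "smooth_on (cmap c ` U) (f \<circ> cinv c)"
  shows "smooth_function_on A U f"
  unfolding smooth_function_on_def
proof
  fix d assume d: "d \<in> A"
  have e: "U \<inter> cdom c = U" using U by auto
  show "smooth_on (cmap d ` (U \<inter> cdom d)) (f \<circ> cinv d)"
    using smooth_change_chart[OF c d U(1), of f] f by (simp add: e)
qed

lemma smooth_vfield_chart_field:
  assumes c: "c \<in> A" and U: "open U" "U \<subseteq> cdom c" and \<phi>: "smooth_on (cmap c ` U) \<phi>"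
  shows "smooth_vfield_on A U (chart_field c \<phi>)"
  unfolding smooth_vfield_on_def
proof (intro conjI ballI)
  show "chart_field c \<phi> p \<in> tangent_space A p" if "p \<in> U" for p
    using coord_field_tangent[OF c] that U by (auto simp: chart_field_def)
  fix d assume d: "d \<in> A"
  have e: "(U \<inter> cdom d) \<inter> cdom c = U \<inter> cdom d" "(U \<inter> cdom d) \<inter> cdom c \<inter> cdom d = U \<inter> cdom d" using U by auto
  have o: "open (U \<inter> cdom d)" using U open_cdom[OF d] by auto
  have W: "open (cmap c ` (U \<inter> cdom d))" using open_cmap_image[OF c o] by (simp add: e)
  have 1: "smooth_on (cmap c ` (U \<inter> cdom d)) (\<lambda>y. frechet_derivative (tr c d) (at y) (\<phi> y))"
    by (rule smooth_on_directional[OF W smooth_on_subset[OF tr_smooth[OF c d]] smooth_on_subset[OF \<phi>]])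
      (use U in auto)
  have "smooth_on (cmap c ` (U \<inter> cdom d)) ((\<lambda>p. chart_field c \<phi> p d) \<circ> cinv c)"
    by (rule iffD1[OF smooth_on_cong[OF W] 1])
      (use U d c in \<open>auto simp: chart_field_def cinv_cmap coord_field_apply subset_iff\<close>)
  then show "smooth_on (cmap d ` (U \<inter> cdom d)) (\<lambda>x. chart_field c \<phi> (cinv d x) d)"
    using smooth_change_chart[OF c d o, of "\<lambda>p. chart_field c \<phi> p d"] unfolding e by (simp add: comp_def)
qed

lemma smooth_vfield_coord_field:
  assumes "c \<in> A" shows "smooth_vfield_on A (cdom c) (coord_field A c u)"
  using smooth_vfield_chart_field[OF assms open_cdom[OF assms] subset_refl smooth_on_const]
  by (simp add: chart_field_const)

lemma smooth_vfield_subset: "smooth_vfield_on A U V \<Longrightarrow> W \<subseteq> U \<Longrightarrow> smooth_vfield_on A W V"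
  unfolding smooth_vfield_on_def by (meson smooth_on_subset image_mono Int_mono subset_iff subset_refl)

lemma smooth_vfield_tangent: "smooth_vfield_on A U V \<Longrightarrow> p \<in> U \<Longrightarrow> V p \<in> tangent_space A p"
  by (simp add: smooth_vfield_on_def)

definition rep :: "('a, 'e) chart \<Rightarrow> ('a, 'e) vfield \<Rightarrow> 'e \<Rightarrow> 'e" where
  "rep c V = (\<lambda>x. V (cinv c x) c)"

lemma rep_cmap: "c \<in> A \<Longrightarrow> p \<in> cdom c \<Longrightarrow> rep c V (cmap c p) = V p c"
  by (simp add: rep_def cinv_cmap)

lemma rep_smooth: "smooth_vfield_on A U V \<Longrightarrow> c \<in> A \<Longrightarrow> smooth_on (cmap c ` (U \<inter> cdom c)) (rep c V)"
  by (simp add: smooth_vfield_on_def rep_def)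

lemma chart_field_rep:
  assumes "smooth_vfield_on A U V" "c \<in> A" "p \<in> U" "p \<in> cdom c"
  shows "chart_field c (rep c V) p = V p"
  using tangent_eq_coord_field[OF assms(2,4) smooth_vfield_tangent[OF assms(1,3)]] assms
  by (simp add: chart_field_def rep_cmap)

text \<open>\<open>dir_deriv\<close> uses a chosen chart; the chain rule and the transformation of
  tangent vectors make the value independent of that choice.\<close>

lemma dir_deriv_chart:
  assumes c: "c \<in> A" "p \<in> cdom c" and v: "v \<in> tangent_space A p"
    and f: "(f \<circ> cinv c) differentiable (at (cmap c p))"
  shows "dir_deriv A f p v = frechet_derivative (f \<circ> cinv c) (at (cmap c p)) (v c)"
proof -
  have p: "p \<in> mcarrier A" using c cdom_subset by blast
  note d = chart_at[OF p]
  show ?thesis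
    unfolding dir_deriv_def Let_def dtr_chain(2)[OF d(1) c(1) d(2) c(2) f]
    using tangentD[OF v d(1) c(1) d(2) c(2)] by simp
qed

lemma smooth_vfield_tdiff:
  assumes "open U" "smooth_vfield_on A U V" "smooth_vfield_on A U W"
  shows "smooth_vfield_on A U (\<lambda>p. tdiff (V p) (W p))"
  unfolding smooth_vfield_on_def
proof (intro conjI ballI)
  show "tdiff (V p) (W p) \<in> tangent_space A p" if "p \<in> U" for p
    by (rule tangent_tdiff[OF smooth_vfield_tangent[OF assms(2) that] smooth_vfield_tangent[OF assms(3) that]])
  show "smooth_on (cmap c ` (U \<inter> cdom c)) (\<lambda>x. tdiff (V (cinv c x)) (W (cinv c x)) c)" if "c \<in> A" for c
    unfolding tdiff_def
    by (rule smooth_on_diff[OF open_cmap_image[OF that assms(1)]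
          rep_smooth[OF assms(2) that, unfolded rep_def] rep_smooth[OF assms(3) that, unfolded rep_def]])
qed

lemma smooth_vfield_cong:
  assumes "open U" "\<And>p. p \<in> U \<Longrightarrow> V p = W p" "smooth_vfield_on A U V"
  shows "smooth_vfield_on A U W"
  unfolding smooth_vfield_on_def
proof (intro conjI ballI)
  show "W p \<in> tangent_space A p" if "p \<in> U" for p
    using assms that by (auto simp: smooth_vfield_on_def)
  fix c assume c: "c \<in> A"
  have "smooth_on (cmap c ` (U \<inter> cdom c)) (rep c V)" by (rule rep_smooth[OF assms(3) c])
  then show "smooth_on (cmap c ` (U \<inter> cdom c)) (\<lambda>x. W (cinv c x) c)"
    by (rule iffD1[OF smooth_on_cong[OF open_cmap_image[OF c assms(1)]], rotated])
      (use assms(2) c in \<open>auto simp: rep_def cinv_cmap\<close>)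
qed

end

section \<open>The connection in a chart\<close>

locale riemannian_manifold = atlas A
  for A :: "('a::{t2_space,second_countable_topology}, 'e::{real_inner,heine_borel,banach}) chart set" +
  fixes g :: "('a, 'e) metric" and nabla :: "('a, 'e) connection"
  assumes metric: "riemannian_metric A g" and levi_civita: "levi_civita A g nabla"
begin

lemma
  assumes "p \<in> mcarrier A" "u \<in> tangent_space A p" "v \<in> tangent_space A p"
  shows g_commute: "g p u v = g p v u"
    and g_add: "w \<in> tangent_space A p \<Longrightarrow> g p (tadd u v) w = g p u w + g p v w"
    and g_scale: "g p (tscale r u) v = r * g p u v"
  using metric assms unfolding riemannian_metric_def by blast+

lemma g_pos: "p \<in> mcarrier A \<Longrightarrow> u \<in> tangent_space A p \<Longrightarrow> u \<noteq> tzero \<Longrightarrow> g p u u > 0"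
  using metric unfolding riemannian_metric_def by blast

lemma g_diff:
  assumes "p \<in> mcarrier A" "u \<in> tangent_space A p" "v \<in> tangent_space A p" "w \<in> tangent_space A p"
  shows "g p (tdiff u v) w = g p u w - g p v w"
proof -
  have "tdiff u v = tadd u (tscale (-1) v)" by (simp add: tdiff_def tadd_def tscale_def)
  then show ?thesis
    using g_add[OF assms(1,2) tangent_tscale[OF assms(3)] assms(4), of "-1"] g_scale[OF assms(1,3,4), of "-1"] by simp
qed

lemma
  assumes U: "open U" "U \<subseteq> mcarrier A" and V: "smooth_vfield_on A U V" and Y: "smooth_vfield_on A U Y"
  shows nabla_smooth: "smooth_vfield_on A U (nabla V Y)"
    and nabla_cong: "(\<And>q. q \<in> U \<Longrightarrow> V' q = V q) \<Longrightarrow> (\<And>q. q \<in> U \<Longrightarrow> Y' q = Y q) \<Longrightarrow> p \<in> U \<Longrightarrow>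
      nabla V' Y' p = nabla V Y p"
    and nabla_add_left: "smooth_vfield_on A U V' \<Longrightarrow> p \<in> U \<Longrightarrow>
      nabla (\<lambda>q. tadd (V q) (V' q)) Y p = tadd (nabla V Y p) (nabla V' Y p)"
    and nabla_add_right: "smooth_vfield_on A U Y' \<Longrightarrow> p \<in> U \<Longrightarrow>
      nabla V (\<lambda>q. tadd (Y q) (Y' q)) p = tadd (nabla V Y p) (nabla V Y' p)"
    and nabla_scale_left: "smooth_function_on A U f \<Longrightarrow> p \<in> U \<Longrightarrow>
      nabla (\<lambda>q. tscale (f q) (V q)) Y p = tscale (f p) (nabla V Y p)"
    and nabla_scale_right: "smooth_function_on A U f \<Longrightarrow> p \<in> U \<Longrightarrow>
      nabla V (\<lambda>q. tscale (f q) (Y q)) p = tadd (tscale (dir_deriv A f p (V p)) (Y p)) (tscale (f p) (nabla V Y p))"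
proof -
  have "affine_connection A nabla" using levi_civita by (simp add: levi_civita_def)
  note * = this[unfolded affine_connection_def, THEN spec[of _ U], THEN mp, OF conjI[OF U],
      THEN spec[of _ V], THEN spec[of _ Y], THEN mp, OF conjI[OF V Y]]
  note a = conjunct1[OF *] and b = conjunct2[OF *]
  note a1 = conjunct1[OF b] and b1 = conjunct2[OF b]
  note a2 = conjunct1[OF b1] and b2 = conjunct2[OF b1]
  note a3 = conjunct1[OF b2] and a4 = conjunct2[OF b2]
  show "smooth_vfield_on A U (nabla V Y)" by (rule a)
  show "nabla V' Y' p = nabla V Y p"
    if "\<And>q. q \<in> U \<Longrightarrow> V' q = V q" "\<And>q. q \<in> U \<Longrightarrow> Y' q = Y q" "p \<in> U"
    using a1 that by blast
  show "nabla (\<lambda>q. tadd (V q) (V' q)) Y p = tadd (nabla V Y p) (nabla V' Y p)"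
    if "smooth_vfield_on A U V'" "p \<in> U"
    using a2 that by blast
  show "nabla V (\<lambda>q. tadd (Y q) (Y' q)) p = tadd (nabla V Y p) (nabla V Y' p)"
    if "smooth_vfield_on A U Y'" "p \<in> U"
    using a3 that by blast
  show "nabla (\<lambda>q. tscale (f q) (V q)) Y p = tscale (f p) (nabla V Y p)"
    "nabla V (\<lambda>q. tscale (f q) (Y q)) p = tadd (tscale (dir_deriv A f p (V p)) (Y p)) (tscale (f p) (nabla V Y p))"
    if "smooth_function_on A U f" "p \<in> U"
    using a4 that by blast+
qed

section \<open>From the abstract connection to Christoffel symbols\<close>

text \<open>Additivity and function-linearity in the direction, iterated over a finite frame, so
  that only the coefficients at p enter.\<close>

lemma nabla_chart_field_left:
  assumes c: "c \<in> A" and U: "open U" "U \<subseteq> cdom c" and Y: "smooth_vfield_on A U Y" and p: "p \<in> U"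
    and f: "\<And>i. i \<in> I \<Longrightarrow> smooth_on (cmap c ` U) (f i)" and I: "finite I"
  shows "nabla (chart_field c (\<lambda>x. \<Sum>i\<in>I. f i x *\<^sub>R w i)) Y p c =
    (\<Sum>i\<in>I. f i (cmap c p) *\<^sub>R nabla (coord_field A c (w i)) Y p c)"
proof -
  have M: "U \<subseteq> mcarrier A" using U(2) cdom_subset[OF c] by blast
  have Uc: "U \<inter> cdom c = U" using U by blast
  have o: "open (cmap c ` U)" using open_cmap_image[OF c U(1)] by (simp add: Uc)
  have fs: "smooth_function_on A U (h \<circ> cmap c)" if "smooth_on (cmap c ` U) h" for h
    by (rule smooth_function_on_chart[OF c U], rule iffD1[OF smooth_on_cong[OF o] that])
      (use c U in \<open>auto simp: cinv_cmap subset_iff\<close>)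
  have sc: "nabla (chart_field c (\<lambda>x. h x *\<^sub>R v)) Y p c = h (cmap c p) *\<^sub>R nabla (coord_field A c v) Y p c"
    if h: "smooth_on (cmap c ` U) h" for h v
    using nabla_scale_left[OF U(1) M smooth_vfield_subset[OF smooth_vfield_coord_field[OF c] U(2)] Y fs[OF h] p, of v]
    by (simp add: chart_field_scale[OF c] chart_field_const tscale_def)
  show ?thesis
    using I f
  proof (induction I)
    case empty
    \<comment> \<open>The empty sum is the zero field, written as the function 0 times a coordinate
      field.\<close>
    show ?case using sc[OF smooth_on_const[of _ 0], of 0] by simp
  next
    case (insert i I)
    have 1: "smooth_on (cmap c ` U) (\<lambda>x. f i x *\<^sub>R w i)"
      by (rule smooth_on_scaleR[OF o insert.prems[OF insertI1] smooth_on_const])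
    have 2: "smooth_on (cmap c ` U) (\<lambda>x. \<Sum>i\<in>I. f i x *\<^sub>R w i)"
      by (rule smooth_on_sum[OF o smooth_on_scaleR[OF o insert.prems[OF insertI2] smooth_on_const]])
    show ?case
      using nabla_add_left[OF U(1) M smooth_vfield_chart_field[OF c U 1] Y smooth_vfield_chart_field[OF c U 2] p]
        insert sc[OF insert.prems[OF insertI1], of "w i"]
      by (simp add: chart_field_add[OF c] tadd_def)
  qed
qed

text \<open>In the differentiated slot the Leibniz rule adds the derivative of each coefficient,
  which produces the derivative term of the coordinate formula.\<close>

lemma nabla_chart_field_right:
  assumes c: "c \<in> A" and U: "open U" "U \<subseteq> cdom c" and V: "smooth_vfield_on A U V" and p: "p \<in> U"
    and f: "\<And>i. i \<in> I \<Longrightarrow> smooth_on (cmap c ` U) (f i)" and I: "finite I"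
  shows "nabla V (chart_field c (\<lambda>x. \<Sum>i\<in>I. f i x *\<^sub>R w i)) p c =
    (\<Sum>i\<in>I. frechet_derivative (f i) (at (cmap c p)) (V p c) *\<^sub>R w i
      + f i (cmap c p) *\<^sub>R nabla V (coord_field A c (w i)) p c)"
proof -
  have M: "U \<subseteq> mcarrier A" using U(2) cdom_subset[OF c] by blast
  have Uc: "U \<inter> cdom c = U" using U by blast
  have o: "open (cmap c ` U)" using open_cmap_image[OF c U(1)] by (simp add: Uc)
  have pc: "p \<in> cdom c" using p U by blast
  have hc: "h x = ((h \<circ> cmap c) \<circ> cinv c) x" if "x \<in> cmap c ` U" for h x
    using that c U by (auto simp: cinv_cmap subset_iff)
  have hs: "smooth_on (cmap c ` U) ((h \<circ> cmap c) \<circ> cinv c)" if "smooth_on (cmap c ` U) h" for h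
    by (rule iffD1[OF _ that], rule smooth_on_cong[OF o], rule hc)
  have fs: "smooth_function_on A U (h \<circ> cmap c)" if "smooth_on (cmap c ` U) h" for h
    by (rule smooth_function_on_chart[OF c U hs[OF that]])
  have dd: "dir_deriv A (h \<circ> cmap c) p (V p) = frechet_derivative h (at (cmap c p)) (V p c)"
    if h: "smooth_on (cmap c ` U) h" for h
  proof -
    have pU: "cmap c p \<in> cmap c ` U" using p by blast
    note h' = hs[OF h]
    have "frechet_derivative h (at (cmap c p)) = frechet_derivative ((h \<circ> cmap c) \<circ> cinv c) (at (cmap c p))"
      by (rule frechet_derivative_cong_open[OF o pU hc smooth_on_differentiable[OF h' pU]])
    then show ?thesis
      by (simp add: dir_deriv_chart[OF c pc smooth_vfield_tangent[OF V p] smooth_on_differentiable[OF h' pU]])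
  qed
  have sc: "nabla V (chart_field c (\<lambda>x. h x *\<^sub>R v)) p c =
      frechet_derivative h (at (cmap c p)) (V p c) *\<^sub>R v + h (cmap c p) *\<^sub>R nabla V (coord_field A c v) p c"
    if h: "smooth_on (cmap c ` U) h" for h v
    using nabla_scale_right[OF U(1) M V smooth_vfield_subset[OF smooth_vfield_coord_field[OF c] U(2)] fs[OF h] p, of v]
    by (simp add: chart_field_scale[OF c] chart_field_const tscale_def tadd_def dd[OF h] c pc)
  show ?thesis
    using I f
  proof (induction I)
    case empty
    show ?case using sc[OF smooth_on_const[of _ 0], of 0] by simp
  next
    case (insert i I)
    have 1: "smooth_on (cmap c ` U) (\<lambda>x. f i x *\<^sub>R w i)"
      by (rule smooth_on_scaleR[OF o insert.prems[OF insertI1] smooth_on_const])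
    have 2: "smooth_on (cmap c ` U) (\<lambda>x. \<Sum>i\<in>I. f i x *\<^sub>R w i)"
      by (rule smooth_on_sum[OF o smooth_on_scaleR[OF o insert.prems[OF insertI2] smooth_on_const]])
    show ?case
      using nabla_add_right[OF U(1) M V smooth_vfield_chart_field[OF c U 1] smooth_vfield_chart_field[OF c U 2] p]
        insert sc[OF insert.prems[OF insertI1], of "w i"]
      by (simp add: chart_field_add[OF c] tadd_def)
  qed
qed

lemma linear_obase_sum: "linear (\<lambda>u :: 'e. \<Sum>b\<in>obase. (u \<bullet> b) *\<^sub>R f b)"
  by (rule linearI) (simp_all add: inner_add_left scaleR_add_left sum.distrib scaleR_sum_right)

lemma nabla_coord_field_left:
  assumes c: "c \<in> A" and U: "open U" "U \<subseteq> cdom c" and Y: "smooth_vfield_on A U Y" and p: "p \<in> U"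
  shows "nabla (coord_field A c u) Y p c = (\<Sum>b\<in>obase. (u \<bullet> b) *\<^sub>R nabla (coord_field A c b) Y p c)"
  using nabla_chart_field_left[OF c U Y p smooth_on_const finite_obase, of "\<lambda>b. u \<bullet> b" "\<lambda>b. b"]
  by (simp add: obase_expand chart_field_const)

lemma christoffel_linear_left:
  assumes "c \<in> A" "p \<in> cdom c" shows "linear (\<lambda>u. christoffel A nabla c p u v)"
proof -
  have e: "christoffel A nabla c p u v = (\<Sum>b\<in>obase. (u \<bullet> b) *\<^sub>R christoffel A nabla c p b v)" for u
    unfolding christoffel_def
    by (rule nabla_coord_field_left[OF assms(1) open_cdom[OF assms(1)] subset_refl
          smooth_vfield_coord_field[OF assms(1)] assms(2)])
  show ?thesis by (subst e) (rule linear_obase_sum)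
qed

lemma christoffel_linear_right:
  assumes c: "c \<in> A" and p: "p \<in> cdom c" shows "linear (christoffel A nabla c p u)"
proof -
  have e: "christoffel A nabla c p u v = (\<Sum>b\<in>obase. (v \<bullet> b) *\<^sub>R christoffel A nabla c p u b)" for v
    using nabla_chart_field_right[OF c open_cdom[OF c] subset_refl smooth_vfield_coord_field[OF c] p
        smooth_on_const finite_obase, of u "\<lambda>b. v \<bullet> b" "\<lambda>b. b"]
    by (simp add: obase_expand chart_field_const christoffel_def)
  show ?thesis by (rule back_subst[of linear, OF linear_obase_sum ext[OF e[symmetric]]])
qed

text \<open>By locality V and Y may be replaced, on the part of U inside the chart, by the chart
  fields of their components. Expanding both in \<open>obase\<close> reduces the connection to its
  values on coordinate fields.\<close>

lemma nabla_chart: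
  assumes U: "open U" "U \<subseteq> mcarrier A" and V: "smooth_vfield_on A U V" and Y: "smooth_vfield_on A U Y"
    and c: "c \<in> A" and p: "p \<in> U" "p \<in> cdom c"
  shows "nabla V Y p c = frechet_derivative (rep c Y) (at (cmap c p)) (V p c)
    + christoffel A nabla c p (V p c) (Y p c)"
proof -
  let ?W = "U \<inter> cdom c"
  have W: "open ?W" "?W \<subseteq> mcarrier A" "?W \<subseteq> cdom c" "p \<in> ?W" using U p open_cdom[OF c] by auto
  note V' = smooth_vfield_subset[OF V Int_lower1, of "cdom c"] and Y' = smooth_vfield_subset[OF Y Int_lower1, of "cdom c"]
  note rV = rep_smooth[OF V c] and rY = rep_smooth[OF Y c]
  have o: "open (cmap c ` ?W)" by (rule open_cmap_image[OF c U(1)])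
  note cV = smooth_vfield_chart_field[OF c W(1,3) rV] and cY = smooth_vfield_chart_field[OF c W(1,3) rY]
  have cs: "smooth_vfield_on A ?W (coord_field A c b)" for b
    by (rule smooth_vfield_subset[OF smooth_vfield_coord_field[OF c] W(3)])
  have in1: "smooth_on (cmap c ` ?W) (\<lambda>x. rep c Z x \<bullet> b)" if "smooth_on (cmap c ` ?W) (rep c Z)" for Z b
    by (rule smooth_on_bounded_linear[OF bounded_linear_inner_left o that])
  have pW: "cmap c p \<in> cmap c ` ?W" using W by blast
  have 1: "nabla V Y p = nabla (chart_field c (rep c V)) (chart_field c (rep c Y)) p"
    by (rule nabla_cong[OF W(1,2) cV cY])
      (use chart_field_rep[OF V c] chart_field_rep[OF Y c] W(4) in auto)
  have 2: "nabla (chart_field c (rep c V)) (chart_field c (rep c Y)) p c =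
    (\<Sum>b\<in>obase. frechet_derivative (\<lambda>x. rep c Y x \<bullet> b) (at (cmap c p)) (chart_field c (rep c V) p c) *\<^sub>R b
      + (Y p c \<bullet> b) *\<^sub>R nabla (chart_field c (rep c V)) (coord_field A c b) p c)"
    using nabla_chart_field_right[OF c W(1,3) cV W(4) in1[OF rY] finite_obase, of "\<lambda>b. b" "\<lambda>b. b"]
    by (simp add: obase_expand rep_cmap c p)
  have 3: "chart_field c (rep c V) p c = V p c"
    using chart_field_rep[OF V c p] by simp
  have 4: "frechet_derivative (\<lambda>x. rep c Y x \<bullet> b) (at (cmap c p)) (V p c) =
      frechet_derivative (rep c Y) (at (cmap c p)) (V p c) \<bullet> b" for b
    by (subst frechet_derivative_eq[OF has_derivative_inner_left[OF smooth_on_has_derivative[OF rY pW]]]) simp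
  have 5: "nabla (chart_field c (rep c V)) (coord_field A c b) p c = christoffel A nabla c p (V p c) b" for b
    using nabla_chart_field_left[OF c W(1,3) cs W(4) in1[OF rV] finite_obase, of "\<lambda>b. b" "\<lambda>b. b" b]
      linear_obase_expand[OF christoffel_linear_left[OF c p(2)], of "V p c" b]
    by (simp add: obase_expand rep_cmap c p christoffel_def)
  show ?thesis
    unfolding 1 2 3 4 5
    using linear_obase_expand[OF christoffel_linear_right[OF c p(2)], of "V p c" "Y p c"]
    by (simp add: sum.distrib obase_expand)
qed

section \<open>Metric coefficients and Christoffel symbols of a chart\<close>

definition chr :: "('a, 'e) chart \<Rightarrow> 'e \<Rightarrow> 'e \<Rightarrow> 'e \<Rightarrow> 'e" where
  "chr c x u v = christoffel A nabla c (cinv c x) u v"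

definition met :: "('a, 'e) chart \<Rightarrow> 'e \<Rightarrow> 'e \<Rightarrow> 'e \<Rightarrow> real" where
  "met c x u v = g (cinv c x) (coord_field A c u (cinv c x)) (coord_field A c v (cinv c x))"

lemma chr_cmap: "c \<in> A \<Longrightarrow> p \<in> cdom c \<Longrightarrow> chr c (cmap c p) u v = christoffel A nabla c p u v"
  by (simp add: chr_def cinv_cmap)

lemma met_cmap:
  "c \<in> A \<Longrightarrow> p \<in> cdom c \<Longrightarrow> u \<in> tangent_space A p \<Longrightarrow> v \<in> tangent_space A p \<Longrightarrow> met c (cmap c p) (u c) (v c) = g p u v"
  by (simp add: met_def cinv_cmap tangent_eq_coord_field)

lemma rep_coord_field: "c \<in> A \<Longrightarrow> x \<in> cmap c ` cdom c \<Longrightarrow> rep c (coord_field A c u) x = u"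
  by (simp add: rep_def cinv_in)

lemma frechet_derivative_rep_coord_field:
  assumes "c \<in> A" "p \<in> cdom c"
  shows "frechet_derivative (rep c (coord_field A c u)) (at (cmap c p)) v = 0"
  by (subst frechet_derivative_cong_open[OF open_range[OF assms(1)] _ rep_coord_field[OF assms(1)]])
    (use assms in auto)

lemma torsion:
  assumes "open U" "U \<subseteq> mcarrier A" "smooth_vfield_on A U V" "smooth_vfield_on A U W" "p \<in> U"
  shows "lie_bracket A V W p = tdiff (nabla V W p) (nabla W V p)"
proof -
  have "torsion_free A nabla" using levi_civita by (simp add: levi_civita_def)
  from this[unfolded torsion_free_def, THEN spec[of _ U], THEN spec[of _ V], THEN spec[of _ W]]
  show ?thesis using assms by force
qed

lemma compat:
  assumes "open U" "U \<subseteq> mcarrier A" "smooth_vfield_on A U V" "smooth_vfield_on A U Y" "smooth_vfield_on A U Z" "p \<in> U"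
  shows "dir_deriv A (\<lambda>q. g q (Y q) (Z q)) p (V p) = g p (nabla V Y p) (Z p) + g p (Y p) (nabla V Z p)"
proof -
  have "metric_compatible A g nabla" using levi_civita by (simp add: levi_civita_def)
  from this[unfolded metric_compatible_def, THEN spec[of _ U], THEN spec[of _ V], THEN spec[of _ Y], THEN spec[of _ Z]]
  show ?thesis using assms by blast
qed

text \<open>Coordinate fields have constant components in c, so their bracket has component 0 there
  and vanishing torsion gives the symmetry.\<close>

lemma christoffel_commute:
  assumes c: "c \<in> A" and p: "p \<in> cdom c"
  shows "christoffel A nabla c p u v = christoffel A nabla c p v u"
proof -
  have "lie_bracket A (coord_field A c u) (coord_field A c v) p c = 0"
    using frechet_derivative_rep_coord_field[OF c p] c p by (simp add: lie_bracket_def rep_def)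
  then show ?thesis
    using torsion[OF open_cdom[OF c] cdom_subset[OF c] smooth_vfield_coord_field[OF c, of u]
        smooth_vfield_coord_field[OF c, of v] p]
    by (simp add: christoffel_def tdiff_def)
qed

lemma met_smooth:
  assumes c: "c \<in> A" shows "smooth_on (cmap c ` cdom c) (\<lambda>x. met c x u v)"
proof -
  have "smooth_function_on A (cdom c) (\<lambda>p. g p (coord_field A c u p) (coord_field A c v p))"
    using metric open_cdom[OF c] cdom_subset[OF c] smooth_vfield_coord_field[OF c]
    unfolding riemannian_metric_def by blast
  then show ?thesis using c by (auto simp: smooth_function_on_def met_def[abs_def] comp_def)
qed

lemma chr_smooth:
  assumes c: "c \<in> A" shows "smooth_on (cmap c ` cdom c) (\<lambda>x. chr c x u v)"
  using rep_smooth[OF nabla_smooth[OF open_cdom[OF c] cdom_subset[OF c] smooth_vfield_coord_field[OF c, of u]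
      smooth_vfield_coord_field[OF c, of v]] c]
  by (simp add: rep_def[abs_def] chr_def christoffel_def)

text \<open>The bridge to the coordinate locale: torsion-freeness, compatibility and positivity are
  evaluated on the coordinate fields of c.\<close>

lemma local_metric_chart:
  assumes c: "c \<in> A"
  shows "local_metric (cmap c ` cdom c) (chr c) (met c)"
proof (rule local_metric.intro)
  show "open (cmap c ` cdom c)" by (rule open_range[OF c])
  fix x u v w assume "x \<in> cmap c ` cdom c"
  then obtain p where x: "x = cmap c p" and p: "p \<in> cdom c" by blast
  note M = subsetD[OF cdom_subset[OF c] p] and t = coord_field_tangent[OF c p]
  show "linear (chr c x u)" unfolding chr_def[abs_def] x cinv_cmap[OF c p] by (rule christoffel_linear_right[OF c p])
  show "chr c x u v = chr c x v u" unfolding x chr_cmap[OF c p] by (rule christoffel_commute[OF c p])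
  have sym: "met c x u v = met c x v u" for u v
    unfolding x met_def cinv_cmap[OF c p] by (rule g_commute[OF M t t])
  have "linear (\<lambda>u. met c x u v)" for v
    by (rule linearI) (simp_all add: x met_def cinv_cmap[OF c p] coord_field_add[OF c] coord_field_scale[OF c]
        g_add[OF M t t t] g_scale[OF M t t])
  then show "linear (met c x u)" "met c x u v = met c x v u" using sym by simp_all
  show "met c x u u > 0" if "u \<noteq> 0"
  proof -
    have "coord_field A c u p \<noteq> tzero"
      using coord_field_self[OF c p, of u] that by (metis tzero_def)
    then show ?thesis unfolding x met_def cinv_cmap[OF c p] by (rule g_pos[OF M t])
  qed
  \<comment> \<open>Needed because \<open>met\<close> accepts components only: the covariant
    derivative at p is recovered from its component in c.\<close>
  have n: "coord_field A c (nabla (coord_field A c w) (coord_field A c u) p c) p = nabla (coord_field A c w) (coord_field A c u) p" for u w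
    by (rule tangent_eq_coord_field[OF c p smooth_vfield_tangent[OF
            nabla_smooth[OF open_cdom[OF c] cdom_subset[OF c] smooth_vfield_coord_field[OF c] smooth_vfield_coord_field[OF c]] p]])
  have e: "(\<lambda>q. g q (coord_field A c u q) (coord_field A c v q)) \<circ> cinv c = (\<lambda>x. met c x u v)"
    by (simp add: met_def comp_def)
  have "dir_deriv A (\<lambda>q. g q (coord_field A c u q) (coord_field A c v q)) p (coord_field A c w p) =
    frechet_derivative (\<lambda>x. met c x u v) (at x) w"
    using dir_deriv_chart[OF c p t, of "\<lambda>q. g q (coord_field A c u q) (coord_field A c v q)" w]
      smooth_on_differentiable[OF met_smooth[OF c]] p unfolding e x by (simp add: c p)
  then show "frechet_derivative (\<lambda>y. met c y u v) (at x) w = met c x (chr c x w u) v + met c x u (chr c x w v)"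
    using compat[OF open_cdom[OF c] cdom_subset[OF c] smooth_vfield_coord_field[OF c, of w]
        smooth_vfield_coord_field[OF c, of u] smooth_vfield_coord_field[OF c, of v] p]
    by (simp add: x met_def cinv_cmap[OF c p] chr_def christoffel_def n)
qed (use chr_smooth[OF c] met_smooth[OF c] in auto)

abbreviation lcov where "lcov c \<equiv> local_metric.cov (chr c)"
abbreviation lcov2 where "lcov2 c \<equiv> local_metric.cov2 (chr c)"
abbreviation lcurv where "lcurv c \<equiv> local_metric.curv (chr c)"
abbreviation lskew where "lskew c \<equiv> local_metric.skew_cov (cmap c ` cdom c) (chr c) (met c)"

lemma nabla_tangent:
  assumes "open U" "U \<subseteq> mcarrier A" "smooth_vfield_on A U V" "smooth_vfield_on A U Y" "p \<in> U"
  shows "nabla V Y p \<in> tangent_space A p"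
  by (rule smooth_vfield_tangent[OF nabla_smooth[OF assms(1-4)] assms(5)])

lemma nabla_lcov:
  assumes U: "open U" "U \<subseteq> mcarrier A" and V: "smooth_vfield_on A U V" and Y: "smooth_vfield_on A U Y"
    and c: "c \<in> A" and p: "p \<in> U" "p \<in> cdom c"
  shows "nabla V Y p c = lcov c (rep c Y) (cmap c p) (V p c)"
proof -
  interpret L: local_metric "cmap c ` cdom c" "chr c" "met c" by (rule local_metric_chart[OF c])
  show ?thesis using nabla_chart[OF assms] by (simp add: L.cov_def chr_cmap rep_cmap c p)
qed

lemma lie_bracket_smooth:
  assumes "open U" "U \<subseteq> mcarrier A" "smooth_vfield_on A U V" "smooth_vfield_on A U W"
  shows "smooth_vfield_on A U (lie_bracket A V W)"
  by (rule smooth_vfield_cong[OF assms(1) torsion[OF assms, symmetric]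
        smooth_vfield_tdiff[OF assms(1) nabla_smooth[OF assms] nabla_smooth[OF assms(1,2,4,3)]]])

text \<open>The coordinate value involves the fields only through their values at p, which justifies
  the arbitrary extensions in \<open>curvature_at\<close>.\<close>

lemma curvature_chart:
  assumes U: "open U" "U \<subseteq> mcarrier A" and V: "smooth_vfield_on A U V" and W: "smooth_vfield_on A U W"
    and Y: "smooth_vfield_on A U Y" and c: "c \<in> A" and p: "p \<in> U" "p \<in> cdom c"
  shows "curvature A nabla V W Y p c = lcurv c (cmap c p) (V p c) (W p c) (Y p c)"
proof -
  interpret L: local_metric "cmap c ` cdom c" "chr c" "met c" by (rule local_metric_chart[OF c])
  define T where "T = cmap c ` (U \<inter> cdom c)"
  have T: "open T" "T \<subseteq> cmap c ` cdom c" "cmap c p \<in> T"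
    using open_cmap_image[OF c U(1)] p by (auto simp: T_def)
  define D where "D = (\<lambda>a b x. frechet_derivative b (at x) (a x) + chr c x (a x) (b x))"
  have Dx: "D a b x = frechet_derivative b (at x) (a x) + chr c x (a x) (b x)" for a b x by (simp add: D_def)
  have r: "rep c (nabla Z Z') x = D (rep c Z) (rep c Z') x"
    if Z: "smooth_vfield_on A U Z" and Z': "smooth_vfield_on A U Z'" and x: "x \<in> T" for Z Z' x
  proof -
    obtain q where q: "x = cmap c q" "q \<in> U" "q \<in> cdom c" using x by (auto simp: T_def)
    show ?thesis
      using nabla_chart[OF U Z Z' c q(2,3)] by (simp add: q D_def rep_cmap c chr_cmap)
  qed
  \<comment> \<open>The outer derivative needs the inner covariant derivative near
    \<open>cmap c p\<close>, not merely at that point; the coordinate formula holds on all of the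
    open set T.\<close>
  have DD: "D (rep c Z) (rep c (nabla Z' Z'')) (cmap c p) = D (rep c Z) (D (rep c Z') (rep c Z'')) (cmap c p)"
    if Z: "smooth_vfield_on A U Z" and Z': "smooth_vfield_on A U Z'" and Z'': "smooth_vfield_on A U Z''" for Z Z' Z''
  proof -
    have "frechet_derivative (D (rep c Z') (rep c Z'')) (at (cmap c p)) = frechet_derivative (rep c (nabla Z' Z'')) (at (cmap c p))"
      by (rule frechet_derivative_cong_open[OF T(1,3) r[OF Z' Z'', symmetric]])
        (use smooth_on_differentiable[OF rep_smooth[OF nabla_smooth[OF U Z' Z''] c]] T(3) in \<open>auto simp: T_def\<close>)
    then show ?thesis by (simp add: Dx[of _ "rep c (nabla Z' Z'')"] Dx[of _ "D (rep c Z') (rep c Z'')"] r[OF Z' Z'' T(3)])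
  qed
  have n: "nabla Z (nabla Z' Y) p c = D (rep c Z) (D (rep c Z') (rep c Y)) (cmap c p)"
    if Z: "smooth_vfield_on A U Z" and Z': "smooth_vfield_on A U Z'" for Z Z'
    using r[OF Z nabla_smooth[OF U Z' Y] T(3)] DD[OF Z Z' Y] by (simp add: rep_cmap c p)
  have lb: "lie_bracket A V W p c = frechet_derivative (rep c W) (at (cmap c p)) (rep c V (cmap c p))
      - frechet_derivative (rep c V) (at (cmap c p)) (rep c W (cmap c p))"
    by (simp add: lie_bracket_def c p rep_cmap) (simp add: rep_def[abs_def])
  have nl: "nabla (lie_bracket A V W) Y p c = frechet_derivative (rep c Y) (at (cmap c p)) (lie_bracket A V W p c)
      + chr c (cmap c p) (lie_bracket A V W p c) (rep c Y (cmap c p))"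
    using nabla_chart[OF U lie_bracket_smooth[OF U V W] Y c p] by (simp add: rep_cmap c p chr_cmap)
  have "curvature A nabla V W Y p c = D (rep c V) (D (rep c W) (rep c Y)) (cmap c p) - D (rep c W) (D (rep c V) (rep c Y)) (cmap c p)
     - (frechet_derivative (rep c Y) (at (cmap c p)) (lie_bracket A V W p c)
      + chr c (cmap c p) (lie_bracket A V W p c) (rep c Y (cmap c p)))"
    by (simp add: curvature_def tdiff_def n V W nl)
  also have "\<dots> = lcurv c (cmap c p) (rep c V (cmap c p)) (rep c W (cmap c p)) (rep c Y (cmap c p))"
    unfolding lb D_def
    by (rule L.curvature_formula[OF T rep_smooth[OF V c, folded T_def] rep_smooth[OF W c, folded T_def]
          rep_smooth[OF Y c, folded T_def]])
  finally show ?thesis by (simp add: rep_cmap c p)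
qed

lemma extend_at:
  assumes "p \<in> mcarrier A" "v \<in> tangent_space A p"
  shows "smooth_vfield_on A (cdom (chart_at A p)) (extend_at A p v)" "extend_at A p v p = v"
  unfolding extend_at_def
  using smooth_vfield_coord_field[OF chart_at(1)[OF assms(1)]] tangent_eq_coord_field[OF chart_at[OF assms(1)] assms(2)]
  by auto

lemma
  assumes p: "p \<in> mcarrier A" and v: "v \<in> tangent_space A p" "w \<in> tangent_space A p" "y \<in> tangent_space A p"
  shows curvature_at_tangent: "curvature_at A nabla p v w y \<in> tangent_space A p"
    and curvature_at_chart: "c \<in> A \<Longrightarrow> p \<in> cdom c \<Longrightarrow>
      curvature_at A nabla p v w y c = lcurv c (cmap c p) (v c) (w c) (y c)"
proof -
  let ?c = "chart_at A p"
  note U = open_cdom[OF chart_at(1)[OF p]] cdom_subset[OF chart_at(1)[OF p]]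
  note e = extend_at[OF p v(1)] extend_at[OF p v(2)] extend_at[OF p v(3)]
  show "curvature_at A nabla p v w y \<in> tangent_space A p"
    unfolding curvature_at_def curvature_def
    by (intro tangent_tdiff nabla_tangent[OF U] nabla_smooth[OF U] lie_bracket_smooth[OF U] e chart_at(2)[OF p])
  show "curvature_at A nabla p v w y c = lcurv c (cmap c p) (v c) (w c) (y c)" if "c \<in> A" "p \<in> cdom c"
    using curvature_chart[OF U e(1,3,5) that(1) chart_at(2)[OF p] that(2)] e(2,4,6)
    by (simp add: curvature_at_def)
qed

text \<open>The inhomogeneous transformation law: in the chart d the coordinate fields of c have
  variable components, whose derivative is the second derivative of the transition map.\<close>

lemma christoffel_transform:
  assumes c: "c \<in> A" "p \<in> cdom c" and d: "d \<in> A" "p \<in> cdom d"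
  shows "christoffel A nabla d p (dtr c d p u) (dtr c d p v) =
    dtr c d p (christoffel A nabla c p u v)
    - frechet_derivative (\<lambda>z. frechet_derivative (tr c d) (at z) v) (at (cmap c p)) u"
proof -
  note U = open_cdom[OF c(1)] cdom_subset[OF c(1)]
  note s = smooth_vfield_coord_field[OF c(1)]
  have W: "open (cmap d ` (cdom d \<inter> cdom c))" "cmap d p \<in> cmap d ` (cdom d \<inter> cdom c)"
    using open_overlap[OF d(1) c(1)] c d by auto
  have tp: "tr d c (cmap d p) = cmap c p" by (rule tr_cmap[OF d])
  have d2: "(\<lambda>z. frechet_derivative (tr c d) (at z) v) differentiable (at (tr d c (cmap d p)))"
    unfolding tp
    by (rule smooth_on_differentiable[OF smooth_on_derivative[OF tr_smooth[OF c(1) d(1)]]]) (use c d in auto)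
  have e: "rep d (coord_field A c v) y = frechet_derivative (tr c d) (at (tr d c y)) v"
    if "y \<in> cmap d ` (cdom d \<inter> cdom c)" for y
    using that c(1) d(1) by (auto simp: rep_def cinv_cmap coord_field_apply)
  have "frechet_derivative (rep d (coord_field A c v)) (at (cmap d p)) (dtr c d p u) =
    frechet_derivative (\<lambda>y. frechet_derivative (tr c d) (at (tr d c y)) v) (at (cmap d p)) (dtr c d p u)"
    by (subst frechet_derivative_cong_open[OF W e differentiableI[OF has_derivative_compose[OF
              differentiable_has_derivative[OF tr_differentiable[OF d(1) c(1) d(2) c(2)]]
              differentiable_has_derivative[OF d2]]]]) auto
  also have "\<dots> = frechet_derivative (\<lambda>z. frechet_derivative (tr c d) (at z) v) (at (tr d c (cmap d p))) (dtr d c p (dtr c d p u))"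
    by (rule frechet_derivative_chain[OF d2 tr_differentiable[OF d(1) c(1) d(2) c(2)]])
  also have "\<dots> = frechet_derivative (\<lambda>z. frechet_derivative (tr c d) (at z) v) (at (cmap c p)) u"
    unfolding tp using dtr_dtr[OF c(1) d(1) c(1) c(2) d(2) c(2)] dtr_self[OF c] by simp
  finally have 1: "frechet_derivative (rep d (coord_field A c v)) (at (cmap d p)) (dtr c d p u) =
    frechet_derivative (\<lambda>z. frechet_derivative (tr c d) (at z) v) (at (cmap c p)) u" .
  have "nabla (coord_field A c u) (coord_field A c v) p d = dtr c d p (christoffel A nabla c p u v)"
    unfolding christoffel_def
    by (rule tangentD[OF nabla_tangent[OF U s s c(2)] c(1) d(1) c(2) d(2)])
  then show ?thesis
    using nabla_chart[OF U s[of u] s[of v] d(1) c(2) d(2)] 1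
    by (simp add: coord_field_apply c d algebra_simps)
qed

section \<open>Geodesics and covariant derivatives along them in a chart\<close>

lemma open_curve_preimage:
  assumes "open J" "smooth_curve_on A J \<gamma>" "c \<in> A"
  shows "open (J \<inter> \<gamma> -` cdom c)"
  using continuous_open_preimage[of J \<gamma> "cdom c"] assms open_cdom by (simp add: smooth_curve_on_def)

lemma velocity_tangent:
  assumes J: "open J" and \<gamma>: "smooth_curve_on A J \<gamma>" and t: "t \<in> J"
  shows "velocity A \<gamma> t \<in> tangent_space A (\<gamma> t)"
proof (rule tangentI)
  show "velocity A \<gamma> t c = 0" if "\<not> (c \<in> A \<and> \<gamma> t \<in> cdom c)" for c using that by (auto simp: velocity_def)
  fix c d assume c: "c \<in> A" "\<gamma> t \<in> cdom c" and d: "d \<in> A" "\<gamma> t \<in> cdom d"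
  define W where "W = (J \<inter> \<gamma> -` cdom c) \<inter> (J \<inter> \<gamma> -` cdom d)"
  have W: "open W" "t \<in> W"
    using open_Int[OF open_curve_preimage[OF J \<gamma> c(1)] open_curve_preimage[OF J \<gamma> d(1)]] c d t
    by (simp_all add: W_def)
  have "smooth_on (J \<inter> \<gamma> -` cdom c) (cmap c \<circ> \<gamma>)" using \<gamma> c by (simp add: smooth_curve_on_def)
  from smooth_on_has_vector_derivative[OF this, of t]
  have v: "((cmap c \<circ> \<gamma>) has_derivative (\<lambda>h. h *\<^sub>R vector_derivative (cmap c \<circ> \<gamma>) (at t))) (at t)"
    using t c by (simp add: has_vector_derivative_def)
  have "(tr c d has_derivative dtr c d (\<gamma> t)) (at ((cmap c \<circ> \<gamma>) t))"
    using differentiable_has_derivative[OF tr_differentiable[OF c(1) d(1) c(2) d(2)]]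
    unfolding o_apply[of "cmap c" \<gamma>] .
  from has_derivative_transform_within_open[OF has_derivative_compose[OF v this] W, of "cmap d \<circ> \<gamma>"]
  have "((cmap d \<circ> \<gamma>) has_vector_derivative dtr c d (\<gamma> t) (vector_derivative (cmap c \<circ> \<gamma>) (at t))) (at t)"
    using c(1) by (simp add: W_def cinv_cmap has_vector_derivative_def linear_scale[OF dtr_linear[OF c(1) d(1) c(2) d(2)]])
  then show "velocity A \<gamma> t d = dtr c d (\<gamma> t) (velocity A \<gamma> t c)"
    using c d by (simp add: velocity_def vector_derivative_at)
qed

lemma
  assumes geo: "geodesic_on A nabla J \<gamma>" and c: "c \<in> A" and t: "t \<in> J" "\<gamma> t \<in> cdom c"
  shows geodesic_position: "((cmap c \<circ> \<gamma>) has_vector_derivative velocity A \<gamma> t c) (at t)"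
    and geodesic_velocity: "((\<lambda>s. velocity A \<gamma> s c) has_vector_derivative
      - chr c (cmap c (\<gamma> t)) (velocity A \<gamma> t c) (velocity A \<gamma> t c)) (at t)"
proof -
  have J: "open J" and \<gamma>: "smooth_curve_on A J \<gamma>" and eq: "cov_along A nabla \<gamma> (velocity A \<gamma>) t = tzero"
    using geo t by (auto simp: geodesic_on_def)
  let ?W = "J \<inter> \<gamma> -` cdom c"
  have W: "open ?W" "t \<in> ?W" using open_curve_preimage[OF J \<gamma> c] t by auto
  have x: "smooth_on ?W (cmap c \<circ> \<gamma>)" using \<gamma> c by (simp add: smooth_curve_on_def)
  show "((cmap c \<circ> \<gamma>) has_vector_derivative velocity A \<gamma> t c) (at t)"
    using smooth_on_has_vector_derivative[OF x W(2)] c t by (simp add: velocity_def)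
  have "smooth_on ?W (\<lambda>s. velocity A \<gamma> s c)"
    by (rule iffD1[OF smooth_on_cong[OF W(1)] smooth_on_vector_derivative[OF W(1) x]])
      (use c in \<open>auto simp: velocity_def\<close>)
  from smooth_on_has_vector_derivative[OF this W(2)]
  have v: "((\<lambda>s. velocity A \<gamma> s c) has_vector_derivative vector_derivative (\<lambda>s. velocity A \<gamma> s c) (at t)) (at t)" .
  have "cov_along A nabla \<gamma> (velocity A \<gamma>) t c = 0" using eq by (simp add: tzero_def)
  then have "vector_derivative (\<lambda>s. velocity A \<gamma> s c) (at t) = - chr c (cmap c (\<gamma> t)) (velocity A \<gamma> t c) (velocity A \<gamma> t c)"
    using c t by (simp add: cov_along_def chr_cmap eq_neg_iff_add_eq_0)
  with v show "((\<lambda>s. velocity A \<gamma> s c) has_vector_derivative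
      - chr c (cmap c (\<gamma> t)) (velocity A \<gamma> t c) (velocity A \<gamma> t c)) (at t)" by simp
qed

lemma rep_smooth_cdom:
  assumes "smooth_vfield_on A (mcarrier A) X" "c \<in> A"
  shows "smooth_on (cmap c ` cdom c) (rep c X)"
  using rep_smooth[OF assms] cdom_subset[OF assms(2)] by (simp add: Int_absorb1)

text \<open>Identifies the intrinsic derivatives along the curve with \<open>cov\<close> and
  \<open>cov2\<close>, so that the Jacobi equation becomes an identity in
  \<open>local_metric\<close>.\<close>

lemma cov_along_geodesic:
  assumes geo: "geodesic_on A nabla J \<gamma>" and X: "smooth_vfield_on A (mcarrier A) X"
    and c: "c \<in> A" and t: "t \<in> J" "\<gamma> t \<in> cdom c"
  shows "cov_along A nabla \<gamma> (X \<circ> \<gamma>) t c = lcov c (rep c X) (cmap c (\<gamma> t)) (velocity A \<gamma> t c)"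
    and "cov_along A nabla \<gamma> (cov_along A nabla \<gamma> (X \<circ> \<gamma>)) t c =
      lcov2 c (rep c X) (cmap c (\<gamma> t)) (velocity A \<gamma> t c) (velocity A \<gamma> t c)"
proof -
  interpret L: local_metric "cmap c ` cdom c" "chr c" "met c" by (rule local_metric_chart[OF c])
  note rX = rep_smooth_cdom[OF X c]
  have J: "open J" and \<gamma>: "smooth_curve_on A J \<gamma>" using geo by (auto simp: geodesic_on_def)
  let ?W = "J \<inter> \<gamma> -` cdom c"
  have W: "open ?W" "t \<in> ?W" using open_curve_preimage[OF J \<gamma> c] t by auto
  \<comment> \<open>Stated for all s near t, because the second covariant derivative differentiates
    this expression.\<close>
  have 1: "cov_along A nabla \<gamma> (X \<circ> \<gamma>) s c = lcov c (rep c X) ((cmap c \<circ> \<gamma>) s) (velocity A \<gamma> s c)" if s: "s \<in> ?W" for s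
  proof -
    have "((\<lambda>s. rep c X ((cmap c \<circ> \<gamma>) s)) has_vector_derivative
        (lcov c (rep c X) ((cmap c \<circ> \<gamma>) s) (velocity A \<gamma> s c)
          - chr c ((cmap c \<circ> \<gamma>) s) (velocity A \<gamma> s c) (rep c X ((cmap c \<circ> \<gamma>) s)))) (at s)"
      by (rule L.has_vector_derivative_vfield[OF rX _ geodesic_position[OF geo c]]) (use s in auto)
    from has_vector_derivative_transform_within_open[OF this W(1) s, of "\<lambda>s. X (\<gamma> s) c"]
    have "((\<lambda>s. X (\<gamma> s) c) has_vector_derivative
        (lcov c (rep c X) (cmap c (\<gamma> s)) (velocity A \<gamma> s c)
          - chr c (cmap c (\<gamma> s)) (velocity A \<gamma> s c) (X (\<gamma> s) c))) (at s)"
      using s c by (simp add: rep_cmap)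
    then show ?thesis
      using s c by (simp add: cov_along_def vector_derivative_at chr_cmap)
  qed
  show "cov_along A nabla \<gamma> (X \<circ> \<gamma>) t c = lcov c (rep c X) (cmap c (\<gamma> t)) (velocity A \<gamma> t c)"
    using 1[OF W(2)] by simp
  have "((\<lambda>s. lcov c (rep c X) ((cmap c \<circ> \<gamma>) s) (velocity A \<gamma> s c)) has_vector_derivative
      (lcov2 c (rep c X) ((cmap c \<circ> \<gamma>) t) (velocity A \<gamma> t c) (velocity A \<gamma> t c)
      - chr c ((cmap c \<circ> \<gamma>) t) (velocity A \<gamma> t c) (lcov c (rep c X) ((cmap c \<circ> \<gamma>) t) (velocity A \<gamma> t c)))) (at t)"
    by (rule L.has_vector_derivative_cov[where x = "cmap c \<circ> \<gamma>" and u = "\<lambda>s. velocity A \<gamma> s c" and t = t,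
          OF rX _ geodesic_position[OF geo c t]])
      (use geodesic_velocity[OF geo c t] t in auto)
  from has_vector_derivative_transform_within_open[OF this W 1[symmetric]]
  have "vector_derivative (\<lambda>s. cov_along A nabla \<gamma> (X \<circ> \<gamma>) s c) (at t) =
      lcov2 c (rep c X) ((cmap c \<circ> \<gamma>) t) (velocity A \<gamma> t c) (velocity A \<gamma> t c)
      - chr c ((cmap c \<circ> \<gamma>) t) (velocity A \<gamma> t c) (lcov c (rep c X) ((cmap c \<circ> \<gamma>) t) (velocity A \<gamma> t c))"
    by (rule vector_derivative_at)
  then show "cov_along A nabla \<gamma> (cov_along A nabla \<gamma> (X \<circ> \<gamma>)) t c =
      lcov2 c (rep c X) (cmap c (\<gamma> t)) (velocity A \<gamma> t c) (velocity A \<gamma> t c)"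
    using 1[OF W(2)] c t by (simp add: cov_along_def[of _ _ _ "cov_along A nabla \<gamma> (X \<circ> \<gamma>)"] chr_cmap)
qed

section \<open>Killing fields and Jacobi fields\<close>

text \<open>Compatibility expands the derivative of g(V,W) along X, and vanishing torsion expands
  the brackets; the terms \<nabla>_X V and \<nabla>_X W cancel.\<close>

lemma lie_deriv_metric_nabla:
  assumes U: "open U" "U \<subseteq> mcarrier A" and X: "smooth_vfield_on A U X"
    and V: "smooth_vfield_on A U V" and W: "smooth_vfield_on A U W" and p: "p \<in> U"
  shows "lie_deriv_metric A g X V W p = g p (nabla V X p) (W p) + g p (V p) (nabla W X p)"
proof -
  have M: "p \<in> mcarrier A" using U p by blast
  note tV = smooth_vfield_tangent[OF V p] and tW = smooth_vfield_tangent[OF W p]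
  note n = nabla_tangent[OF U X V p] nabla_tangent[OF U V X p] nabla_tangent[OF U X W p] nabla_tangent[OF U W X p]
  have "g p (V p) (tdiff (nabla X W p) (nabla W X p)) = g p (V p) (nabla X W p) - g p (V p) (nabla W X p)"
    unfolding g_commute[OF M tV tangent_tdiff[OF n(3,4)]] g_commute[OF M tV n(3)] g_commute[OF M tV n(4)]
    by (rule g_diff[OF M n(3,4) tV])
  then show ?thesis
    unfolding lie_deriv_metric_def compat[OF U X V W p] torsion[OF U X V p] torsion[OF U X W p]
      g_diff[OF M n(1,2) tW] by simp
qed

text \<open>Coordinate fields realise all pairs of vectors at a point, giving one direction; for the
  converse, a single chart around the point suffices.\<close>

lemma killing_iff_skew:
  assumes X: "smooth_vfield_on A (mcarrier A) X"
  shows "killing A g X \<longleftrightarrow> (\<forall>c\<in>A. lskew c (rep c X))"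
proof -
  have key: "lie_deriv_metric A g X V W p =
      met c (cmap c p) (lcov c (rep c X) (cmap c p) (V p c)) (W p c)
      + met c (cmap c p) (V p c) (lcov c (rep c X) (cmap c p) (W p c))"
    if U: "open U" "U \<subseteq> mcarrier A" and V: "smooth_vfield_on A U V" and W: "smooth_vfield_on A U W"
      and p: "p \<in> U" and c: "c \<in> A" "p \<in> cdom c" for U V W p c
  proof -
    note X' = smooth_vfield_subset[OF X U(2)]
    show ?thesis
      unfolding lie_deriv_metric_nabla[OF U X' V W p]
        nabla_lcov[OF U V X' c(1) p c(2), symmetric] nabla_lcov[OF U W X' c(1) p c(2), symmetric]
        met_cmap[OF c nabla_tangent[OF U V X' p] smooth_vfield_tangent[OF W p]]
        met_cmap[OF c smooth_vfield_tangent[OF V p] nabla_tangent[OF U W X' p]] ..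
  qed
  show ?thesis
  proof
    assume k: "killing A g X"
    show "\<forall>c\<in>A. lskew c (rep c X)"
    proof
      fix c assume c: "c \<in> A"
      interpret L: local_metric "cmap c ` cdom c" "chr c" "met c" by (rule local_metric_chart[OF c])
      show "lskew c (rep c X)"
        unfolding L.skew_cov_def
      proof (intro ballI allI)
        fix x u v assume "x \<in> cmap c ` cdom c"
        then obtain p where p: "x = cmap c p" "p \<in> cdom c" by blast
        note s = smooth_vfield_coord_field[OF c]
        have "lie_deriv_metric A g X (coord_field A c u) (coord_field A c v) p = 0"
          using k s open_cdom[OF c] cdom_subset[OF c] p(2) unfolding killing_def by blast
        then show "met c x (lcov c (rep c X) x u) v + met c x u (lcov c (rep c X) x v) = 0"
          using key[OF open_cdom[OF c] cdom_subset[OF c] s s p(2) c p(2), of u v] by (simp add: c p)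
      qed
    qed
  next
    assume sk: "\<forall>c\<in>A. lskew c (rep c X)"
    show "killing A g X"
      unfolding killing_def
    proof (intro allI impI ballI)
      fix U V W p assume h: "open U \<and> U \<subseteq> mcarrier A \<and> smooth_vfield_on A U V \<and> smooth_vfield_on A U W" "p \<in> U"
      then have p: "p \<in> mcarrier A" by blast
      note c = chart_at[OF p]
      interpret L: local_metric "cmap (chart_at A p) ` cdom (chart_at A p)" "chr (chart_at A p)" "met (chart_at A p)"
        by (rule local_metric_chart[OF c(1)])
      show "lie_deriv_metric A g X V W p = 0"
        using key[of U V W p "chart_at A p"] h c sk[THEN bspec, OF c(1)] by (auto simp: L.skew_cov_def)
    qed
  qed
qed

lemma killing_imp_global_jacobi:
  assumes X: "smooth_vfield_on A (mcarrier A) X" and k: "killing A g X"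
  shows "global_jacobi A nabla X"
  unfolding global_jacobi_def jacobi_along_def
proof (intro allI impI ballI)
  fix J \<gamma> t assume geo: "geodesic_on A nabla J \<gamma>" and t: "t \<in> J"
  have J: "open J" and \<gamma>: "smooth_curve_on A J \<gamma>" using geo by (auto simp: geodesic_on_def)
  have M: "\<gamma> t \<in> mcarrier A" using \<gamma> t by (auto simp: smooth_curve_on_def)
  note v = velocity_tangent[OF J \<gamma> t] and Xt = smooth_vfield_tangent[OF X M]
  show "cov_along A nabla \<gamma> (cov_along A nabla \<gamma> (X \<circ> \<gamma>)) t =
    curvature_at A nabla (\<gamma> t) (velocity A \<gamma> t) ((X \<circ> \<gamma>) t) (velocity A \<gamma> t)"
  proof
    fix c
    show "cov_along A nabla \<gamma> (cov_along A nabla \<gamma> (X \<circ> \<gamma>)) t c =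
      curvature_at A nabla (\<gamma> t) (velocity A \<gamma> t) ((X \<circ> \<gamma>) t) (velocity A \<gamma> t) c"
    proof (cases "c \<in> A \<and> \<gamma> t \<in> cdom c")
      case True
      then have c: "c \<in> A" "\<gamma> t \<in> cdom c" by auto
      interpret L: local_metric "cmap c ` cdom c" "chr c" "met c" by (rule local_metric_chart[OF c(1)])
      have sk: "lskew c (rep c X)" using k killing_iff_skew[OF X] c(1) by blast
      have "lcov2 c (rep c X) (cmap c (\<gamma> t)) (velocity A \<gamma> t c) (velocity A \<gamma> t c) =
        lcurv c (cmap c (\<gamma> t)) (velocity A \<gamma> t c) (X (\<gamma> t) c) (velocity A \<gamma> t c)"
        using L.killing_cov2[OF rep_smooth_cdom[OF X c(1)] sk, of "cmap c (\<gamma> t)"] c by (simp add: rep_cmap)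
      then show ?thesis
        using cov_along_geodesic(2)[OF geo X c(1) t c(2)] curvature_at_chart[OF M v Xt v c] by simp
    next
      \<comment> \<open>Outside the charts at the point both sides are 0 by convention.\<close>
      case False
      then show ?thesis
        using tangent_outside[OF curvature_at_tangent[OF M v Xt v] False] by (auto simp: cov_along_def)
    qed
  qed
qed

text \<open>In the chart used by \<open>divergence\<close> the endomorphism is skew for the metric
  coefficients, and \<open>lin_trace_skew_eq_0\<close> applies although the basis is not orthonormal
  for them.\<close>

lemma killing_imp_solenoidal:
  assumes X: "smooth_vfield_on A (mcarrier A) X" and k: "killing A g X"
  shows "solenoidal A nabla X"
  unfolding solenoidal_def divergence_def Let_def
proof
  fix p assume p: "p \<in> mcarrier A"
  let ?c = "chart_at A p"
  note c = chart_at[OF p]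
  interpret L: local_metric "cmap ?c ` cdom ?c" "chr ?c" "met ?c" by (rule local_metric_chart[OF c(1)])
  have sk: "lskew ?c (rep ?c X)" using k killing_iff_skew[OF X] c(1) by blast
  have x: "cmap ?c p \<in> cmap ?c ` cdom ?c" using c(2) by blast
  have "nabla (coord_field A ?c u) X p ?c = lcov ?c (rep ?c X) (cmap ?c p) u" for u
    using nabla_lcov[OF open_cdom[OF c(1)] cdom_subset[OF c(1)] smooth_vfield_coord_field[OF c(1)]
        smooth_vfield_subset[OF X cdom_subset[OF c(1)]] c(1) c(2) c(2), of u] by (simp add: c)
  moreover have "lin_trace (lcov ?c (rep ?c X) (cmap ?c p)) = 0"
    by (rule lin_trace_skew_eq_0[OF L.G_linear_right[OF x] L.G_linear_left[OF x] L.G_commute[OF x]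
          L.G_pos[OF x] L.cov_linear[OF rep_smooth_cdom[OF X c(1)] x]])
      (use sk x in \<open>auto simp: L.skew_cov_def\<close>)
  ultimately show "lin_trace (\<lambda>u. nabla (coord_field A ?c u) X p ?c) = 0" by simp
qed

section \<open>Geodesics constructed in a single chart\<close>

text \<open>\<open>geodesic_on\<close> demands the equation in every chart met by the curve, whereas
  the differential equation was solved in c alone; the transformation law of the Christoffel symbols
  closes the gap.\<close>

lemma
  assumes c: "c \<in> A" and d: "0 < d" and x: "\<And>t. t \<in> {-d<..<d} \<Longrightarrow> x t \<in> cmap c ` cdom c"
    and x': "\<And>t. t \<in> {-d<..<d} \<Longrightarrow> (x has_vector_derivative u t) (at t)"
    and u': "\<And>t. t \<in> {-d<..<d} \<Longrightarrow> (u has_vector_derivative - chr c (x t) (u t) (u t)) (at t)"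
    and sm: "smooth_on {-d<..<d} x"
  shows geodesic_from_chart: "geodesic_on A nabla {-d<..<d} (cinv c \<circ> x)"
    and velocity_from_chart: "\<And>t. t \<in> {-d<..<d} \<Longrightarrow> velocity A (cinv c \<circ> x) t c = u t"
proof -
  let ?J = "{-d<..<d}" and ?\<gamma> = "cinv c \<circ> x"
  have in_c: "?\<gamma> t \<in> cdom c" and x_eq: "cmap c (?\<gamma> t) = x t" if "t \<in> ?J" for t
    using x[OF that] c by (auto simp: cinv_cmap)
  have cont: "continuous_on ?J ?\<gamma>"
    by (rule continuous_on_compose[OF smooth_on_continuous[OF sm] continuous_on_subset[OF continuous_on_cinv[OF c]]])
      (use x in blast)
  define W where "W e = ?J \<inter> ?\<gamma> -` cdom e" for e :: "('a, 'e) chart"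
  have oW: "open (W e)" if "e \<in> A" for e
    unfolding W_def by (rule continuous_open_preimage[OF cont _ open_cdom[OF that]]) simp
  have xW: "x t \<in> cmap c ` (cdom c \<inter> cdom e)" if t: "t \<in> W e" for t e
    using in_c x_eq t unfolding W_def by (metis IntD1 IntD2 IntI image_eqI vimageE)
  have comp: "(cmap e \<circ> ?\<gamma>) = (\<lambda>t. tr c e (x t))" for e by (simp add: comp_def)
  have curve: "smooth_curve_on A ?J ?\<gamma>"
    unfolding smooth_curve_on_def
  proof (intro conjI ballI cont)
    show "?\<gamma> ` ?J \<subseteq> mcarrier A" using in_c cdom_subset[OF c] by blast
    fix e assume e: "e \<in> A"
    show "smooth_on (?J \<inter> ?\<gamma> -` cdom e) (cmap e \<circ> ?\<gamma>)"
      unfolding comp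
      by (rule smooth_on_compose[OF oW[OF e, unfolded W_def] tr_smooth[OF c e] smooth_on_subset[OF sm]])
        (use xW[unfolded W_def] in blast)+
  qed
  have vel: "velocity A ?\<gamma> t e = frechet_derivative (tr c e) (at (x t)) (u t)" if e: "e \<in> A" and t: "t \<in> W e" for t e
  proof -
    have tJ: "t \<in> ?J" and te: "?\<gamma> t \<in> cdom e" using t by (auto simp: W_def)
    note dt = smooth_on_differentiable[OF tr_smooth[OF c e] xW[OF t]]
    have "((\<lambda>t. tr c e (x t)) has_vector_derivative frechet_derivative (tr c e) (at (x t)) (u t)) (at t)"
      using has_derivative_compose[OF x'[OF tJ, unfolded has_vector_derivative_def] differentiable_has_derivative[OF dt]]
        linear_scale[OF linear_frechet_derivative[OF dt]] by (simp add: has_vector_derivative_def)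
    then show ?thesis using e te by (simp add: velocity_def comp vector_derivative_at)
  qed
  have velc: "velocity A ?\<gamma> t c = u t" if t: "t \<in> ?J" for t
  proof -
    have "t \<in> W c" using t in_c by (simp add: W_def)
    then show ?thesis using vel[OF c, of t] dtr_self[OF c in_c[OF t], of "u t"] x_eq[OF t] by simp
  qed
  then show "\<And>t. t \<in> ?J \<Longrightarrow> velocity A ?\<gamma> t c = u t" .
  have "cov_along A nabla ?\<gamma> (velocity A ?\<gamma>) t e = 0" if tJ: "t \<in> ?J" for t e
  proof (cases "e \<in> A \<and> ?\<gamma> t \<in> cdom e")
    case True
    then have e: "e \<in> A" and t: "t \<in> W e" and te: "?\<gamma> t \<in> cdom e" using tJ by (auto simp: W_def)
    \<comment> \<open>The second derivative of the transition map along the velocity. It enters the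
      derivative of the velocity component in e with a plus sign and the Christoffel symbol of e
      with a minus sign, and cancels.\<close>
    let ?D = "frechet_derivative (\<lambda>z. frechet_derivative (tr c e) (at z) (u t)) (at (x t)) (u t)"
    let ?T = "frechet_derivative (tr c e) (at (x t))"
    note ds = smooth_on_differentiable[OF smooth_on_derivative[OF tr_smooth[OF c e]] xW[OF t]]
    note lin = smooth_on_linear_derivative[OF tr_smooth[OF c e] xW[OF t]]
    have "((\<lambda>s. frechet_derivative (tr c e) (at (x s)) (u s)) has_derivative
      (\<lambda>h. frechet_derivative (\<lambda>z. frechet_derivative (tr c e) (at z) (u t)) (at (x t)) (h *\<^sub>R u t)
        + ?T (h *\<^sub>R - chr c (x t) (u t) (u t)))) (at t)"
      by (rule has_derivative_linear_apply[where x = x and t = t, OF open_overlap[OF c e] xW[OF t]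
            smooth_on_linear_derivative[OF tr_smooth[OF c e]] ds
            x'[OF tJ, unfolded has_vector_derivative_def] u'[OF tJ, unfolded has_vector_derivative_def]])
    then have "((\<lambda>s. frechet_derivative (tr c e) (at (x s)) (u s)) has_vector_derivative
        (?D - ?T (chr c (x t) (u t) (u t)))) (at t)"
      by (simp add: has_vector_derivative_def linear_scale[OF linear_frechet_derivative[OF ds]]
          linear_scale[OF lin] linear_neg[OF lin] algebra_simps)
    from vector_derivative_at[OF has_vector_derivative_transform_within_open[OF this oW[OF e] t vel[OF e, symmetric]]]
    have 1: "vector_derivative (\<lambda>s. velocity A ?\<gamma> s e) (at t) = ?D - ?T (chr c (x t) (u t) (u t))" .
    have 2: "christoffel A nabla e (?\<gamma> t) (?T (u t)) (?T (u t)) = ?T (christoffel A nabla c (?\<gamma> t) (u t) (u t)) - ?D"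
      using christoffel_transform[OF c in_c[OF tJ] e te, of "u t" "u t"] unfolding x_eq[OF tJ] .
    have 3: "christoffel A nabla c (?\<gamma> t) (u t) (u t) = chr c (x t) (u t) (u t)"
      by (simp add: chr_def)
    have "cov_along A nabla ?\<gamma> (velocity A ?\<gamma>) t e = vector_derivative (\<lambda>s. velocity A ?\<gamma> s e) (at t)
      + christoffel A nabla e (?\<gamma> t) (velocity A ?\<gamma> t e) (velocity A ?\<gamma> t e)"
      using True by (simp add: cov_along_def)
    then show ?thesis unfolding 1 vel[OF e t] 2 3 by simp
  qed (auto simp: cov_along_def)
  then show "geodesic_on A nabla ?J ?\<gamma>"
    unfolding geodesic_on_def using curve by (simp add: is_interval_oo fun_eq_iff tzero_def)
qed

section \<open>The compactness argument for global Jacobi fields\<close>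

definition jpair :: "('a, 'e) vfield \<Rightarrow> 'a \<Rightarrow> ('a, 'e) tvec \<Rightarrow> real \<times> real" where
  "jpair X p v = (g p (nabla (extend_at A p v) X p) v, g p (X p) v)"

definition ljpair :: "('a, 'e) vfield \<Rightarrow> ('a, 'e) chart \<Rightarrow> 'e \<Rightarrow> 'e \<Rightarrow> real \<times> real" where
  "ljpair X c x u = (met c x (lcov c (rep c X) x u) u, met c x (rep c X x) u)"

lemma jpair_chart:
  assumes X: "smooth_vfield_on A (mcarrier A) X" and c: "c \<in> A" "p \<in> cdom c" and v: "v \<in> tangent_space A p"
  shows "jpair X p v = ljpair X c (cmap c p) (v c)"
proof -
  have p: "p \<in> mcarrier A" using c cdom_subset by blast
  note d = chart_at[OF p]
  note U = open_cdom[OF d(1)] cdom_subset[OF d(1)]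
  note e = extend_at[OF p v] and X' = smooth_vfield_subset[OF X U(2)]
  have "met c (cmap c p) (lcov c (rep c X) (cmap c p) (v c)) (v c) = g p (nabla (extend_at A p v) X p) v"
    using nabla_lcov[OF U e(1) X' c(1) d(2) c(2)] met_cmap[OF c nabla_tangent[OF U e(1) X' d(2)] v] by (simp add: e(2))
  moreover have "met c (cmap c p) (rep c X (cmap c p)) (v c) = g p (X p) v"
    using met_cmap[OF c smooth_vfield_tangent[OF X p] v] by (simp add: rep_cmap c)
  ultimately show ?thesis by (simp add: jpair_def ljpair_def)
qed

text \<open>The image in the plane of the unit tangent bundle under the pair (a, b) of the overview;
  compactness is asserted of this image only.\<close>

definition jset :: "('a, 'e) vfield \<Rightarrow> (real \<times> real) set" where
  "jset X = {jpair X p v | p v. p \<in> mcarrier A \<and> v \<in> tangent_space A p \<and> g p v v = 1}"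

lemma ljpair_in_jset:
  assumes X: "smooth_vfield_on A (mcarrier A) X" and c: "c \<in> A" and x: "x \<in> cmap c ` cdom c" and u: "met c x u u = 1"
  shows "ljpair X c x u \<in> jset X"
proof -
  obtain p where p: "x = cmap c p" "p \<in> cdom c" using x by blast
  note t = coord_field_tangent[OF c p(2), of u]
  have "ljpair X c x u = jpair X p (coord_field A c u p)"
    using jpair_chart[OF X c p(2) t] by (simp add: c p)
  moreover have "g p (coord_field A c u p) (coord_field A c u p) = 1"
    using met_cmap[OF c p(2) t t] u by (simp add: c p)
  ultimately show ?thesis
    unfolding jset_def using t cdom_subset[OF c] p(2) by blast
qed

text \<open>Finitely many coordinate balls cover the manifold, and over each closed ball the unit
  vectors form a compact set on which the pair is continuous.\<close>

lemma compact_jset: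
  assumes X: "smooth_vfield_on A (mcarrier A) X" and M: "compact (mcarrier A)"
  shows "compact (jset X)"
proof -
  have "\<exists>r>0. cball (cmap (chart_at A p) p) r \<subseteq> cmap (chart_at A p) ` cdom (chart_at A p)"
    if "p \<in> mcarrier A" for p
    using open_contains_cball open_range[OF chart_at(1)[OF that]] chart_at(2)[OF that] by blast
  then obtain r where r: "\<And>p. p \<in> mcarrier A \<Longrightarrow> r p > 0"
    "\<And>p. p \<in> mcarrier A \<Longrightarrow> cball (cmap (chart_at A p) p) (r p) \<subseteq> cmap (chart_at A p) ` cdom (chart_at A p)"
    by metis
  \<comment> \<open>Open balls provide the cover; the closed balls of the same radius, which still
    lie in the chart ranges, provide compactness in \<open>B\<close>.\<close>
  define N where "N p = cdom (chart_at A p) \<inter> cmap (chart_at A p) -` ball (cmap (chart_at A p) p) (r p)" for p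
  have oN: "open (N p)" if "p \<in> mcarrier A" for p
    unfolding N_def
    by (rule continuous_open_preimage[OF continuous_on_cmap open_cdom open_ball]) (use chart_at[OF that] in auto)
  have "p \<in> N p" if "p \<in> mcarrier A" for p
    using r(1)[OF that] chart_at[OF that] by (simp add: N_def)
  then have "mcarrier A \<subseteq> (\<Union>p\<in>mcarrier A. N p)" by blast
  from compactE_image[OF M oN this]
  obtain I where I: "I \<subseteq> mcarrier A" "finite I" "mcarrier A \<subseteq> (\<Union>p\<in>I. N p)"
    by metis
  define B where "B p = {z \<in> cball (cmap (chart_at A p) p) (r p) \<times> UNIV.
      met (chart_at A p) (fst z) (snd z) (snd z) = 1}" for p
  have "jset X = (\<Union>p\<in>I. (\<lambda>z. ljpair X (chart_at A p) (fst z) (snd z)) ` B p)"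
  proof (intro equalityI subsetI)
    fix y assume "y \<in> jset X"
    then obtain q v where q: "y = jpair X q v" "q \<in> mcarrier A" "v \<in> tangent_space A q" "g q v v = 1"
      by (auto simp: jset_def)
    then obtain p where p: "p \<in> I" "q \<in> N p" using I(3) by blast
    have c: "chart_at A p \<in> A" "q \<in> cdom (chart_at A p)"
      using chart_at I(1) p by (auto simp: N_def)
    have "(cmap (chart_at A p) q, v (chart_at A p)) \<in> B p"
      using p(2) met_cmap[OF c q(3,3)] q(4) by (auto simp: B_def N_def)
    moreover have "y = ljpair X (chart_at A p) (fst (cmap (chart_at A p) q, v (chart_at A p))) (snd (cmap (chart_at A p) q, v (chart_at A p)))"
      using jpair_chart[OF X c q(3)] q(1) by simp
    ultimately show "y \<in> (\<Union>p\<in>I. (\<lambda>z. ljpair X (chart_at A p) (fst z) (snd z)) ` B p)"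
      using p(1) by blast
  next
    fix y assume "y \<in> (\<Union>p\<in>I. (\<lambda>z. ljpair X (chart_at A p) (fst z) (snd z)) ` B p)"
    then obtain p z where z: "p \<in> I" "z \<in> B p" "y = ljpair X (chart_at A p) (fst z) (snd z)" by blast
    have p: "p \<in> mcarrier A" using z(1) I(1) by blast
    show "y \<in> jset X"
      unfolding z(3)
      by (rule ljpair_in_jset[OF X chart_at(1)[OF p]]) (use z(2) r(2)[OF p] in \<open>auto simp: B_def\<close>)
  qed
  moreover have "compact ((\<lambda>z. ljpair X (chart_at A p) (fst z) (snd z)) ` B p)" if "p \<in> I" for p
  proof -
    have p: "p \<in> mcarrier A" using that I(1) by blast
    let ?c = "chart_at A p"
    note c = chart_at[OF p]
    interpret L: local_metric "cmap ?c ` cdom ?c" "chr ?c" "met ?c" by (rule local_metric_chart[OF c(1)])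
    note rX = rep_smooth_cdom[OF X c(1)]
    have rX': "smooth_on ((cmap ?c ` cdom ?c) \<times> UNIV) (\<lambda>z :: 'e \<times> 'e. rep ?c X (fst z))"
      by (rule smooth_on_compose[OF L.open_S_Times rX L.smooth_on_fst]) auto
    have "smooth_on ((cmap ?c ` cdom ?c) \<times> UNIV) (\<lambda>z. ljpair X ?c (fst z) (snd z))"
      unfolding ljpair_def
      by (rule smooth_on_Pair[OF L.open_S_Times
            L.smooth_on_G_Times[OF L.smooth_on_cov_Times[OF rX] L.smooth_on_snd]
            L.smooth_on_G_Times[OF rX' L.smooth_on_snd]])
    then have "continuous_on (B p) (\<lambda>z. ljpair X ?c (fst z) (snd z))"
      by (rule continuous_on_subset[OF smooth_on_continuous]) (use r(2)[OF p] in \<open>auto simp: B_def\<close>)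
    moreover have "compact (B p)"
      unfolding B_def by (rule L.compact_unit_bundle[OF compact_cball r(2)[OF p]])
    ultimately show ?thesis by (rule compact_continuous_image)
  qed
  ultimately show ?thesis using I(2) by (auto intro!: compact_UN)
qed

text \<open>A short geodesic with initial velocity v stays in one chart and keeps unit speed, so the
  affine motion of its pair remains in \<open>jset X\<close>.\<close>

lemma jset_flow:
  assumes X: "smooth_vfield_on A (mcarrier A) X" and jac: "global_jacobi A nabla X" and ab: "(a, b) \<in> jset X"
  obtains d where "0 < d" "\<And>t. t \<in> {-d<..<d} \<Longrightarrow> (a, b + t * a) \<in> jset X"
proof -
  obtain p v where p: "p \<in> mcarrier A" and v: "v \<in> tangent_space A p" "g p v v = 1" and ab: "jpair X p v = (a, b)"
    using ab by (auto simp: jset_def)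
  define c where "c = chart_at A p"
  have c: "c \<in> A" "p \<in> cdom c" using chart_at[OF p] by (auto simp: c_def)
  interpret L: local_metric "cmap c ` cdom c" "chr c" "met c" by (rule local_metric_chart[OF c(1)])
  note rX = rep_smooth_cdom[OF X c(1)]
  have "cmap c p \<in> cmap c ` cdom c" using c by blast
  from L.geodesic_exists[OF this, of "v c"]
  obtain d x u where d: "0 < d" "x 0 = cmap c p" "u 0 = v c"
    and x: "\<And>t. t \<in> {-d<..<d} \<Longrightarrow> x t \<in> cmap c ` cdom c"
    and x': "\<And>t. t \<in> {-d<..<d} \<Longrightarrow> (x has_vector_derivative u t) (at t)"
    and u': "\<And>t. t \<in> {-d<..<d} \<Longrightarrow> (u has_vector_derivative - chr c (x t) (u t) (u t)) (at t)"
    and sm: "smooth_on {-d<..<d} x" by metis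
  let ?J = "{-d<..<d}" and ?\<gamma> = "cinv c \<circ> x"
  have geo: "geodesic_on A nabla ?J ?\<gamma>"
    by (rule geodesic_from_chart[OF c(1) d(1) x x' u' sm])
  have vel: "velocity A ?\<gamma> t c = u t" if "t \<in> ?J" for t
    by (rule velocity_from_chart[OF c(1) d(1) x x' u' sm that])
  have \<gamma>: "smooth_curve_on A ?J ?\<gamma>" using geo by (simp add: geodesic_on_def)
  have j: "lcov2 c (rep c X) (x t) (u t) (u t) = lcurv c (x t) (u t) (rep c X (x t)) (u t)" if t: "t \<in> ?J" for t
  proof -
    have in_c: "?\<gamma> t \<in> cdom c" and x_eq: "cmap c (?\<gamma> t) = x t"
      using x[OF t] c(1) by (auto simp: cinv_cmap)
    have M: "?\<gamma> t \<in> mcarrier A" using in_c cdom_subset[OF c(1)] by blast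
    note vt = velocity_tangent[OF open_greaterThanLessThan \<gamma> t] and Xt = smooth_vfield_tangent[OF X M]
    have "cov_along A nabla ?\<gamma> (cov_along A nabla ?\<gamma> (X \<circ> ?\<gamma>)) t =
        curvature_at A nabla (?\<gamma> t) (velocity A ?\<gamma> t) ((X \<circ> ?\<gamma>) t) (velocity A ?\<gamma> t)"
      using jac geo t unfolding global_jacobi_def jacobi_along_def by blast
    moreover have r: "rep c X (x t) = X (?\<gamma> t) c" by (simp add: rep_def)
    ultimately show ?thesis
      using cov_along_geodesic(2)[OF geo X c(1) t in_c]
        curvature_at_chart[OF M vt Xt vt c(1) in_c]
      by (simp only: vel[OF t] x_eq r o_apply[of X])
  qed
  have J: "open ?J" "is_interval ?J" "0 \<in> ?J" using d(1) by (auto simp: is_interval_oo)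
  have aff: "met c (x t) (u t) (u t) = met c (x 0) (u 0) (u 0)"
    "met c (x t) (lcov c (rep c X) (x t) (u t)) (u t) = met c (x 0) (lcov c (rep c X) (x 0) (u 0)) (u 0)"
    "met c (x t) (rep c X (x t)) (u t) =
      met c (x 0) (rep c X (x 0)) (u 0) + t * met c (x 0) (lcov c (rep c X) (x 0) (u 0)) (u 0)"
    if "t \<in> ?J" for t
    by (rule L.jacobi_geodesic_affine[where x = x and u = u and J = ?J, OF rX J x x' u' j that]; assumption)+
  have ab': "met c (x 0) (lcov c (rep c X) (x 0) (u 0)) (u 0) = a" "met c (x 0) (rep c X (x 0)) (u 0) = b"
    using jpair_chart[OF X c v(1)] ab by (auto simp: ljpair_def d)
  have one: "met c (x 0) (u 0) (u 0) = 1" using met_cmap[OF c v(1,1)] v(2) by (simp add: d)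
  show ?thesis
  proof (rule that[OF d(1)])
    fix t assume t: "t \<in> ?J"
    have "ljpair X c (x t) (u t) \<in> jset X"
      by (rule ljpair_in_jset[OF X c(1) x[OF t]]) (use aff(1)[OF t] one in simp)
    then show "(a, b + t * a) \<in> jset X"
      using aff(2,3)[OF t] ab' by (simp add: ljpair_def)
  qed
qed

lemma jset_fst_eq_0:
  assumes X: "smooth_vfield_on A (mcarrier A) X" and M: "compact (mcarrier A)"
    and jac: "global_jacobi A nabla X" and ab: "(a, b) \<in> jset X"
  shows "a = 0"
proof (rule ccontr)
  assume a: "a \<noteq> 0"
  have "compact (jset X \<inter> {a} \<times> UNIV)"
    by (intro compact_Int_closed compact_jset[OF X M] closed_Times) auto
  then have "compact (snd ` (jset X \<inter> {a} \<times> UNIV))"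
    by (rule compact_continuous_image[rotated]) (intro continuous_intros)
  moreover have "snd ` (jset X \<inter> {a} \<times> UNIV) \<noteq> {}" using ab by auto
  ultimately obtain m where m: "m \<in> snd ` (jset X \<inter> {a} \<times> UNIV)" "\<And>y. y \<in> snd ` (jset X \<inter> {a} \<times> UNIV) \<Longrightarrow> y \<le> m"
    using compact_attains_sup by metis
  then have "(a, m) \<in> jset X" by auto
  then obtain d where d: "0 < d" "\<And>t. t \<in> {-d<..<d} \<Longrightarrow> (a, m + t * a) \<in> jset X"
    using jset_flow[OF X jac] by blast
  \<comment> \<open>The direction of time is chosen by the sign of a, so that t a > 0 and the second
    coordinate exceeds the maximum m.\<close>
  define t where "t = (if a > 0 then d / 2 else - d / 2)"
  have "t \<in> {-d<..<d}" "t * a > 0" using d(1) a by (auto simp: t_def mult_pos_neg)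
  moreover from this have "m + t * a \<in> snd ` (jset X \<inter> {a} \<times> UNIV)" using d(2)[of t] by force
  ultimately show False using m(2) by fastforce
qed

text \<open>The vanishing first coordinate concerns unit vectors; quadratic homogeneity extends it
  to all vectors and polarisation gives skewness.\<close>

lemma global_jacobi_imp_killing:
  assumes X: "smooth_vfield_on A (mcarrier A) X" and M: "compact (mcarrier A)" and jac: "global_jacobi A nabla X"
  shows "killing A g X"
  unfolding killing_iff_skew[OF X]
proof
  fix c assume c: "c \<in> A"
  interpret L: local_metric "cmap c ` cdom c" "chr c" "met c" by (rule local_metric_chart[OF c])
  note rX = rep_smooth_cdom[OF X c]
  show "lskew c (rep c X)"
  proof (rule L.skew_cov_diagonal[OF rX])
    fix x u assume x: "x \<in> cmap c ` cdom c"
    show "met c x (lcov c (rep c X) x u) u = 0"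
    proof (cases "u = 0")
      case False
      \<comment> \<open>The length of u in the metric g, used to rescale u to a unit vector.\<close>
      define n where "n = sqrt (met c x u u)"
      have n: "n > 0" "n * n = met c x u u" using L.G_pos[OF x False] by (auto simp: n_def)
      have "met c x (u /\<^sub>R n) (u /\<^sub>R n) = 1"
        using n L.G_pos[OF x False] by (simp add: L.G_lin x field_simps)
      from ljpair_in_jset[OF X c x this]
      have "met c x (lcov c (rep c X) x (u /\<^sub>R n)) (u /\<^sub>R n) = 0"
        unfolding ljpair_def by (rule jset_fst_eq_0[OF X M jac])
      then show ?thesis
        using n(1) by (simp add: L.G_lin x linear_scale[OF L.cov_linear[OF rX x]])
    qed (simp add: linear_0[OF L.G_linear_right] x)
  qed
qed

end

theorem theoremA:
  fixes A :: "('a::{t2_space,second_countable_topology}, 'e::{real_inner,heine_borel,banach}) chart set"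
    and g :: "('a, 'e) metric"
    and nabla :: "('a, 'e) connection"
    and X :: "('a, 'e) vfield"
  assumes "smooth_atlas A"
    and "compact (mcarrier A)"
    and "riemannian_metric A g"
    and "levi_civita A g nabla"
    and "smooth_vfield_on A (mcarrier A) X"
  shows "(killing A g X \<longrightarrow> global_jacobi A nabla X \<and> solenoidal A nabla X) \<and>
         (global_jacobi A nabla X \<longrightarrow> killing A g X \<and> solenoidal A nabla X)"
proof -
  interpret riemannian_manifold A g nabla
    by (intro riemannian_manifold.intro atlas.intro riemannian_manifold_axioms.intro assms)
  \<comment> \<open>Solenoidality in the second implication is inherited from the first through the
    Killing property.\<close>
  show ?thesis
    using killing_imp_global_jacobi[OF assms(5)] killing_imp_solenoidal[OF assms(5)]
      global_jacobi_imp_killing[OF assms(5,2)] by blast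
qed

end
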